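(* Let $p\in[1,+\infty)$, $T>0$, and let $V:[0,T]\times\mathcal{P}_p(\mathbb{R}^d)\rightrightarrows C^0(\mathbb{R}^d,\mathbb{R}^d)$ be a set-valued map satisfying Hypotheses (CI) (listed in the context). Then there exists a subset $\mathcal{T}\subset(0,T)$ of full Lebesgue measure $\mathcal{L}^1$ such that for every $\tau\in\mathcal{T}$, all $\mu_\tau\in\mathcal{P}_p(\mathbb{R}^d)$, each $v_\tau\in V(\tau,\mu_\tau)$ and any $\varepsilon>0$, there exist some $h_\varepsilon>0$ and a curve $\mu_\varepsilon(\cdot)\in\mathcal{S}_{[0,T]}(\tau,\mu_\tau)$ such that $$W_p\Big(\mu_\varepsilon(\tau+h),(\mathrm{Id}+h v_\tau)_\sharp\mu_\tau\Big)\le\varepsilon h\qquad\text{for all } h\in[0,h_\varepsilon].$$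
   Context: $\mathcal{P}_p(\mathbb{R}^d)$ is the set of Borel probability measures on $\mathbb{R}^d$ with finite moment $\mathcal{M}_p(\mu)=(\int|x|^p\,d\mu(x))^{1/p}$, endowed with the Wasserstein distance $W_p$ of order $p$; $f_\sharp\mu$ is the image measure of $\mu$ through $f$. $C^0(\mathbb{R}^d,\mathbb{R}^d)$ is endowed with the separable Fréchet topology of locally uniform convergence, induced by $d_{cc}(v,w)=\sum_{k\ge1}2^{-k}\min\{1,\|v-w\|_{C^0(B(0,k),\mathbb{R}^d)}\}$. We write $d_{\sup}(v,w)=\sup_{x\in\mathbb{R}^d}|v(x)-w(x)|\in[0,+\infty]$, and $\mathrm{Lip}(v;\mathbb{R}^d)$ for the Lipschitz constant of $v$. A set-valued map $F:I\rightrightarrows X$ is $\mathcal{L}^1$-measurable if $\{t\in I: F(t)\cap O\neq\emptyset\}$ is $\mathcal{L}^1$-measurable for every open $O\subset X$. Hypotheses (CI): (i) for any $\mu\in\mathcal{P}_p(\mathbb{R}^d)$, the map $t\in[0,T]\rightrightarrows V(t,\mu)\subset C^0(\mathbb{R}^d,\mathbb{R}^d)$ is $\mathcal{L}^1$-measurable with closed nonempty images; (ii) there is $m(\cdot)\in L^1([0,T],\mathbb{R}_+)$ such that for $\mathcal{L}^1$-a.e. $t\in[0,T]$, any $\mu\in\mathcal{P}_p(\mathbb{R}^d)$, every $v\in V(t,\mu)$ and all $x\in\mathbb{R}^d$, $|v(x)|\le m(t)(1+|x|+\mathcal{M}_p(\mu))$; (iii) there is $l(\cdot)\in L^1([0,T],\mathbb{R}_+)$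 such that for $\mathcal{L}^1$-a.e. $t\in[0,T]$, any $\mu\in\mathcal{P}_p(\mathbb{R}^d)$ and every $v\in V(t,\mu)$, $\mathrm{Lip}(v;\mathbb{R}^d)\le l(t)$; (iv) there is $L(\cdot)\in L^1([0,T],\mathbb{R}_+)$ such that for $\mathcal{L}^1$-a.e. $t\in[0,T]$, any $\mu,\nu\in\mathcal{P}_p(\mathbb{R}^d)$ and each $v\in V(t,\mu)$, there is $w\in V(t,\nu)$ with $d_{\sup}(v,w)\le L(t)W_p(\mu,\nu)$. Solutions: $\mathcal{S}_{[0,T]}(\tau,\mu_\tau)$ is the set of all absolutely continuous curves $\mu(\cdot)\in AC([0,T],\mathcal{P}_p(\mathbb{R}^d))$ with $\mu(\tau)=\mu_\tau$ that solve the continuity inclusion $\partial_t\mu(t)\in-\mathrm{div}_x(V(t,\mu(t))\mu(t))$, i.e. for which there is an $\mathcal{L}^1$-measurable selection $t\in[0,T]\mapsto v(t)\in V(t,\mu(t))$ (belonging to $V(t,\mu(t))$ for a.e. $t$) such that $\partial_t\mu(t)+\mathrm{div}_x(v(t)\mu(t))=0$ in the sense of distributions: $\int_0^T\int_{\mathbb{R}^d}(\partial_t\varphi(t,x)+\langle\nabla_x\varphi(t,x),v(t,x)\rangle)\,d\mu(t)(x)\,dt=0$ for all $\varphi\in C_c^\infty((0,T)\times\mathbb{R}^d,\mathbb{R})$. *)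

theory Defs
  imports "HOL-Probability.Probability"
begin

section \<open>Wasserstein spaces\<close>

definition Pp :: "real \<Rightarrow> 'a::euclidean_space measure set" where
  "Pp p = {\<mu>. prob_space \<mu> \<and> sets \<mu> = sets borel \<and> integrable \<mu> (\<lambda>x. norm x powr p)}"

definition moment :: "real \<Rightarrow> 'a::euclidean_space measure \<Rightarrow> real" where
  "moment p \<mu> = (\<integral>x. norm x powr p \<partial>\<mu>) powr (1 / p)"

definition couplings ::
    "'a::euclidean_space measure \<Rightarrow> 'a measure \<Rightarrow> ('a \<times> 'a) measure set" where
  "couplings \<mu> \<nu> = {\<gamma>. prob_space \<gamma> \<and> sets \<gamma> = sets borel \<and>
     distr \<gamma> borel fst = \<mu> \<and> distr \<gamma> borel snd = \<nu>}"

text \<open>The value \<open>\<infinity>\<close> is kept, so that an upper bound on the distance is never satisfied by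
  a measure without finite moment merely because of a convention for divergent integrals.\<close>

definition Wp :: "real \<Rightarrow> 'a::euclidean_space measure \<Rightarrow> 'a measure \<Rightarrow> ennreal" where
  "Wp p \<mu> \<nu> =
     (let c = (INF \<gamma>\<in>couplings \<mu> \<nu>. \<integral>\<^sup>+ (x, y). ennreal (norm (x - y) powr p) \<partial>\<gamma>)
      in if c = \<infinity> then \<infinity> else ennreal (enn2real c powr (1 / p)))"

section \<open>The Frechet space of continuous vector fields\<close>

definition C0 :: "('a::euclidean_space \<Rightarrow> 'a) set" where
  "C0 = {v. continuous_on UNIV v}"

definition sup_dist :: "'a set \<Rightarrow> ('a::euclidean_space \<Rightarrow> 'a) \<Rightarrow> ('a \<Rightarrow> 'a) \<Rightarrow> ennreal" where
  "sup_dist S v w = (SUP x\<in>S. ennreal (norm (v x - w x)))"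

abbreviation d_sup :: "('a::euclidean_space \<Rightarrow> 'a) \<Rightarrow> ('a \<Rightarrow> 'a) \<Rightarrow> ennreal" where
  "d_sup \<equiv> sup_dist UNIV"

text \<open>The series starts at \<open>k = 0\<close>, hence the successors.\<close>

definition d_cc :: "('a::euclidean_space \<Rightarrow> 'a) \<Rightarrow> ('a \<Rightarrow> 'a) \<Rightarrow> real" where
  "d_cc v w = (\<Sum>k. (1 / 2) ^ Suc k * enn2real (min 1 (sup_dist (cball 0 (real (Suc k))) v w)))"

definition cc_topology :: "('a::euclidean_space \<Rightarrow> 'a) topology" where
  "cc_topology = Metric_space.mtopology C0 d_cc"

lemma enn2real_min_le1: "enn2real (min 1 x) \<le> 1"
proof -
  have "enn2real (min 1 x) \<le> enn2real 1"
    by (rule enn2real_mono) auto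
  then show ?thesis by simp
qed

lemma summable_d_cc:
  "summable (\<lambda>k. (1 / 2) ^ Suc k * enn2real (min 1 (sup_dist (cball 0 (real (Suc k))) v w)))"
proof (rule summable_comparison_test')
  show "summable (\<lambda>k. (1 / 2 :: real) ^ Suc k)"
    by (subst summable_Suc_iff) (rule summable_geometric, simp)
  show "norm ((1 / 2) ^ Suc k * enn2real (min 1 (sup_dist (cball 0 (real (Suc k))) v w)))
      \<le> (1 / 2 :: real) ^ Suc k" for k
    using mult_left_mono[OF enn2real_min_le1, of "(1 / 2) ^ Suc k"] by (simp add: abs_mult)
qed

lemma sup_dist_triangle: "sup_dist S u w \<le> sup_dist S u v + sup_dist S v w"
  unfolding sup_dist_def
proof (rule SUP_least)
  fix x assume x: "x \<in> S"
  have "ennreal (norm (u x - w x)) \<le> ennreal (norm (u x - v x) + norm (v x - w x))"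
    using norm_triangle_ineq[of "u x - v x" "v x - w x"] by (intro ennreal_leI) simp
  also have "\<dots> = ennreal (norm (u x - v x)) + ennreal (norm (v x - w x))"
    by simp
  also have "\<dots> \<le> (SUP x\<in>S. ennreal (norm (u x - v x))) + (SUP x\<in>S. ennreal (norm (v x - w x)))"
    using x by (intro add_mono SUP_upper)
  finally show "ennreal (norm (u x - w x)) \<le> \<dots>" .
qed

lemma Metric_space_d_cc: "Metric_space C0 d_cc"
proof
  fix u v w :: "'a::euclidean_space \<Rightarrow> 'a"
  show "0 \<le> d_cc u v"
    unfolding d_cc_def by (rule suminf_nonneg[OF summable_d_cc]) simp
  show "d_cc u v = d_cc v u"
    by (simp add: d_cc_def sup_dist_def norm_minus_commute)
  show "d_cc u v = 0 \<longleftrightarrow> u = v"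
  proof
    assume "d_cc u v = 0"
    then have z: "\<And>k. (1 / 2) ^ Suc k
        * enn2real (min 1 (sup_dist (cball 0 (real (Suc k))) u v)) = 0"
      unfolding d_cc_def by (subst (asm) suminf_eq_zero_iff[OF summable_d_cc]) auto
    show "u = v"
    proof
      fix x :: 'a
      obtain k where k: "norm x \<le> real k" using real_arch_simple by blast
      have "enn2real (min 1 (sup_dist (cball 0 (real (Suc k))) u v)) = 0"
        using z[of k] by simp
      then have "min 1 (sup_dist (cball 0 (real (Suc k))) u v) = 0"
        by (auto simp: enn2real_eq_0_iff min_def split: if_splits)
      then have "sup_dist (cball 0 (real (Suc k))) u v = 0"
        by (simp add: min_def split: if_splits)
      moreover have "ennreal (norm (u x - v x)) \<le> sup_dist (cball 0 (real (Suc k))) u v"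
        unfolding sup_dist_def using k by (intro SUP_upper) simp
      ultimately show "u x = v x" by simp
    qed
  next
    assume "u = v"
    then show "d_cc u v = 0" by (simp add: d_cc_def sup_dist_def)
  qed
  have le: "enn2real (min 1 (sup_dist S u w))
      \<le> enn2real (min 1 (sup_dist S u v)) + enn2real (min 1 (sup_dist S v w))" for S
  proof -
    let ?a = "min 1 (sup_dist S u v)" and ?b = "min 1 (sup_dist S v w)"
    have fin: "?a < \<top>" "?b < \<top>" by (auto simp: min_less_iff_disj)
    have "min 1 (sup_dist S u w) \<le> ?a + ?b"
    proof (cases "1 \<le> sup_dist S u v \<or> 1 \<le> sup_dist S v w")
      case True
      then have "1 \<le> ?a + ?b" 
        by (metis add_increasing add_increasing2 min.absorb1 order.refl zero_le)
      then show ?thesis by (rule min.coboundedI1)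
    next
      case False
      then have "?a + ?b = sup_dist S u v + sup_dist S v w"
        by (simp add: min.absorb2 not_le less_imp_le)
      then show ?thesis using sup_dist_triangle[of S u w v] by (metis min.coboundedI2)
    qed
    then have "enn2real (min 1 (sup_dist S u w)) \<le> enn2real (?a + ?b)"
      using fin by (intro enn2real_mono) auto
    also have "\<dots> = enn2real ?a + enn2real ?b"
      using fin by (intro enn2real_plus) auto
    finally show ?thesis .
  qed
  show "d_cc u w \<le> d_cc u v + d_cc v w"
    unfolding d_cc_def suminf_add[OF summable_d_cc summable_d_cc]
  proof (rule suminf_le)
    show "(1 / 2) ^ Suc k * enn2real (min 1 (sup_dist (cball 0 (real (Suc k))) u w))
      \<le> (1 / 2) ^ Suc k * enn2real (min 1 (sup_dist (cball 0 (real (Suc k))) u v))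
        + (1 / 2) ^ Suc k * enn2real (min 1 (sup_dist (cball 0 (real (Suc k))) v w))" for k
      unfolding distrib_left[symmetric] by (rule mult_left_mono[OF le]) simp
  qed (intro summable_add summable_d_cc)+
qed

section \<open>Measurability on the time interval\<close>

definition L1_nonneg :: "real \<Rightarrow> (real \<Rightarrow> real) set" where
  "L1_nonneg T = {g. integrable (lebesgue_on {0..T}) g \<and> (\<forall>t\<in>{0..T}. 0 \<le> g t)}"

definition setvalued_measurable ::
    "real \<Rightarrow> (real \<Rightarrow> ('a::euclidean_space \<Rightarrow> 'a) set) \<Rightarrow> bool" where
  "setvalued_measurable T F \<longleftrightarrow>
     (\<forall>U. openin cc_topology U \<longrightarrow> {t\<in>{0..T}. F t \<inter> U \<noteq> {}} \<in> sets lebesgue)"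

definition field_measurable :: "real \<Rightarrow> (real \<Rightarrow> 'a::euclidean_space \<Rightarrow> 'a) \<Rightarrow> bool" where
  "field_measurable T v \<longleftrightarrow>
     v \<in> lebesgue_on {0..T} \<rightarrow>\<^sub>M sigma C0 {U. openin cc_topology U}"

definition hypotheses_CI ::
    "real \<Rightarrow> real \<Rightarrow> (real \<Rightarrow> 'a::euclidean_space measure \<Rightarrow> ('a \<Rightarrow> 'a) set) \<Rightarrow> bool" where
  "hypotheses_CI p T V \<longleftrightarrow>
     (\<forall>\<mu>\<in>Pp p. setvalued_measurable T (\<lambda>t. V t \<mu>) \<and>
        (\<forall>t\<in>{0..T}. closedin cc_topology (V t \<mu>) \<and> V t \<mu> \<noteq> {})) \<and>
     (\<exists>m\<in>L1_nonneg T. AE t in lebesgue_on {0..T}. \<forall>\<mu>\<in>Pp p. \<forall>v\<in>V t \<mu>. \<forall>x.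
        norm (v x) \<le> m t * (1 + norm x + moment p \<mu>)) \<and>
     (\<exists>l\<in>L1_nonneg T. AE t in lebesgue_on {0..T}. \<forall>\<mu>\<in>Pp p. \<forall>v\<in>V t \<mu>.
        (l t)-lipschitz_on UNIV v) \<and>
     (\<exists>L\<in>L1_nonneg T. AE t in lebesgue_on {0..T}. \<forall>\<mu>\<in>Pp p. \<forall>\<nu>\<in>Pp p. \<forall>v\<in>V t \<mu>.
        \<exists>w\<in>V t \<nu>. d_sup v w \<le> ennreal (L t) * Wp p \<mu> \<nu>)"

section \<open>Continuity inclusions\<close>

definition AC_curves :: "real \<Rightarrow> real \<Rightarrow> (real \<Rightarrow> 'a::euclidean_space measure) set" where
  "AC_curves p T = {\<mu>. (\<forall>t\<in>{0..T}. \<mu> t \<in> Pp p) \<and>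
     (\<exists>g\<in>L1_nonneg T. \<forall>s t. 0 \<le> s \<and> s \<le> t \<and> t \<le> T \<longrightarrow>
        Wp p (\<mu> s) (\<mu> t) \<le> ennreal (\<integral>r. g r \<partial>lebesgue_on {s..t}))}"

primrec Ck :: "nat \<Rightarrow> ('b::euclidean_space \<Rightarrow> real) \<Rightarrow> bool" where
  "Ck 0 f \<longleftrightarrow> continuous_on UNIV f"
| "Ck (Suc k) f \<longleftrightarrow> (\<forall>x. f differentiable at x) \<and>
     (\<forall>b\<in>Basis. Ck k (\<lambda>x. frechet_derivative f (at x) b))"

text \<open>Functions in \<open>C\<^sub>c\<^sup>\<infinity>((0,T) \<times> \<real>\<^sup>d)\<close> are represented by their extension by zero.\<close>

definition test_functions :: "real \<Rightarrow> (real \<times> 'a::euclidean_space \<Rightarrow> real) set" where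
  "test_functions T = {\<phi>. (\<forall>k. Ck k \<phi>) \<and> compact (closure {z. \<phi> z \<noteq> 0}) \<and>
     closure {z. \<phi> z \<noteq> 0} \<subseteq> {0<..<T} \<times> UNIV}"

definition grad :: "('a::euclidean_space \<Rightarrow> real) \<Rightarrow> 'a \<Rightarrow> 'a" where
  "grad f x = (THE D. GDERIV f x :> D)"

text \<open>Stating the vanishing of the time integral with \<^const>\<open>has_bochner_integral\<close> rules out that the
  equation holds only because the integral of a non-integrable function is zero by convention.\<close>

definition continuity_equation ::
    "real \<Rightarrow> (real \<Rightarrow> 'a::euclidean_space \<Rightarrow> 'a) \<Rightarrow> (real \<Rightarrow> 'a measure) \<Rightarrow> bool" where
  "continuity_equation T v \<mu> \<longleftrightarrow>
     (\<forall>\<phi>\<in>test_functions T. has_bochner_integral (lebesgue_on {0..T})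
        (\<lambda>t. \<integral>x. deriv (\<lambda>s. \<phi> (s, x)) t + grad (\<lambda>y. \<phi> (t, y)) x \<bullet> v t x \<partial>\<mu> t) 0)"

definition solutions ::
    "real \<Rightarrow> real \<Rightarrow> (real \<Rightarrow> 'a::euclidean_space measure \<Rightarrow> ('a \<Rightarrow> 'a) set) \<Rightarrow>
     real \<Rightarrow> 'a measure \<Rightarrow> (real \<Rightarrow> 'a measure) set" where
  "solutions p T V \<tau> \<mu>\<^sub>\<tau> = {\<mu>\<in>AC_curves p T. \<mu> \<tau> = \<mu>\<^sub>\<tau> \<and>
     (\<exists>v. field_measurable T v \<and> (AE t in lebesgue_on {0..T}. v t \<in> V t (\<mu> t)) \<and>
        continuity_equation T v \<mu>)}"

end

theory Submission
  imports Defs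
begin

text \<open>
  The measures of a solution are represented as laws of particle positions \<open>X t x\<close>, where the
  starting point \<open>x\<close> at time \<open>\<tau>\<close> is distributed according to the prescribed measure. The inclusion
  is then solved by a Filippov iteration on the pairs of a motion and a velocity: the motion is
  updated by integrating the velocity, and the velocity by selecting, in the set attached to the
  new law, a measurable field at a supremum distance from the old one of at most \<open>L t\<close> times a bound
  for the distance of the laws (\<open>filippov_step\<close>). If displacements are measured relative to \<open>1 + \<bar>x\<bar>\<close>, the
  errors decay like the terms of an exponential series, in both time directions at once, and no
  flow of an ordinary differential equation has to be constructed. The limit is a solution whose
  velocity differs from the first one, \<open>v0\<close>, by \<open>L t\<close> times a quantity vanishing at \<open>\<tau>\<close>
  (\<open>filippov_existence\<close>), and its laws solve the continuity equation because a test function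
  integrates to zero along every particle path (\<open>law_continuity_equation\<close>).

  The iteration starts from the motionless particles, so \<open>v0\<close> may be any measurable selection along
  the constant curve. It remains to find \<open>v0\<close> close to the prescribed velocity in the mean on short
  intervals after \<open>\<tau>\<close> (\<open>initial_selection\<close>). This is possible whenever the means over
  short intervals after \<open>\<tau>\<close> are asymptotically at most the values at \<open>\<tau>\<close>, for the functions \<open>m\<close>, \<open>l\<close>,
  \<open>L\<close> and for countably many functions measuring how well the fields in \<open>V t \<nu>\<close> can match given
  values at finitely many points; the separability of the space of measures (\<open>Pp_separable\<close>) and
  the Lipschitz dependence of \<open>V\<close> on the measure extend this to all measures and velocities, which
  is why one null set of times suffices.

  Measurable selections exist because, at each time, the growth and Lipschitz bounds make the set of
  fields compact. Fields are encoded by their values on a dense sequence of points; for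
  compact-valued maps into sequences, closed constraints preserve measurability, and successive
  minimisation of the coordinates yields a selection (\<open>measurable_selection_of_functionals\<close>).
\<close>

section \<open>Upper means of integrable functions\<close>

text \<open>On the set where the density lies below \<open>a\<close> but arbitrarily short intervals to the
  right of the point carry mass above \<open>b\<close> times their length, these intervals form a Vitali
  cover. A disjoint subfamily filling the set has mass at least \<open>b\<close> times its length, whereas
  inside an open set that approximates \<open>{f < a}\<close> for the measure with density \<open>f\<close> the mass is
  at most \<open>a\<close> times the length plus a small error. Hence the length is small.\<close>

lemma density_mean_gap_negligible:
  fixes f :: "real \<Rightarrow> real" and a b :: real
  assumes f[measurable]: "f \<in> borel_measurable borel" and f0: "\<And>x. 0 \<le> f x"
    and fin: "emeasure (density lborel (\<lambda>x. ennreal (f x))) UNIV \<noteq> \<infinity>" and ab: "0 < a" "a < b"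
  shows "negligible {x. f x < a \<and> (\<forall>h0>0. \<exists>h. 0 < h \<and> h < h0 \<and>
            emeasure (density lborel (\<lambda>x. ennreal (f x))) {x..x+h} > ennreal (b * h))}"
    (is "negligible ?S")
proof -
  define N where "N = density lborel (\<lambda>x. ennreal (f x))"
  have sN[simp, measurable_cong]: "sets N = sets borel" by (simp add: N_def)
  have spN: "space N = UNIV" by (simp add: N_def)
  define E where "E = {x. f x < a}"
  have E[measurable]: "E \<in> sets borel" unfolding E_def by measurable
  have finN: "emeasure N A \<noteq> \<infinity>" if "A \<in> sets borel" for A
    using emeasure_mono[of A UNIV N] fin by (auto simp: N_def top_unique)
  show ?thesis
    unfolding negligible_outer_le
  proof (intro allI impI)
    fix e :: real assume e: "0 < e"
    define \<delta> where "\<delta> = e * (b - a)"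
    have \<delta>: "0 < \<delta>" using e ab by (simp add: \<delta>_def)
    have "emeasure N E = (INF U \<in> {U. E \<subseteq> U \<and> open U}. emeasure N U)"
      using fin by (intro outer_regular) (auto simp: N_def[symmetric] spN)
    moreover have "emeasure N E < emeasure N E + ennreal \<delta>"
      using finN[OF E] \<delta> ennreal_add_left_cancel_less[of "emeasure N E" 0 "ennreal \<delta>"] by simp
    ultimately obtain G where G: "E \<subseteq> G" "open G" "emeasure N G < emeasure N E + ennreal \<delta>"
      by (auto simp: INF_less_iff)
    have Gm[measurable]: "G \<in> sets borel" using G by simp
    have "emeasure N (G - E) = emeasure N G - emeasure N E"
      using G finN[OF E] by (intro emeasure_Diff) auto
    also have "\<dots> \<le> ennreal \<delta>"
      using G(3) finN[OF E] by (simp add: ennreal_minus_le_iff less_top add.commute less_imp_le)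
    finally have GE: "emeasure N (G - E) \<le> ennreal \<delta>" .
    define K where "K = {(x, h). x \<in> ?S \<and> 0 < h \<and> {x..x+h} \<subseteq> G \<and> emeasure N {x..x+h} > ennreal (b * h)}"
    define c where "c = (\<lambda>(x::real, h). x + h / 2)"
    define r where "r = (\<lambda>(x::real, h::real). h / 2)"
    have I: "cball (c i) (r i) = {fst i .. fst i + snd i}" for i
      by (auto simp: c_def r_def cball_eq_atLeastAtMost split: prod.splits)
    obtain C where C: "countable C" "C \<subseteq> K"
       "pairwise (\<lambda>i j. disjnt (cball (c i) (r i)) (cball (c j) (r j))) C"
       "negligible(?S - (\<Union>i \<in> C. cball (c i) (r i)))"
    proof (rule Vitali_covering_theorem_cballs[of K r ?S c])
      show "0 < r i" if "i \<in> K" for i using that by (auto simp: K_def r_def)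
      fix x d :: real assume x: "x \<in> ?S" and d: "0 < d"
      then have "x \<in> G" using G by (auto simp: E_def)
      then obtain d' where d': "0 < d'" "ball x d' \<subseteq> G" using G(2) open_contains_ball by blast
      have "0 < min d d'" using d d' by simp
      with x obtain h where h: "0 < h" "h < min d d'" "emeasure N {x..x+h} > ennreal (b * h)"
        unfolding N_def by blast
      have "{x..x+h} \<subseteq> G" using h d' by (auto simp: ball_def dist_real_def subset_eq)
      then have "(x, h) \<in> K" using x h by (simp add: K_def)
      moreover have "x \<in> cball (c (x,h)) (r (x,h))" using h by (auto simp: I)
      moreover have "r (x,h) < d" using h by (simp add: r_def)
      ultimately show "\<exists>i. i \<in> K \<and> x \<in> cball (c i) (r i) \<and> r i < d" by blast
    qed
    define U where "U = (\<Union>i\<in>C. cball (c i) (r i))"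
    have U[measurable]: "U \<in> sets borel" unfolding U_def using C(1) by auto
    have disj: "disjoint_family_on (\<lambda>i. cball (c i) (r i)) C"
      using C(3) by (auto simp: disjoint_family_on_def pairwise_def disjnt_def)
    have UG: "U \<subseteq> G" using C(2) unfolding U_def I K_def by (force simp: subset_eq)
    have "ennreal b * emeasure lborel U = (\<integral>\<^sup>+i. ennreal b * emeasure lborel (cball (c i) (r i)) \<partial>count_space C)"
      unfolding U_def using C disj by (subst emeasure_UN_countable) (auto simp: nn_integral_cmult)
    also have "\<dots> \<le> (\<integral>\<^sup>+i. emeasure N (cball (c i) (r i)) \<partial>count_space C)"
    proof (rule nn_integral_mono)
      fix i assume "i \<in> space (count_space C)"
      then have "i \<in> K" using C by auto
      then show "ennreal b * emeasure lborel (cball (c i) (r i)) \<le> emeasure N (cball (c i) (r i))"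
        unfolding I using ab by (auto simp: K_def ennreal_mult[symmetric] less_imp_le)
    qed
    also have "\<dots> = emeasure N U"
      unfolding U_def using C disj by (subst emeasure_UN_countable) auto
    finally have bU: "ennreal b * emeasure lborel U \<le> emeasure N U" .
    have "emeasure N U \<le> emeasure N ((U \<inter> E) \<union> (G - E))"
      using UG by (intro emeasure_mono) auto
    also have "\<dots> \<le> emeasure N (U \<inter> E) + emeasure N (G - E)"
      by (rule emeasure_subadditive) auto
    also have "emeasure N (U \<inter> E) = (\<integral>\<^sup>+x. ennreal (f x) * indicator (U \<inter> E) x \<partial>lborel)"
      unfolding N_def by (rule emeasure_density) auto
    also have "\<dots> \<le> (\<integral>\<^sup>+x. ennreal a * indicator U x \<partial>lborel)"
      by (intro nn_integral_mono) (auto simp: E_def indicator_def intro!: ennreal_leI)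
    also have "\<dots> = ennreal a * emeasure lborel U"
      by (simp add: nn_integral_cmult_indicator)
    finally have NU: "emeasure N U \<le> ennreal a * emeasure lborel U + ennreal \<delta>"
      using add_left_mono[OF GE, of "ennreal a * emeasure lborel U"] by (auto intro: order_trans add_right_mono)
    have "ennreal b * emeasure lborel U < \<infinity>"
      using order.strict_trans1[OF bU] finN[OF U] by (simp add: less_top)
    then have Ufin: "emeasure lborel U < \<infinity>" using ab by (auto simp: ennreal_mult_less_top)
    then obtain u where u: "emeasure lborel U = ennreal u" "0 \<le> u"
      by (metis infinity_ennreal_def less_top_ennreal)
    have "ennreal (b * u) \<le> ennreal (a * u + \<delta>)"
      using order_trans[OF bU NU] u ab \<delta> by (simp add: ennreal_mult ennreal_plus)
    then have "b * u \<le> a * u + \<delta>"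
      using u ab \<delta> by (subst (asm) ennreal_le_iff) (auto intro!: add_nonneg_nonneg)
    then have "u * (b - a) \<le> e * (b - a)" by (simp add: \<delta>_def algebra_simps)
    then have ue: "u \<le> e" using ab by simp
    have Ul: "U \<in> lmeasurable"
      using Ufin by (auto simp: fmeasurable_def)
    define Z where "Z = ?S - U"
    have Z: "negligible Z" using C(4) by (simp add: Z_def U_def)
    have "U \<union> Z \<in> lmeasurable" using Ul Z by (simp add: negligible_imp_measurable fmeasurable.Un)
    moreover have "measure lebesgue (U \<union> Z) \<le> e"
    proof -
      have "measure lebesgue (U \<union> Z) \<le> measure lebesgue U + measure lebesgue Z"
        using Ul Z by (intro measure_Un_le) (auto simp: fmeasurableD negligible_iff_null_sets)
      also have "measure lebesgue Z = 0" using Z negligible_imp_measure0 by blast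
      also have "measure lebesgue U = u" using u U by (simp add: measure_def)
      finally show ?thesis using ue by simp
    qed
    moreover have "?S \<subseteq> U \<union> Z" by (auto simp: Z_def)
    ultimately show "\<exists>T. ?S \<subseteq> T \<and> T \<in> lmeasurable \<and> measure lebesgue T \<le> e" by blast
  qed
qed

text \<open>One half of the Lebesgue differentiation theorem, for means over intervals to the right of
  the point: an upper bound for the means of a nonnegative function is all that the final estimate
  requires. The exceptional set is a union over pairs of rationals.\<close>

lemma integral_upper_derivative_ae:
  fixes f :: "real \<Rightarrow> real"
  assumes f: "f absolutely_integrable_on {a..b}" and f0: "\<And>x. x \<in> {a..b} \<Longrightarrow> 0 \<le> f x"
  shows "\<exists>Z. negligible Z \<and> (\<forall>x\<in>{a<..<b} - Z. \<forall>e>0. \<exists>h0>0. x + h0 \<le> b \<and>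
            (\<forall>h\<in>{0..h0}. integral {x..x+h} f \<le> (f x + e) * h))"
proof -
  have "(\<lambda>x. indicator {a..b} x *\<^sub>R f x) \<in> borel_measurable (completion lborel)"
    using f unfolding set_integrable_def by blast
  then obtain g0 where g0: "g0 \<in> borel_measurable lborel"
      "AE x in lborel. indicator {a..b} x *\<^sub>R f x = g0 x"
    using completion_ex_borel_measurable_real[of "\<lambda>x. indicator {a..b} x *\<^sub>R f x" lborel] by auto
  define g where "g = (\<lambda>x. \<bar>g0 x\<bar>)"
  have g[measurable]: "g \<in> borel_measurable borel" using g0(1) by (simp add: g_def)
  have gp: "0 \<le> g x" for x by (simp add: g_def)
  have ae: "AE x in lborel. indicator {a..b} x * f x = g x"
    using g0(2)
  proof eventually_elim
    case (elim x)
    have "0 \<le> indicator {a..b} x * f x" using f0[of x] by (simp add: indicator_def)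
    then show ?case using elim by (simp add: g_def)
  qed
  obtain Z0 where Z0: "negligible Z0" "\<And>x. x \<notin> Z0 \<Longrightarrow> indicator {a..b} x * f x = g x"
  proof -
    from ae obtain N where N: "{x \<in> space lborel. \<not> indicator {a..b} x * f x = g x} \<subseteq> N" "N \<in> null_sets lborel"
      by (auto elim!: AE_E2 simp: eventually_ae_filter)
    have "negligible N" using N(2) by (meson negligible_iff_null_sets null_sets_completionI)
    with N(1) show ?thesis using that by auto
  qed
  define N where "N = density lborel (\<lambda>x. ennreal (g x))"
  have NI: "emeasure N {x..y} = ennreal (integral {x..y} f)" if "a \<le> x" "y \<le> b" for x y
  proof -
    have "emeasure N {x..y} = (\<integral>\<^sup>+t. ennreal (g t) * indicator {x..y} t \<partial>lborel)"
      unfolding N_def by (rule emeasure_density) auto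
    also have "\<dots> = (\<integral>\<^sup>+t. ennreal (indicator {x..y} t * g t) \<partial>lborel)"
      by (intro nn_integral_cong) (auto simp: indicator_def)
    also have "\<dots> = ennreal (integral {x..y} f)"
    proof (rule nn_integral_has_integral_lborel)
      show "(\<lambda>t. indicator {x..y} t * g t) \<in> borel_measurable borel" by measurable
      show "0 \<le> indicator {x..y} t * g t" for t using gp by auto
      have "f integrable_on {x..y}"
        using f that by (meson absolutely_integrable_on_def atLeastatMost_subset_iff integrable_on_subinterval)
      then have "(f has_integral integral {x..y} f) {x..y}" by (rule integrable_integral)
      then have "((\<lambda>t. if t \<in> {x..y} then f t else 0) has_integral integral {x..y} f) UNIV"
        using has_integral_restrict_UNIV[of "{x..y}" f] by simp
      then show "((\<lambda>t. indicator {x..y} t * g t) has_integral integral {x..y} f) UNIV"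
        by (rule has_integral_spike[OF Z0(1), rotated]) (use Z0(2) that in \<open>force simp: indicator_def\<close>)
    qed
    finally show ?thesis .
  qed
  have "emeasure N UNIV = emeasure N {a..b}"
  proof -
    have "emeasure N UNIV = (\<integral>\<^sup>+t. ennreal (g t) \<partial>lborel)"
      unfolding N_def by (subst emeasure_density) auto
    also have "\<dots> = (\<integral>\<^sup>+t. ennreal (g t) * indicator {a..b} t \<partial>lborel)"
      using ae by (intro nn_integral_cong_AE) (auto simp: indicator_def)
    also have "\<dots> = emeasure N {a..b}" unfolding N_def by (subst emeasure_density) auto
    finally show ?thesis .
  qed
  then have fin: "emeasure N UNIV \<noteq> \<infinity>" using NI[of a b] by simp
  define Bad where "Bad = (\<lambda>(p::real, q::real). {x. g x < p \<and> (\<forall>h0>0. \<exists>h. 0 < h \<and> h < h0 \<and>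
            emeasure N {x..x+h} > ennreal (q * h))})"
  define Q where "Q = {(p, q). p \<in> \<rat> \<and> q \<in> \<rat> \<and> 0 < p \<and> p < (q::real)}"
  have "countable Q"
    by (rule countable_subset[of _ "\<rat> \<times> \<rat>"]) (auto simp: Q_def countable_rat)
  moreover have "negligible (Bad i)" if "i \<in> Q" for i
    using that density_mean_gap_negligible[OF g gp fin[unfolded N_def]]
    by (auto simp: Q_def Bad_def N_def)
  ultimately have nB: "negligible (\<Union>(Bad ` Q))"
    by (intro negligible_countable_Union) auto
  show ?thesis
  proof (rule exI[of _ "Z0 \<union> \<Union>(Bad ` Q)"], intro conjI ballI allI impI)
    show "negligible (Z0 \<union> \<Union>(Bad ` Q))" using Z0(1) nB by (rule negligible_Un)
    fix x e :: real assume x: "x \<in> {a<..<b} - (Z0 \<union> \<Union>(Bad ` Q))" and e: "0 < e"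
    then have gx: "g x = f x" using Z0(2)[of x] by (auto simp: indicator_def)
    obtain p where p: "p \<in> \<rat>" "g x < p" "p < g x + e/2"
      using Rats_dense_in_real[of "g x" "g x + e/2"] e by auto
    obtain q where q: "q \<in> \<rat>" "g x + e/2 < q" "q < g x + e"
      using Rats_dense_in_real[of "g x + e/2" "g x + e"] e by auto
    have "0 < p" using gp[of x] p by linarith
    then have "(p, q) \<in> Q" using p q by (auto simp: Q_def)
    then have "x \<notin> Bad (p, q)" using x by auto
    then have "\<not> (\<forall>h0>0. \<exists>h. 0 < h \<and> h < h0 \<and> emeasure N {x..x+h} > ennreal (q * h))"
      using p by (simp add: Bad_def)
    then obtain h0 where h0: "h0 > 0" "\<And>h. 0 < h \<Longrightarrow> h < h0 \<Longrightarrow> emeasure N {x..x+h} \<le> ennreal (q * h)"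
      unfolding not_all not_imp not_ex by (metis not_less)
    define h1 where "h1 = min (h0 / 2) (b - x)"
    have h1: "0 < h1" "h1 < h0" "x + h1 \<le> b" using h0 x by (auto simp: h1_def)
    show "\<exists>h0>0. x + h0 \<le> b \<and> (\<forall>h\<in>{0..h0}. integral {x..x+h} f \<le> (f x + e) * h)"
    proof (intro exI[of _ h1] conjI ballI)
      fix h assume h: "h \<in> {0..h1}"
      show "integral {x..x+h} f \<le> (f x + e) * h"
      proof (cases "h = 0")
        case False
        then have "ennreal (integral {x..x+h} f) \<le> ennreal (q * h)"
          using h0(2)[of h] h h1 x by (subst NI[symmetric]) auto
        moreover have "0 \<le> q * h" using h q gp[of x] e by simp
        ultimately have "integral {x..x+h} f \<le> q * h" by (simp add: ennreal_le_iff)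
        also have "\<dots> \<le> (f x + e) * h" using q gx h by (intro mult_right_mono) auto
        finally show ?thesis .
      qed simp
    qed (use h1 in auto)
  qed
qed

section \<open>The chain rule along primitives of integrable functions\<close>

text \<open>The curve \<open>Y\<close> is only a primitive of an integrable function, so it need not be
  differentiable at any prescribed point and the fundamental theorem of calculus does not apply
  directly. Instead, the defect on an interval is bounded by the oscillation of the gradient along
  \<open>Y\<close> times the variation of \<open>Y\<close>; this bound is local and additive over adjacent intervals, so
  bisection carries it to the whole interval, where the oscillation is arbitrarily small.\<close>

lemma chain_rule_indefinite_integral:
  fixes \<phi> :: "'b::euclidean_space \<Rightarrow> real" and D :: "'b \<Rightarrow> 'b" and Y g :: "real \<Rightarrow> 'b"
  assumes ab: "a \<le> b" and der: "\<And>x. (\<phi> has_derivative (\<lambda>h. D x \<bullet> h)) (at x)"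
    and D: "continuous_on UNIV D"
    and g: "g absolutely_integrable_on {a..b}"
    and Y: "\<And>t. t \<in> {a..b} \<Longrightarrow> Y t = Y a + integral {a..t} g"
  shows "(\<lambda>t. D (Y t) \<bullet> g t) absolutely_integrable_on {a..b}"
    and "integral {a..b} (\<lambda>t. D (Y t) \<bullet> g t) = \<phi> (Y b) - \<phi> (Y a)"
proof -
  have gi: "g integrable_on {s..t}" if "a \<le> s" "t \<le> b" for s t
    using g that by (meson absolutely_integrable_on_def atLeastatMost_subset_iff integrable_on_subinterval)
  have ngi: "(\<lambda>r. norm (g r)) integrable_on {s..t}" if "a \<le> s" "t \<le> b" for s t
  proof -
    have "(\<lambda>r. norm (g r)) integrable_on {a..b}" using g unfolding absolutely_integrable_on_def by simp
    then show ?thesis by (rule integrable_on_subinterval) (use that in auto)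
  qed
  have Yc: "continuous_on {a..b} Y"
  proof -
    have "continuous_on {a..b} (\<lambda>t. Y a + integral {a..t} g)"
      by (intro continuous_intros indefinite_integral_continuous_1 gi) auto
    then show ?thesis by (rule continuous_on_eq) (rule Y[symmetric])
  qed
  have Yst: "Y t - Y s = integral {s..t} g" if "a \<le> s" "s \<le> t" "t \<le> b" for s t
    using Y[of s] Y[of t] Henstock_Kurzweil_Integration.integral_combine[of a s t g] gi[of a t] that
    by (auto simp: algebra_simps)
  have DYc: "continuous_on {a..b} (\<lambda>t. D (Y t))"
    using continuous_on_compose2[OF D Yc] by auto
  show hai: "(\<lambda>t. D (Y t) \<bullet> g t) absolutely_integrable_on {a..b}"
  proof (rule absolutely_integrable_bounded_measurable_product[OF bilinear_conv_bounded_bilinear[THEN iffD2, OF bounded_bilinear_inner]])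
    show "(\<lambda>t. D (Y t)) \<in> borel_measurable (lebesgue_on {a..b})"
      by (rule continuous_imp_measurable_on_sets_lebesgue[OF DYc]) auto
    show "bounded ((\<lambda>t. D (Y t)) ` {a..b})"
      using compact_continuous_image[OF DYc] compact_imp_bounded by blast
  qed (use g in auto)
  let ?h = "\<lambda>t. D (Y t) \<bullet> g t"
  have hi: "?h integrable_on {s..t}" if "a \<le> s" "t \<le> b" for s t
    using hai that by (meson absolutely_integrable_on_def atLeastatMost_subset_iff integrable_on_subinterval)
  define G where "G = integral {a..b} (\<lambda>r. norm (g r))"
  have G: "0 \<le> G" unfolding G_def by (rule integral_nonneg) (use ngi[of a b] in auto)
  have key: "\<bar>\<phi> (Y b) - \<phi> (Y a) - integral {a..b} ?h\<bar> \<le> 2 * e * G" if e: "0 < e" for e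
  proof -
    define P where "P = (\<lambda>(s, t). a \<le> s \<and> t \<le> b \<longrightarrow>
        \<bar>\<phi> (Y t) - \<phi> (Y s) - integral {s..t} ?h\<bar> \<le> 2 * e * integral {s..t} (\<lambda>r. norm (g r)))"
    have "P (a, b)"
    proof (rule Bolzano[OF ab])
      fix s r t assume P: "P (s, r)" "P (r, t)" "s \<le> r" "r \<le> t"
      show "P (s, t)" unfolding P_def
      proof clarify
        assume st: "a \<le> s" "t \<le> b"
        have 1: "integral {s..t} ?h = integral {s..r} ?h + integral {r..t} ?h"
          using Henstock_Kurzweil_Integration.integral_combine[of s r t ?h] hi st P by simp
        have 2: "integral {s..t} (\<lambda>r. norm (g r)) = integral {s..r} (\<lambda>r. norm (g r)) + integral {r..t} (\<lambda>r. norm (g r))"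
          using Henstock_Kurzweil_Integration.integral_combine[of s r t "\<lambda>r. norm (g r)"] ngi st P by simp
        have "\<bar>\<phi> (Y r) - \<phi> (Y s) - integral {s..r} ?h\<bar> \<le> 2 * e * integral {s..r} (\<lambda>r. norm (g r))"
             "\<bar>\<phi> (Y t) - \<phi> (Y r) - integral {r..t} ?h\<bar> \<le> 2 * e * integral {r..t} (\<lambda>r. norm (g r))"
          using P st by (auto simp: P_def)
        then show "\<bar>\<phi> (Y t) - \<phi> (Y s) - integral {s..t} ?h\<bar> \<le> 2 * e * integral {s..t} (\<lambda>r. norm (g r))"
          unfolding 1 2 distrib_left by linarith
      qed
    next
      fix x assume x: "a \<le> x" "x \<le> b"
      have "continuous (at (Y x)) D" using D by (simp add: continuous_on_eq_continuous_at)
      then obtain d1 where d1: "0 < d1" "\<And>y. dist y (Y x) < d1 \<Longrightarrow> dist (D y) (D (Y x)) < e"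
        using e unfolding continuous_at_eps_delta by blast
      obtain d where d: "0 < d" "\<And>t. t \<in> {a..b} \<Longrightarrow> dist t x < d \<Longrightarrow> dist (Y t) (Y x) < d1"
        using Yc x d1(1) unfolding continuous_on_iff by (metis atLeastAtMost_iff)
      show "\<exists>d>0. \<forall>s t. s \<le> x \<and> x \<le> t \<and> t - s < d \<longrightarrow> P (s, t)"
      proof (intro exI[of _ d] conjI allI impI d(1))
        fix s t assume st: "s \<le> x \<and> x \<le> t \<and> t - s < d"
        show "P (s, t)" unfolding P_def
        proof clarify
          assume ab: "a \<le> s" "t \<le> b"
          have Yr: "Y r \<in> ball (Y x) d1" if "r \<in> {s..t}" for r
            using d(2)[of r] that st ab by (auto simp: dist_real_def dist_commute)
          have Dr: "norm (D y - D (Y x)) \<le> e" if "y \<in> ball (Y x) d1" for y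
            using d1(2)[of y] that by (auto simp: dist_norm norm_minus_commute less_imp_le)
          have YI: "Y t - Y s = integral {s..t} g" using Yst[of s t] st ab by auto
          have gn: "norm (Y t - Y s) \<le> integral {s..t} (\<lambda>r. norm (g r))"
            unfolding YI using gi ngi ab by (intro integral_norm_bound_integral) auto
          have "norm (\<phi> (Y t) - \<phi> (Y s) - D (Y x) \<bullet> (Y t - Y s)) \<le> norm (Y t - Y s) * e"
          proof (rule differentiable_bound_linearization[of "Y s" "Y t" "ball (Y x) d1" \<phi> "\<lambda>y h. D y \<bullet> h" "Y x" e])
            show "Y s + u *\<^sub>R (Y t - Y s) \<in> ball (Y x) d1" if "u \<in> {0..1}" for u
            proof -
              have "(1 - u) *\<^sub>R Y s + u *\<^sub>R Y t \<in> ball (Y x) d1"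
                using convexD_alt[OF convex_ball Yr[of s] Yr[of t], of u] that st by auto
              then show ?thesis by (simp add: algebra_simps)
            qed
            show "(\<phi> has_derivative (\<lambda>h. D y \<bullet> h)) (at y within ball (Y x) d1)" for y
              using der by (rule has_derivative_at_withinI)
            show "onorm ((\<lambda>h. D y \<bullet> h) - (\<lambda>h. D (Y x) \<bullet> h)) \<le> e" if "y \<in> ball (Y x) d1" for y
            proof (rule onorm_le)
              fix h
              have "norm ((D y - D (Y x)) \<bullet> h) \<le> norm (D y - D (Y x)) * norm h"
                by (simp add: Cauchy_Schwarz_ineq2)
              also have "\<dots> \<le> e * norm h" using Dr[OF that] by (rule mult_right_mono) simp
              finally show "norm (((\<lambda>h. D y \<bullet> h) - (\<lambda>h. D (Y x) \<bullet> h)) h) \<le> e * norm h"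
                by (simp add: inner_diff_left)
            qed
            show "Y x \<in> ball (Y x) d1" using d1 by simp
          qed
          then have A: "\<bar>\<phi> (Y t) - \<phi> (Y s) - D (Y x) \<bullet> (Y t - Y s)\<bar> \<le> e * integral {s..t} (\<lambda>r. norm (g r))"
            using gn e by (smt (verit, best) mult.commute mult_left_mono real_norm_def)
          have i2: "(\<lambda>r. D (Y x) \<bullet> g r) integrable_on {s..t}"
            using integrable_linear[OF gi[OF ab] bounded_linear_inner_right, of "D (Y x)"] by (simp add: o_def)
          have "D (Y x) \<bullet> (Y t - Y s) = integral {s..t} (\<lambda>r. D (Y x) \<bullet> g r)"
            unfolding YI using integral_linear[OF gi[OF ab] bounded_linear_inner_right, of "D (Y x)"] by (simp add: o_def)
          moreover have "norm (integral {s..t} (\<lambda>r. D (Y x) \<bullet> g r) - integral {s..t} ?h) \<le> integral {s..t} (\<lambda>r. e * norm (g r))"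
          proof (subst Henstock_Kurzweil_Integration.integral_diff[symmetric, OF i2 hi[OF ab]],
                 rule integral_norm_bound_integral)
            show "(\<lambda>r. D (Y x) \<bullet> g r - ?h r) integrable_on {s..t}"
              by (intro Henstock_Kurzweil_Integration.integrable_diff i2 hi ab)
            show "(\<lambda>r. e * norm (g r)) integrable_on {s..t}" using ngi[OF ab] by (rule integrable_on_mult_right)
            fix r assume r: "r \<in> {s..t}"
            have "norm ((D (Y x) - D (Y r)) \<bullet> g r) \<le> norm (D (Y x) - D (Y r)) * norm (g r)"
              by (simp add: Cauchy_Schwarz_ineq2)
            also have "\<dots> \<le> e * norm (g r)" using Dr[OF Yr[OF r]] by (intro mult_right_mono) (auto simp: norm_minus_commute)
            finally show "norm (D (Y x) \<bullet> g r - ?h r) \<le> e * norm (g r)" by (simp add: inner_diff_left)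
          qed
          ultimately show "\<bar>\<phi> (Y t) - \<phi> (Y s) - integral {s..t} ?h\<bar> \<le> 2 * e * integral {s..t} (\<lambda>r. norm (g r))"
            using A by simp
        qed
      qed
    qed
    then show ?thesis by (simp add: P_def G_def)
  qed
  show "integral {a..b} ?h = \<phi> (Y b) - \<phi> (Y a)"
  proof (rule ccontr)
    assume "integral {a..b} ?h \<noteq> \<phi> (Y b) - \<phi> (Y a)"
    then have c: "0 < \<bar>\<phi> (Y b) - \<phi> (Y a) - integral {a..b} ?h\<bar>" (is "0 < ?c") by simp
    have "?c \<le> 2 * (?c / (4 * (G + 1))) * G" by (rule key) (use c G in simp)
    also have "\<dots> = ?c * (G / (2 * (G + 1)))" using G by (simp add: field_simps)
    also have "\<dots> < ?c * 1" using c G by (intro mult_strict_left_mono) (auto simp: field_simps)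
    finally show False by simp
  qed
qed

text \<open>This is the identity behind the factorials in the convergence rate of the Picard
  iteration.\<close>

lemma integral_power_primitive:
  fixes \<kappa> :: "real \<Rightarrow> real"
  assumes ab: "a \<le> b" and k: "\<kappa> absolutely_integrable_on {a..b}"
    and A: "\<And>t. t \<in> {a..b} \<Longrightarrow> A t = A a + integral {a..t} \<kappa>"
  shows "(\<lambda>t. \<kappa> t * (A t) ^ n) absolutely_integrable_on {a..b}"
    and "integral {a..b} (\<lambda>t. \<kappa> t * (A t) ^ n) = (A b ^ Suc n - A a ^ Suc n) / real (Suc n)"
proof -
  define c where "c = inverse (real (Suc n))"
  have "((\<lambda>x::real. c * x ^ Suc n) has_derivative (\<lambda>h. x ^ n \<bullet> h)) (at x)" for x
    by (rule has_derivative_eq_rhs, (rule derivative_intros)+) (auto simp: c_def field_simps)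
  note * = chain_rule_indefinite_integral[OF ab this _ k A]
  have "continuous_on UNIV (\<lambda>x::real. x ^ n)" by (intro continuous_intros)
  note * = *[OF this]
  show "(\<lambda>t. \<kappa> t * (A t) ^ n) absolutely_integrable_on {a..b}" using *(1) by (simp add: mult.commute)
  show "integral {a..b} (\<lambda>t. \<kappa> t * (A t) ^ n) = (A b ^ Suc n - A a ^ Suc n) / real (Suc n)"
    using *(2) by (simp add: mult.commute c_def divide_inverse right_diff_distrib)
qed

section \<open>Measurable selections of compact-valued maps\<close>

definition weakly_measurable :: "'t measure \<Rightarrow> ('t \<Rightarrow> 'e::topological_space set) \<Rightarrow> bool" where
  "weakly_measurable M K \<longleftrightarrow> (\<forall>U. open U \<longrightarrow> {t \<in> space M. K t \<inter> U \<noteq> {}} \<in> sets M)"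

text \<open>An open set of a metric space is a countable union of closed sets.\<close>

lemma weakly_measurableI_closed:
  fixes K :: "'t \<Rightarrow> 'e::metric_space set"
  assumes "\<And>C. closed C \<Longrightarrow> {t \<in> space M. K t \<inter> C \<noteq> {}} \<in> sets M"
  shows "weakly_measurable M K"
  unfolding weakly_measurable_def
proof (intro allI impI)
  fix U :: "'e set" assume U: "open U"
  define C where "C = (\<lambda>n::nat. {x. ball x (1 / Suc n) \<subseteq> U})"
  have "closed (C n)" for n
  proof -
    have "- C n = (\<Union>y\<in>-U. ball y (1 / Suc n))" by (auto simp: C_def dist_commute)
    then show ?thesis by (simp add: closed_def open_UN)
  qed
  then have "(\<Union>n. {t \<in> space M. K t \<inter> C n \<noteq> {}}) \<in> sets M"
    using assms by blast
  also have "(\<Union>n. {t \<in> space M. K t \<inter> C n \<noteq> {}}) = {t \<in> space M. K t \<inter> U \<noteq> {}}"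
  proof -
    have "U = (\<Union>n. C n)"
    proof (intro equalityI subsetI)
      fix x assume "x \<in> U"
      then obtain e where e: "e > 0" "ball x e \<subseteq> U" using U open_contains_ball by blast
      obtain n :: nat where "inverse (real (Suc n)) < e" using reals_Archimedean[OF e(1)] by blast
      then have "ball x (1 / Suc n) \<subseteq> U" using e(2) subset_ball[of "1 / Suc n" e x]
        by (simp add: inverse_eq_divide)
      then show "x \<in> (\<Union>n. C n)" unfolding C_def by blast
    next
      fix x assume "x \<in> (\<Union>n. C n)"
      then obtain n where "ball x (1 / Suc n) \<subseteq> U" by (auto simp: C_def)
      then show "x \<in> U" using centre_in_ball[of x "1 / Suc n"] by auto
    qed
    then show ?thesis by blast
  qed
  finally show "{t \<in> space M. K t \<inter> U \<noteq> {}} \<in> sets M" .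
qed

text \<open>The existential over the uncountable set \<open>K t\<close> is replaced by one over the basic open
  sets meeting \<open>K t\<close>; that a strict bound with some slack holds on a basic set is tested on a
  countable dense subset.\<close>

lemma weakly_measurable_open_constraint:
  fixes K :: "'t \<Rightarrow> 'e::{metric_space, second_countable_topology} set"
  assumes K: "weakly_measurable M K" and Op: "open U"
    and cont: "\<And>i t. t \<in> space M \<Longrightarrow> continuous_on UNIV (g i t)"
    and meas: "\<And>i u. (\<lambda>t. g i t u) \<in> borel_measurable M"
  shows "{t \<in> space M. \<exists>u\<in>K t. u \<in> U \<and> (\<forall>i\<le>n::nat. g i t u < (c::real))} \<in> sets M"
proof -
  obtain B :: "'e set set" where B: "countable B" "topological_basis B"
    using ex_countable_basis by blast
  obtain D :: "'e set" where D: "countable D" "\<And>X. open X \<Longrightarrow> X \<noteq> {} \<Longrightarrow> \<exists>d\<in>D. d \<in> X"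
    using countable_dense_setE[where 'a='e] by blast
  have oB: "open b" if "b \<in> B" for b using B(2) that by (rule topological_basis_open)
  define S where "S = (\<lambda>b j. {t \<in> space M. K t \<inter> b \<noteq> {}} \<inter>
      (\<Inter>i\<in>{..n}. {t \<in> space M. \<forall>d\<in>D \<inter> b. g i t d \<le> c - 1 / Suc j}))"
  have gm: "{t \<in> space M. \<forall>d\<in>D \<inter> b. g i t d \<le> c - 1 / Suc j} \<in> sets M" for b i j
  proof -
    have "countable (D \<inter> b)" using D(1) by blast
    moreover have "{t \<in> space M. g i t d \<le> c - 1 / Suc j} \<in> sets M" for d
      using meas[of i d] by measurable
    ultimately have "space M \<inter> (\<Inter>d\<in>D \<inter> b. {t \<in> space M. g i t d \<le> c - 1 / Suc j}) \<in> sets M"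
      by (cases "D \<inter> b = {}") (simp_all, intro sets.Int sets.countable_INT', auto)
    also have "space M \<inter> (\<Inter>d\<in>D \<inter> b. {t \<in> space M. g i t d \<le> c - 1 / Suc j})
        = {t \<in> space M. \<forall>d\<in>D \<inter> b. g i t d \<le> c - 1 / Suc j}" by blast
    finally show ?thesis .
  qed
  have "S b j \<in> sets M" if "b \<in> B" for b j
    unfolding S_def using K oB[OF that] gm
    by (intro sets.Int sets.finite_INT) (auto simp: weakly_measurable_def)
  then have "(\<Union>b\<in>{b\<in>B. b \<subseteq> U}. \<Union>j. S b j) \<in> sets M"
    using B(1) by (intro sets.countable_UN' sets.countable_UN) (auto intro: countable_subset)
  also have "(\<Union>b\<in>{b\<in>B. b \<subseteq> U}. \<Union>j. S b j)
      = {t \<in> space M. \<exists>u\<in>K t. u \<in> U \<and> (\<forall>i\<le>n. g i t u < c)}"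
  proof (intro equalityI subsetI)
    fix t assume "t \<in> (\<Union>b\<in>{b\<in>B. b \<subseteq> U}. \<Union>j. S b j)"
    then obtain b j where b: "b \<in> B" "b \<subseteq> U" "t \<in> S b j" by auto
    then obtain u where u: "t \<in> space M" "u \<in> K t" "u \<in> b" by (auto simp: S_def)
    have "g i t u < c" if "i \<le> n" for i
    proof (rule ccontr)
      assume "\<not> g i t u < c"
      moreover have "0 < 1 / real (Suc j)" by simp
      ultimately have "g i t u > c - 1 / Suc j" by linarith
      then have "u \<in> b \<inter> {v. g i t v > c - 1 / Suc j}" using u by simp
      moreover have "open {v. g i t v > c - 1 / Suc j}"
        using cont[OF u(1)] by (intro open_Collect_less) auto
      ultimately obtain d where "d \<in> D" "d \<in> b" "g i t d > c - 1 / Suc j"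
        using D(2)[of "b \<inter> {v. g i t v > c - 1 / Suc j}"] oB[OF b(1)] by auto
      then show False using b(3) that by (force simp: S_def)
    qed
    then show "t \<in> {t \<in> space M. \<exists>u\<in>K t. u \<in> U \<and> (\<forall>i\<le>n. g i t u < c)}"
      using u b by auto
  next
    fix t assume "t \<in> {t \<in> space M. \<exists>u\<in>K t. u \<in> U \<and> (\<forall>i\<le>n. g i t u < c)}"
    then obtain u where t: "t \<in> space M" and u: "u \<in> K t" "u \<in> U" "\<And>i. i \<le> n \<Longrightarrow> g i t u < c" by auto
    define m where "m = Max ((\<lambda>i. g i t u) ` {..n})"
    have "m < c" unfolding m_def using u(3) by (subst Max_less_iff) auto
    then obtain j where j: "inverse (real (Suc j)) < c - m" using reals_Archimedean[of "c - m"] by auto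
    define W where "W = U \<inter> (\<Inter>i\<in>{..n}. {v. g i t v < c - 1 / Suc j})"
    have "g i t u < c - 1 / Suc j" if "i \<le> n" for i
    proof -
      have "g i t u \<le> m" unfolding m_def using that by (intro Max_ge) auto
      then show ?thesis using j by (simp add: inverse_eq_divide)
    qed
    then have uW: "u \<in> W" using u by (auto simp: W_def)
    have "open W" unfolding W_def
      using cont[OF t] Op by (intro open_Int open_INT ballI open_Collect_less) auto
    then obtain b where b: "b \<in> B" "u \<in> b" "b \<subseteq> W" using topological_basisE[OF B(2) _ uW] by blast
    have "t \<in> S b j"
      unfolding S_def
    proof (intro IntI INT_I CollectI conjI t ballI)
      show "K t \<inter> b \<noteq> {}" using u b by blast
      fix i d assume "i \<in> {..n}" "d \<in> D \<inter> b"
      then show "g i t d \<le> c - 1 / Suc j" using b(3) unfolding W_def by (intro less_imp_le) blast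
    qed
    then show "t \<in> (\<Union>b\<in>{b\<in>B. b \<subseteq> U}. \<Union>j. S b j)" using b by (auto simp: W_def)
  qed
  finally show ?thesis .
qed

text \<open>Compactness is what makes intersections measurable: \<open>K t\<close> meets a closed set subject to
  all the constraints iff for each \<open>n\<close> it meets the \<open>1/(n+1)\<close>-neighbourhood subject to the first
  \<open>n\<close> constraints relaxed by \<open>1/(n+1)\<close>.\<close>

lemma weakly_measurable_closed_constraints:
  fixes K :: "'t \<Rightarrow> 'e::{metric_space, second_countable_topology} set"
    and g :: "nat \<Rightarrow> 't \<Rightarrow> 'e \<Rightarrow> real"
  assumes K: "weakly_measurable M K" and comp: "\<And>t. t \<in> space M \<Longrightarrow> compact (K t)"
    and cont: "\<And>i t. t \<in> space M \<Longrightarrow> continuous_on UNIV (g i t)"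
    and meas: "\<And>i u. (\<lambda>t. g i t u) \<in> borel_measurable M"
  shows "weakly_measurable M (\<lambda>t. {u \<in> K t. \<forall>i. g i t u \<le> (0::real)})"
proof (rule weakly_measurableI_closed)
  fix C :: "'e set" assume C: "closed C"
  define Op where "Op = (\<lambda>n::nat. \<Union>c\<in>C. ball c (1 / Suc n))"
  have oOp: "open (Op n)" for n by (auto simp: Op_def)
  have "(\<Inter>n. {t \<in> space M. \<exists>u\<in>K t. u \<in> Op n \<and> (\<forall>i\<le>n. g i t u < 1 / Suc n)}) \<in> sets M"
    by (intro sets.countable_INT') (auto intro!: weakly_measurable_open_constraint K oOp cont meas)
  also have "(\<Inter>n. {t \<in> space M. \<exists>u\<in>K t. u \<in> Op n \<and> (\<forall>i\<le>n. g i t u < 1 / Suc n)})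
    = {t \<in> space M. {u \<in> K t. \<forall>i. g i t u \<le> 0} \<inter> C \<noteq> {}}"
  proof (intro equalityI subsetI)
    fix t assume t: "t \<in> {t \<in> space M. {u \<in> K t. \<forall>i. g i t u \<le> 0} \<inter> C \<noteq> {}}"
    then obtain u where u: "u \<in> K t" "\<And>i. g i t u \<le> 0" "u \<in> C" by auto
    have "g i t u < 1 / Suc n" for i n using u(2)[of i] by (rule order_le_less_trans) simp
    moreover have "u \<in> Op n" for n unfolding Op_def using u(3) by (intro UN_I[of u]) auto
    ultimately show "t \<in> (\<Inter>n. {t \<in> space M. \<exists>u\<in>K t. u \<in> Op n \<and> (\<forall>i\<le>n. g i t u < 1 / Suc n)})"
      using t u(1) by blast
  next
    fix t assume t: "t \<in> (\<Inter>n. {t \<in> space M. \<exists>u\<in>K t. u \<in> Op n \<and> (\<forall>i\<le>n. g i t u < 1 / Suc n)})"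
    then have ts: "t \<in> space M" by blast
    from t have "\<forall>n. \<exists>u. u \<in> K t \<and> u \<in> Op n \<and> (\<forall>i\<le>n. g i t u < 1 / Suc n)" by blast
    then obtain u where u: "\<And>n. u n \<in> K t" "\<And>n. u n \<in> Op n" "\<And>n i. i \<le> n \<Longrightarrow> g i t (u n) < 1 / Suc n"
      by metis
    obtain l r where l: "l \<in> K t" "strict_mono r" "(u \<circ> r) \<longlonglongrightarrow> l"
      using comp[OF ts] u(1) unfolding compact_def by metis
    have inv0: "(\<lambda>n. 1 / real (Suc (r n))) \<longlonglongrightarrow> 0"
      using LIMSEQ_subseq_LIMSEQ[OF LIMSEQ_Suc[OF lim_1_over_n] l(2)] by (simp add: o_def)
    have "\<exists>c. c \<in> C \<and> dist c (u n) < 1 / Suc n" for n using u(2)[of n] by (auto simp: Op_def)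
    then obtain c where c: "\<And>n. c n \<in> C" "\<And>n. dist (c n) (u n) < 1 / Suc n" by metis
    have lim: "(\<lambda>n. 1 / real (Suc (r n)) + dist (u (r n)) l) \<longlonglongrightarrow> 0"
      using tendsto_add[OF inv0, of "\<lambda>n. dist (u (r n)) l" 0] l(3) by (simp add: tendsto_dist_iff[symmetric] o_def)
    have "(\<lambda>n. dist (c (r n)) l) \<longlonglongrightarrow> 0"
    proof (rule tendsto_sandwich[OF _ _ tendsto_const lim])
      have "dist (c (r n)) l \<le> 1 / real (Suc (r n)) + dist (u (r n)) l" for n
        using dist_triangle[of "c (r n)" l "u (r n)"] c(2)[of "r n"] by linarith
      then show "\<forall>\<^sub>F n in sequentially. dist (c (r n)) l \<le> 1 / real (Suc (r n)) + dist (u (r n)) l"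
        by (rule always_eventually[OF allI])
    qed simp
    then have "(\<lambda>n. c (r n)) \<longlonglongrightarrow> l" by (simp add: tendsto_dist_iff[symmetric])
    then have "l \<in> C" by (rule closed_sequentially[OF C, rotated]) (simp add: c(1))
    moreover have "g i t l \<le> 0" for i
    proof (rule LIMSEQ_le[OF _ inv0])
      have "isCont (g i t) l" using cont[OF ts, of i] by (simp add: continuous_on_eq_continuous_at)
      then show "(\<lambda>n. g i t (u (r n))) \<longlonglongrightarrow> g i t l"
        using l(3) isCont_tendsto_compose[of l "g i t" "\<lambda>n. u (r n)" sequentially] by (simp add: o_def)
      have "g i t (u (r n)) \<le> 1 / real (Suc (r n))" if "i \<le> n" for n
        using u(3)[of i "r n"] seq_suble[OF l(2), of n] that by simp
      then show "\<exists>N. \<forall>n\<ge>N. g i t (u (r n)) \<le> 1 / real (Suc (r n))" by blast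
    qed
    ultimately show "t \<in> {t \<in> space M. {u \<in> K t. \<forall>i. g i t u \<le> 0} \<inter> C \<noteq> {}}" using ts l(1) by auto
  qed
  finally show "{t \<in> space M. {u \<in> K t. \<forall>i. g i t u \<le> 0} \<inter> C \<noteq> {}} \<in> sets M" .
qed

lemma compact_attains_Inf:
  fixes h :: "'e::topological_space \<Rightarrow> real"
  assumes "compact A" "A \<noteq> {}" and cont: "continuous_on UNIV h"
  shows "\<exists>u\<in>A. h u = Inf (h ` A) \<and> (\<forall>v\<in>A. h u \<le> h v)"
proof -
  obtain u where u: "u \<in> A" "\<And>v. v \<in> A \<Longrightarrow> h u \<le> h v"
    using continuous_attains_inf[OF assms(1,2) continuous_on_subset[OF cont subset_UNIV]] by metis
  then have "Inf (h ` A) = h u" by (intro cInf_eq_minimum) auto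
  then show ?thesis using u by auto
qed

lemma measurable_Inf_weakly_measurable:
  fixes h :: "'e::topological_space \<Rightarrow> real"
  assumes F: "weakly_measurable M F" "\<And>t. t \<in> space M \<Longrightarrow> compact (F t)" "\<And>t. t \<in> space M \<Longrightarrow> F t \<noteq> {}"
    and cont: "continuous_on UNIV h"
  shows "(\<lambda>t. Inf (h ` F t)) \<in> borel_measurable M"
proof (rule borel_measurableI_less)
  fix r
  have "{t \<in> space M. Inf (h ` F t) < r} = {t \<in> space M. F t \<inter> {u. h u < r} \<noteq> {}}"
  proof (intro Collect_cong conj_cong refl)
    fix t assume "t \<in> space M"
    then obtain u where u: "u \<in> F t" "h u = Inf (h ` F t)" "\<And>v. v \<in> F t \<Longrightarrow> h u \<le> h v"
      using compact_attains_Inf[of "F t" h] F cont by blast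
    then show "(Inf (h ` F t) < r) = (F t \<inter> {u. h u < r} \<noteq> {})"
      by (auto intro: le_less_trans)
  qed
  moreover have "open {u. h u < r}" using cont by (intro open_Collect_less continuous_on_const)
  ultimately show "{t \<in> space M. Inf (h ` F t) < r} \<in> sets M"
    using F(1) by (simp add: weakly_measurable_def)
qed

text \<open>A lexicographic choice: minimise the first functional over \<open>K t\<close>, then the second one
  over the minimisers, and so on. Each stage is a closed constraint with a measurable right-hand
  side, so it stays compact-valued and measurable, and along a point of the intersection every
  functional takes its measurable minimal value.\<close>

lemma measurable_selection_of_functionals:
  fixes K :: "'t \<Rightarrow> 'e::{metric_space, second_countable_topology} set" and c :: "nat \<Rightarrow> 'e \<Rightarrow> real"
  assumes K: "weakly_measurable M K" and comp: "\<And>t. t \<in> space M \<Longrightarrow> compact (K t)"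
    and ne: "\<And>t. t \<in> space M \<Longrightarrow> K t \<noteq> {}"
    and cont: "\<And>k. continuous_on UNIV (c k)"
  shows "\<exists>f. (\<forall>t\<in>space M. f t \<in> K t) \<and> (\<forall>k. (\<lambda>t. c k (f t)) \<in> borel_measurable M)"
proof -
  define KK where "KK = rec_nat K (\<lambda>k F t. {u \<in> F t. c k u \<le> Inf (c k ` F t)})"
  have KK0: "KK 0 = K" and KKS: "KK (Suc k) t = {u \<in> KK k t. c k u \<le> Inf (c k ` KK k t)}" for k t
    by (simp_all add: KK_def)
  note mc = compact_attains_Inf[OF _ _ cont]
  have inf_meas: "(\<lambda>t. Inf (c k ` F t)) \<in> borel_measurable M"
    if "weakly_measurable M F" "\<forall>t\<in>space M. compact (F t) \<and> F t \<noteq> {}" for k F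
    using that cont by (intro measurable_Inf_weakly_measurable) auto
  have *: "weakly_measurable M (KK k) \<and> (\<forall>t\<in>space M. compact (KK k t) \<and> KK k t \<noteq> {})
      \<and> (\<lambda>t. Inf (c k ` KK k t)) \<in> borel_measurable M" for k
  proof (induction k)
    case 0
    have "(\<lambda>t. Inf (c 0 ` KK 0 t)) \<in> borel_measurable M" by (rule inf_meas) (use K comp ne in \<open>auto simp: KK0\<close>)
    then show ?case using K comp ne by (simp add: KK0)
  next
    case (Suc k)
    let ?a = "\<lambda>t. Inf (c k ` KK k t)"
    have eq: "KK (Suc k) = (\<lambda>t. {u \<in> KK k t. \<forall>i::nat. c k u - ?a t \<le> 0})"
      by (auto simp: KKS fun_eq_iff)
    have w: "weakly_measurable M (KK (Suc k))"
      unfolding eq using Suc cont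
      by (intro weakly_measurable_closed_constraints) (auto intro!: continuous_intros borel_measurable_diff)
    have cn: "compact (KK (Suc k) t) \<and> KK (Suc k) t \<noteq> {}" if t: "t \<in> space M" for t
    proof
      have "closed {u. c k u \<le> ?a t}"
        using cont by (intro closed_Collect_le continuous_on_const)
      moreover have "KK (Suc k) t = KK k t \<inter> {u. c k u \<le> ?a t}" by (auto simp: KKS)
      ultimately show "compact (KK (Suc k) t)" using Suc t by (simp add: compact_Int_closed)
      show "KK (Suc k) t \<noteq> {}" using mc[of "KK k t" k] Suc t by (auto simp: KKS)
    qed
    then show ?case using w inf_meas[OF w] by blast
  qed
  have ex: "\<exists>u. \<forall>k. u \<in> KK k t" if t: "t \<in> space M" for t
  proof -
    have mono: "KK n t \<subseteq> KK m t" if "m \<le> n" for m n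
      using that by (induction rule: dec_induct) (auto simp: KKS)
    have "KK 0 t \<inter> (\<Inter>k\<in>UNIV. KK k t) \<noteq> {}"
    proof (rule compact_imp_fip_image)
      show "compact (KK 0 t)" using * t by blast
      show "closed (KK k t)" for k using * t compact_imp_closed by blast
      fix I :: "nat set" assume "finite I"
      then have "KK (Max (insert 0 I)) t \<subseteq> KK 0 t \<inter> (\<Inter>k\<in>I. KK k t)"
        by (intro Int_greatest INT_greatest mono) auto
      moreover have "KK (Max (insert 0 I)) t \<noteq> {}" using * t by blast
      ultimately show "KK 0 t \<inter> (\<Inter>k\<in>I. KK k t) \<noteq> {}" by blast
    qed
    then show ?thesis by blast
  qed
  define f where "f = (\<lambda>t. SOME u. \<forall>k. u \<in> KK k t)"
  have f: "f t \<in> KK k t" if "t \<in> space M" for t k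
    using someI_ex[OF ex[OF that]] unfolding f_def by blast
  have cf: "c k (f t) = Inf (c k ` KK k t)" if t: "t \<in> space M" for t k
  proof -
    have "c k (f t) \<le> Inf (c k ` KK k t)" using f[OF t, of "Suc k"] by (simp add: KKS)
    moreover have "Inf (c k ` KK k t) \<le> c k (f t)" using mc[of "KK k t" k] * t f[OF t, of k] by auto
    ultimately show ?thesis by simp
  qed
  have "(\<lambda>t. c k (f t)) \<in> borel_measurable M" for k
    using * cf by (subst measurable_cong[where g="\<lambda>t. Inf (c k ` KK k t)"]) auto
  moreover have "\<forall>t\<in>space M. f t \<in> K t" using f[of _ 0] by (simp add: KK0)
  ultimately show ?thesis by blast
qed

lemma measurable_selection_sequence_space:
  fixes K :: "'t \<Rightarrow> (nat \<Rightarrow> 'a::euclidean_space) set"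
  assumes K: "weakly_measurable M K" and comp: "\<And>t. t \<in> space M \<Longrightarrow> compact (K t)"
    and ne: "\<And>t. t \<in> space M \<Longrightarrow> K t \<noteq> {}"
  shows "\<exists>f. (\<forall>t\<in>space M. f t \<in> K t) \<and> (\<forall>i. (\<lambda>t. f t i) \<in> borel_measurable M)"
proof -
  define c :: "nat \<Rightarrow> (nat \<Rightarrow> 'a) \<Rightarrow> real" where
    "c = (\<lambda>k u. u (fst (prod_decode k)) \<bullet> from_nat_into Basis (snd (prod_decode k)))"
  have "continuous_on UNIV (c k)" for k
    unfolding c_def by (intro continuous_intros continuous_on_product_coordinates)
  from measurable_selection_of_functionals[where c=c, OF K comp ne this]
  obtain f where f: "\<And>t. t \<in> space M \<Longrightarrow> f t \<in> K t" "\<And>k. (\<lambda>t. c k (f t)) \<in> borel_measurable M" by blast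
  have "(\<lambda>t. f t i) \<in> borel_measurable M" for i
  proof (subst borel_measurable_euclidean_space, intro ballI)
    fix b :: 'a assume b: "b \<in> Basis"
    then obtain j where "from_nat_into Basis j = b"
      by (metis countable_finite finite_Basis from_nat_into_surj)
    then have "c (prod_encode (i, j)) u = u i \<bullet> b" for u by (simp add: c_def)
    then show "(\<lambda>t. f t i \<bullet> b) \<in> borel_measurable M" using f(2)[of "prod_encode (i, j)"] by simp
  qed
  then show ?thesis using f(1) by blast
qed

lemma infdist_less_iff:
  fixes A :: "'e::metric_space set"
  assumes "A \<noteq> {}"
  shows "infdist x A < r \<longleftrightarrow> (\<exists>a\<in>A. dist x a < r)"
  unfolding infdist_notempty[OF assms]
  by (rule cINF_less_iff[OF assms bdd_belowI[of _ 0]]) auto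

lemma weakly_measurable_imp_infdist:
  fixes K :: "'t \<Rightarrow> 'e::metric_space set"
  assumes K: "weakly_measurable M K" and ne: "\<And>t. t \<in> space M \<Longrightarrow> K t \<noteq> {}"
  shows "(\<lambda>t. infdist u (K t)) \<in> borel_measurable M"
proof (rule borel_measurableI_less)
  fix r
  have "{t \<in> space M. infdist u (K t) < r} = {t \<in> space M. K t \<inter> ball u r \<noteq> {}}"
    using ne by (auto simp: infdist_less_iff disjoint_iff)
  then show "{t \<in> space M. infdist u (K t) < r} \<in> sets M"
    using K by (simp add: weakly_measurable_def)
qed

lemma weakly_measurableI_infdist:
  fixes K :: "'t \<Rightarrow> 'e::{metric_space, second_countable_topology} set"
  assumes ne: "\<And>t. t \<in> space M \<Longrightarrow> K t \<noteq> {}"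
    and meas: "\<And>u. (\<lambda>t. infdist u (K t)) \<in> borel_measurable M"
  shows "weakly_measurable M K"
  unfolding weakly_measurable_def
proof (intro allI impI)
  fix U :: "'e set" assume U: "open U"
  obtain D :: "'e set" where D: "countable D" "\<And>X. open X \<Longrightarrow> X \<noteq> {} \<Longrightarrow> \<exists>d\<in>D. d \<in> X"
    using countable_dense_setE[where 'a='e] by blast
  define I where "I = {(d, q). d \<in> D \<and> q \<in> \<rat> \<and> ball d q \<subseteq> U}"
  have cI: "countable I"
    by (rule countable_subset[of _ "D \<times> \<rat>"]) (use D(1) in \<open>auto simp: I_def countable_rat\<close>)
  have "{t \<in> space M. infdist d (K t) < q} \<in> sets M" for d q using meas[of d] by measurable
  then have "(\<Union>i\<in>I. {t \<in> space M. infdist (fst i) (K t) < snd i}) \<in> sets M"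
    using cI by (intro sets.countable_UN') auto
  also have "(\<Union>i\<in>I. {t \<in> space M. infdist (fst i) (K t) < snd i}) = {t \<in> space M. K t \<inter> U \<noteq> {}}"
  proof (intro equalityI subsetI)
    fix t assume "t \<in> (\<Union>i\<in>I. {t \<in> space M. infdist (fst i) (K t) < snd i})"
    then show "t \<in> {t \<in> space M. K t \<inter> U \<noteq> {}}"
      using ne by (fastforce simp: I_def infdist_less_iff disjoint_iff)
  next
    fix t assume "t \<in> {t \<in> space M. K t \<inter> U \<noteq> {}}"
    then obtain u where t: "t \<in> space M" and u: "u \<in> K t" "u \<in> U" by auto
    obtain e where e: "e > 0" "ball u e \<subseteq> U" using U u open_contains_ball by blast
    obtain q where q: "q \<in> \<rat>" "0 < q" "q < e / 2" using Rats_dense_in_real[of 0 "e/2"] e by auto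
    obtain d where d: "d \<in> D" "d \<in> ball u q" using D(2)[of "ball u q"] q by auto
    have "ball d q \<subseteq> ball u e"
    proof
      fix x assume "x \<in> ball d q"
      then show "x \<in> ball u e" using d q dist_triangle[of u x d] by auto
    qed
    then have "(d, q) \<in> I" using d q e by (auto simp: I_def)
    moreover have "infdist d (K t) < q" using infdist_le2[OF u(1), of d "dist d u"] d by (auto simp: dist_commute)
    ultimately show "t \<in> (\<Union>i\<in>I. {t \<in> space M. infdist (fst i) (K t) < snd i})" using t by force
  qed
  finally show "{t \<in> space M. K t \<inter> U \<noteq> {}} \<in> sets M" .
qed

section \<open>Vector fields sampled along a dense sequence\<close>

interpretation cc: Metric_space C0 d_cc
  by (rule Metric_space_d_cc)

lemma mtopology_cc: "cc.mtopology = cc_topology"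
  by (simp add: cc_topology_def)

lemma topspace_cc [simp]: "topspace cc_topology = C0"
  by (simp add: mtopology_cc[symmetric])

text \<open>The terms of the series with index at least \<open>n\<close> are bounded by the weights alone.\<close>

lemma d_cc_le:
  assumes c: "0 \<le> c" and le: "\<And>x. norm x \<le> real n \<Longrightarrow> norm (v x - w x) \<le> c"
  shows "d_cc v w \<le> c + (1 / 2) ^ n"
proof -
  define a where "a = (\<lambda>k. (1 / 2 :: real) ^ Suc k * enn2real (min 1 (sup_dist (cball 0 (real (Suc k))) v w)))"
  have sa: "summable a" unfolding a_def by (rule summable_d_cc)
  have geo: "(\<lambda>k. (1 / 2 :: real) ^ Suc (k + n)) sums ((1 / 2) ^ n)"
    using sums_mult[OF power_half_series, of "(1/2) ^ n"] by (simp add: power_add mult_ac)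
  have a1: "a k \<le> (1 / 2) ^ Suc k" for k
    unfolding a_def using mult_left_mono[OF enn2real_min_le1, of "(1 / 2) ^ Suc k"] by simp
  have ac: "a k \<le> (1 / 2) ^ Suc k * c" if "k < n" for k
  proof -
    have "sup_dist (cball 0 (real (Suc k))) v w \<le> ennreal c"
      unfolding sup_dist_def using that by (intro SUP_least ennreal_leI le) auto
    then have "enn2real (min 1 (sup_dist (cball 0 (real (Suc k))) v w)) \<le> enn2real (ennreal c)"
      by (intro enn2real_mono) (auto intro: min.coboundedI2)
    then show ?thesis unfolding a_def using c by (intro mult_left_mono) auto
  qed
  have "d_cc v w = (\<Sum>k. a (k + n)) + (\<Sum>k<n. a k)"
    unfolding d_cc_def a_def[symmetric] using suminf_split_initial_segment[OF sa, of n] by (simp add: a_def)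
  also have "(\<Sum>k. a (k + n)) \<le> (\<Sum>k. (1 / 2) ^ Suc (k + n))"
    using a1 sa geo by (intro suminf_le) (auto simp: summable_iff_shift sums_iff)
  also have "\<dots> = (1 / 2) ^ n" using geo by (simp add: sums_iff)
  also have "(\<Sum>k<n. a k) \<le> (\<Sum>k<n. (1 / 2) ^ Suc k * c)" by (intro sum_mono ac) auto
  also have "\<dots> = (\<Sum>k<n. (1 / 2) ^ Suc k) * c" by (simp add: sum_distrib_right)
  also have "(\<Sum>k<n. (1 / 2 :: real) ^ Suc k) \<le> 1"
    using sum_le_suminf[of "\<lambda>k. (1 / 2 :: real) ^ Suc k" "{..<n}"] power_half_series by (auto simp: sums_iff)
  finally show ?thesis using c by (simp add: mult_right_mono)
qed

lemma min_norm_le_d_cc: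
  assumes "norm x \<le> real (Suc k)"
  shows "min 1 (norm (v x - w x)) \<le> 2 ^ Suc k * d_cc v w"
proof -
  define a where "a = (\<lambda>k. (1 / 2 :: real) ^ Suc k * enn2real (min 1 (sup_dist (cball 0 (real (Suc k))) v w)))"
  have "sum a {k} \<le> suminf a"
    unfolding a_def by (intro sum_le_suminf[OF summable_d_cc]) auto
  then have "a k \<le> d_cc v w" by (simp add: d_cc_def a_def)
  then have 1: "enn2real (min 1 (sup_dist (cball 0 (real (Suc k))) v w)) \<le> 2 ^ Suc k * d_cc v w"
    by (simp add: a_def field_simps)
  have "min 1 (ennreal (norm (v x - w x))) \<le> min 1 (sup_dist (cball 0 (real (Suc k))) v w)"
    unfolding sup_dist_def using assms by (intro min.mono SUP_upper order_refl) auto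
  then have "enn2real (min 1 (ennreal (norm (v x - w x)))) \<le> enn2real (min 1 (sup_dist (cball 0 (real (Suc k))) v w))"
    by (intro enn2real_mono) (auto simp: min_less_iff_disj)
  moreover have "enn2real (min 1 (ennreal (norm (v x - w x)))) = min 1 (norm (v x - w x))"
    by (simp add: ennreal_1[symmetric] min_def del: ennreal_1)
  ultimately show ?thesis using 1 by linarith
qed

text \<open>Through evaluations, the topology of \<open>C0\<close> is compared with the product topology on
  sequences, where compactness and measurability are available from type classes.\<close>

lemma continuous_map_evaluation: "continuous_map cc_topology euclidean (\<lambda>v. v x)"
  unfolding continuous_map_def
proof (intro conjI allI impI)
  show "(\<lambda>v. v x) \<in> topspace cc_topology \<rightarrow> topspace euclidean" by simp
  fix W :: "'a set" assume "openin euclidean W"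
  then have W: "open W" by simp
  obtain k where k: "norm x \<le> real k" using real_arch_simple by blast
  then have k: "norm x \<le> real (Suc k)" by simp
  show "openin cc_topology {v \<in> topspace cc_topology. v x \<in> W}"
    unfolding mtopology_cc[symmetric] cc.openin_mtopology
  proof (intro conjI allI impI)
    fix v assume v: "v \<in> {v \<in> topspace cc.mtopology. v x \<in> W}"
    then obtain e where e: "e > 0" "ball (v x) e \<subseteq> W" using W open_contains_ball by blast
    define r where "r = min 1 e / 2 ^ Suc k"
    have "cc.mball v r \<subseteq> {v \<in> topspace cc.mtopology. v x \<in> W}"
    proof
      fix w assume w: "w \<in> cc.mball v r"
      then have wC: "w \<in> C0" "d_cc v w < r" by auto
      have "2 ^ Suc k * d_cc v w < min 1 e" using wC by (simp add: r_def field_simps)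
      then have "min 1 (norm (v x - w x)) < min 1 e" using min_norm_le_d_cc[OF k, of v w] by linarith
      then have "w x \<in> ball (v x) e" by (auto simp: dist_norm min_def split: if_splits)
      then show "w \<in> {v \<in> topspace cc.mtopology. v x \<in> W}" using wC e by auto
    qed
    moreover have "r > 0" using e by (simp add: r_def)
    ultimately show "\<exists>r>0. cc.mball v r \<subseteq> {v \<in> topspace cc.mtopology. v x \<in> W}" by blast
  qed auto
qed

definition dense_seq :: "nat \<Rightarrow> 'a::euclidean_space" where
  "dense_seq = (SOME q. \<forall>U. open U \<longrightarrow> U \<noteq> {} \<longrightarrow> (\<exists>i. q i \<in> U))"

lemma dense_seq:
  assumes "open U" "U \<noteq> {}"
  shows "\<exists>i. dense_seq i \<in> (U :: 'a::euclidean_space set)"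
proof -
  obtain D :: "'a set" where D: "countable D" "\<And>X. open X \<Longrightarrow> X \<noteq> {} \<Longrightarrow> \<exists>d\<in>D. d \<in> X"
    using countable_dense_setE[where 'a='a] by blast
  have "\<exists>q :: nat \<Rightarrow> 'a. \<forall>U. open U \<longrightarrow> U \<noteq> {} \<longrightarrow> (\<exists>i. q i \<in> U)"
    using D(2) from_nat_into_surj[OF D(1)] by (intro exI[of _ "from_nat_into D"]) metis
  from someI_ex[OF this] show ?thesis using assms unfolding dense_seq_def by blast
qed

lemma closure_dense_seq: "closure (range dense_seq) = (UNIV :: 'a::euclidean_space set)"
proof -
  have "x \<in> closure (range dense_seq)" for x :: 'a
    unfolding closure_approachable
  proof (intro allI impI)
    fix e :: real assume "0 < e"
    then show "\<exists>y\<in>range dense_seq. dist y x < e"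
      using dense_seq[of "ball x e"] by (auto simp: dist_commute)
  qed
  then show ?thesis by blast
qed

text \<open>Every ball has a finite net made of the first points of the dense sequence, so for
  equi-Lipschitz fields finitely many values control the field on the ball.\<close>

lemma dense_seq_net:
  assumes "0 < \<delta>"
  shows "\<exists>N. \<forall>x::'a::euclidean_space. norm x \<le> R \<longrightarrow> (\<exists>i\<le>N. dist x (dense_seq i) < \<delta>)"
proof -
  have "cball 0 R \<subseteq> (\<Union>i\<in>UNIV. ball (dense_seq i :: 'a) \<delta>)"
  proof
    fix x :: 'a
    show "x \<in> (\<Union>i\<in>UNIV. ball (dense_seq i) \<delta>)"
      using dense_seq[of "ball x \<delta>"] assms by (auto simp: dist_commute)
  qed
  then obtain F where F: "finite F" "cball 0 R \<subseteq> (\<Union>i\<in>F. ball (dense_seq i :: 'a) \<delta>)"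
    using compactE_image[OF compact_cball, of UNIV "\<lambda>i. ball (dense_seq i :: 'a) \<delta>" 0 R] by auto
  have "\<exists>i\<le>Max (insert 0 F). dist x (dense_seq i) < \<delta>" if "norm x \<le> R" for x :: 'a
  proof -
    have "x \<in> cball 0 R" using that by simp
    then obtain i where "i \<in> F" "x \<in> ball (dense_seq i) \<delta>" using F(2) by blast
    then show ?thesis using F(1) by (intro exI[of _ i]) (auto simp: dist_commute)
  qed
  then show ?thesis by blast
qed

definition sample :: "('a::euclidean_space \<Rightarrow> 'a) \<Rightarrow> nat \<Rightarrow> 'a" where
  "sample v = (\<lambda>i. v (dense_seq i))"

lemma lipschitz_diff_near:
  assumes "C1-lipschitz_on UNIV v" "C2-lipschitz_on UNIV w" "dist x y \<le> \<delta>"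
  shows "norm (v x - w x) \<le> norm (v y - w y) + (C1 + C2) * \<delta>"
proof -
  have "norm (v x - v y) \<le> C1 * \<delta>"
    using lipschitz_onD[OF assms(1), of x y] mult_left_mono[OF assms(3) lipschitz_on_nonneg[OF assms(1)]]
    by (simp add: dist_norm)
  moreover have "norm (w y - w x) \<le> C2 * \<delta>"
    using lipschitz_onD[OF assms(2), of x y] mult_left_mono[OF assms(3) lipschitz_on_nonneg[OF assms(2)]]
    by (simp add: dist_norm norm_minus_commute)
  moreover have "v x - w x = (v x - v y) + (v y - w y) + (w y - w x)" by simp
  then have "norm (v x - w x) \<le> norm (v x - v y) + norm (v y - w y) + norm (w y - w x)"
    by (metis norm_triangle_le norm_triangle_mono order_refl)
  ultimately show ?thesis by (simp add: algebra_simps)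
qed

lemma lipschitz_imp_C0: "C-lipschitz_on UNIV v \<Longrightarrow> v \<in> C0"
  by (simp add: C0_def lipschitz_on_continuous_on)

lemma continuous_map_sample: "continuous_map cc_topology euclidean sample"
proof -
  have "continuous_map cc_topology (product_topology (\<lambda>i. euclidean) UNIV) sample"
    unfolding continuous_map_componentwise_UNIV sample_def by (intro allI continuous_map_evaluation)
  then show ?thesis by (simp add: euclidean_product_topology)
qed

text \<open>Sampling is continuous, so that open sets of sequences pull back to open sets of fields.\<close>

lemma weakly_measurable_sample:
  assumes F: "setvalued_measurable T F" and C: "\<And>t. t \<in> {0..T} \<Longrightarrow> F t \<subseteq> C0"
  shows "weakly_measurable (lebesgue_on {0..T}) (\<lambda>t. sample ` F t)"
  unfolding weakly_measurable_def
proof (intro allI impI)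
  fix U :: "(nat \<Rightarrow> 'a) set" assume U: "open U"
  have "openin cc_topology {v \<in> topspace cc_topology. sample v \<in> U}"
    using continuous_map_sample U by (auto simp: continuous_map_def)
  then have "{t\<in>{0..T}. F t \<inter> {v \<in> topspace cc_topology. sample v \<in> U} \<noteq> {}} \<in> sets lebesgue"
    using F by (auto simp: setvalued_measurable_def)
  also have "{t\<in>{0..T}. F t \<inter> {v \<in> topspace cc_topology. sample v \<in> U} \<noteq> {}}
    = {t \<in> space (lebesgue_on {0..T}). sample ` F t \<inter> U \<noteq> {}}"
    using C by auto
  finally show "{t \<in> space (lebesgue_on {0..T}). sample ` F t \<inter> U \<noteq> {}} \<in> sets (lebesgue_on {0..T})"
    by (subst sets_restrict_space_iff) auto
qed

lemma closedin_cc_locally_uniform: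
  assumes S: "closedin cc_topology S" and v: "v \<in> C0"
    and app: "\<And>n e. 0 < e \<Longrightarrow> \<exists>w\<in>S. \<forall>x. norm x \<le> real n \<longrightarrow> norm (v x - w x) \<le> e"
  shows "v \<in> S"
proof (rule ccontr)
  assume "v \<notin> S"
  moreover have "openin cc.mtopology (C0 - S)"
    using S unfolding mtopology_cc by (simp add: closedin_def)
  ultimately obtain r where r: "r > 0" "cc.mball v r \<subseteq> C0 - S"
    using v unfolding cc.openin_mtopology by blast
  obtain n where n: "(1 / 2 :: real) ^ n < r / 2" using real_arch_pow_inv[of "r/2" "1/2"] r by auto
  obtain w where w: "w \<in> S" "\<And>x. norm x \<le> real n \<Longrightarrow> norm (v x - w x) \<le> r / 2"
    using app[of "r/2" n] r by auto
  have "d_cc v w \<le> r / 2 + (1 / 2) ^ n" using w r by (intro d_cc_le) auto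
  then have "d_cc v w < r" using n by simp
  moreover have "w \<in> C0" using w(1) S closedin_subset by fastforce
  ultimately have "w \<in> cc.mball v r" using v by simp
  then show False using r w by blast
qed

text \<open>An Arzela-Ascoli argument in coordinates: the samples lie in a product of balls, compact
  by Tychonoff, and a limit of samples of equi-Lipschitz fields is Lipschitz on the dense sequence,
  hence the sample of a Lipschitz field, to which the fields converge locally uniformly.\<close>

lemma compact_sample_image:
  assumes S: "closedin cc_topology S" and lip: "\<And>v. v \<in> S \<Longrightarrow> C-lipschitz_on UNIV v"
    and bd: "\<And>v x. v \<in> S \<Longrightarrow> norm (v x) \<le> b x" and C: "0 \<le> C"
  shows "compact (sample ` S)"
proof -
  define B where "B = (\<lambda>i. cball (0::'a) (b (dense_seq i)))"
  have "compactin (product_topology (\<lambda>i. euclidean) UNIV) (PiE UNIV B)"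
    unfolding compactin_PiE by (auto simp: B_def)
  then have cB: "compact (PiE UNIV B)" by (simp add: euclidean_product_topology)
  have "closed (sample ` S)"
    unfolding closed_sequential_limits
  proof (intro allI impI)
    fix f :: "nat \<Rightarrow> nat \<Rightarrow> 'a" and l :: "nat \<Rightarrow> 'a" assume f: "(\<forall>n. f n \<in> sample ` S) \<and> f \<longlonglongrightarrow> l"
    then have "\<forall>n. \<exists>v. v \<in> S \<and> f n = sample v" by blast
    then obtain v where v: "\<And>n. v n \<in> S" "\<And>n. f n = sample (v n)" by metis
    have li: "(\<lambda>n. v n (dense_seq i)) \<longlonglongrightarrow> l i" for i
    proof -
      have "continuous_on UNIV (\<lambda>u :: nat \<Rightarrow> 'a. u i)" by (rule continuous_on_product_coordinates)
      then have "isCont (\<lambda>u :: nat \<Rightarrow> 'a. u i) l"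
        using continuous_on_eq_continuous_at[OF open_UNIV] by blast
      then have "(\<lambda>n. f n i) \<longlonglongrightarrow> l i" using f isCont_tendsto_compose[of l "\<lambda>u. u i" f sequentially] by simp
      then show ?thesis by (simp add: v(2) sample_def)
    qed
    have L: "dist (l i) (l j) \<le> C * dist (dense_seq i :: 'a) (dense_seq j :: 'a)" for i j
    proof (rule LIMSEQ_le_const2)
      show "(\<lambda>n. dist (v n (dense_seq i)) (v n (dense_seq j))) \<longlonglongrightarrow> dist (l i) (l j)"
        by (intro tendsto_intros li)
      show "\<exists>N. \<forall>n\<ge>N. dist (v n (dense_seq i)) (v n (dense_seq j)) \<le> C * dist (dense_seq i :: 'a) (dense_seq j)"
        using lipschitz_onD[OF lip[OF v(1)] UNIV_I UNIV_I] by blast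
    qed
    (* The dense sequence may repeat points; the Lipschitz bound makes the value independent of the index. *)
  define g0 where "g0 = (\<lambda>x::'a. l (SOME i. dense_seq i = x))"
    have g0: "g0 (dense_seq i) = l i" for i
    proof -
      have "dense_seq (SOME j. dense_seq j = (dense_seq i :: 'a)) = (dense_seq i :: 'a)"
        by (rule someI[of "\<lambda>j. dense_seq j = (dense_seq i :: 'a)" i]) simp
      then show ?thesis using L[of "SOME j. dense_seq j = (dense_seq i :: 'a)" i] by (simp add: g0_def)
    qed
    have "C-lipschitz_on (range dense_seq) g0"
      by (rule lipschitz_onI) (use L C in \<open>auto simp: g0\<close>)
    from lipschitz_extend_closure[OF this] obtain g :: "'a \<Rightarrow> 'a" where
      g: "C-lipschitz_on UNIV g" "\<And>i. g (dense_seq i) = l i"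
      by (auto simp: closure_dense_seq g0)
    have "g \<in> S"
    proof (rule closedin_cc_locally_uniform[OF S lipschitz_imp_C0[OF g(1)]])
      fix n :: nat and e :: real assume e: "0 < e"
      define \<delta> where "\<delta> = e / (4 * (C + 1))"
      have \<delta>: "0 < \<delta>" using e C by (simp add: \<delta>_def)
      obtain N where N: "\<And>x::'a. norm x \<le> real n \<Longrightarrow> \<exists>i\<le>N. dist x (dense_seq i) < \<delta>"
        using dense_seq_net[OF \<delta>] by blast
      have "\<forall>\<^sub>F m in sequentially. \<forall>i\<in>{..N}. dist (v m (dense_seq i)) (l i) < e / 2"
        using e by (intro eventually_ball_finite ballI tendstoD[OF li]) auto
      then obtain m where m: "\<And>i. i \<le> N \<Longrightarrow> dist (v m (dense_seq i)) (l i) < e / 2"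
        by (auto dest!: eventually_happens'[OF sequentially_bot])
      have "norm (g x - v m x) \<le> e" if x: "norm x \<le> real n" for x
      proof -
        obtain i where i: "i \<le> N" "dist x (dense_seq i) < \<delta>" using N[OF x] by blast
        have "norm (g x - v m x) \<le> norm (g (dense_seq i) - v m (dense_seq i)) + (C + C) * \<delta>"
          using i by (intro lipschitz_diff_near[OF g(1) lip[OF v(1)]]) auto
        also have "norm (g (dense_seq i) - v m (dense_seq i)) \<le> e / 2"
          using m[OF i(1)] by (simp add: g(2) dist_norm norm_minus_commute)
        also have "(C + C) * \<delta> \<le> e / 2" using e C by (simp add: \<delta>_def field_simps)
        finally show ?thesis by simp
      qed
      then show "\<exists>w\<in>S. \<forall>x. norm x \<le> real n \<longrightarrow> norm (g x - w x) \<le> e" using v(1) by blast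
    qed
    moreover have "sample g = l" by (simp add: sample_def g(2))
    ultimately show "l \<in> sample ` S" by blast
  qed
  moreover have "sample ` S \<subseteq> PiE UNIV B" using bd by (auto simp: B_def sample_def)
  ultimately show ?thesis using cB by (metis compact_Int_closed inf.absorb2)
qed

text \<open>On fields with a common Lipschitz constant the topology of \<open>C0\<close> agrees with
  convergence at the points of the dense sequence. Splitting time according to the size of the
  Lipschitz constant therefore reduces the measurability of a curve of fields to that of its
  evaluations.\<close>

lemma field_measurable_of_evaluations:
  assumes lip: "\<And>t. t \<in> {0..T} \<Longrightarrow> (l t)-lipschitz_on UNIV (v t)"
    and l: "l \<in> borel_measurable (lebesgue_on {0..T})"
    and ev: "\<And>x. (\<lambda>t. v t x) \<in> borel_measurable (lebesgue_on {0..T})"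
  shows "field_measurable T v"
  unfolding field_measurable_def
proof (rule measurable_measure_of)
  show "{U. openin cc_topology U} \<subseteq> Pow C0" using openin_subset by fastforce
  show "v \<in> space (lebesgue_on {0..T}) \<rightarrow> C0"
    by (rule Pi_I, rule lipschitz_imp_C0, rule lip) simp
  fix U :: "('a \<Rightarrow> 'a) set" assume "U \<in> {U. openin cc_topology U}"
  then have U: "openin cc.mtopology U" by (simp add: mtopology_cc)
  have sm: "(\<lambda>t. sample (v t)) \<in> borel_measurable (lebesgue_on {0..T})"
    by (rule measurable_coordinatewise_then_product) (simp add: sample_def ev)
  (* The largest open set of sequences for which N-Lipschitz fields with a sample in it belong to U. *)
  define Op where "Op = (\<lambda>N. \<Union>{W. open W \<and> (\<forall>w. N-lipschitz_on UNIV w \<longrightarrow> sample w \<in> W \<longrightarrow> w \<in> U)})"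
  have key: "sample u \<in> Op N \<longleftrightarrow> u \<in> U" if u: "N-lipschitz_on UNIV u" for N u
  proof
    show "u \<in> U" if "sample u \<in> Op N" using that u by (auto simp: Op_def)
    assume uU: "u \<in> U"
    have N: "0 \<le> N" using u by (rule lipschitz_on_nonneg)
    obtain r where r: "r > 0" "cc.mball u r \<subseteq> U" using U uU unfolding cc.openin_mtopology by blast
    obtain n where n: "(1 / 2 :: real) ^ n < r / 2" using real_arch_pow_inv[of "r/2" "1/2"] r by auto
    define \<delta> where "\<delta> = r / (8 * (N + 1))"
    have \<delta>: "0 < \<delta>" using r N by (simp add: \<delta>_def)
    obtain m where m: "\<And>x::'a. norm x \<le> real n \<Longrightarrow> \<exists>i\<le>m. dist x (dense_seq i) < \<delta>"
      using dense_seq_net[OF \<delta>] by blast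
    define W where "W = (\<Inter>i\<in>{..m}. {f. norm (f i - u (dense_seq i)) < r / 4})"
    have "open W" unfolding W_def
      by (intro open_INT ballI open_Collect_less continuous_intros continuous_on_product_coordinates) auto
    moreover have "w \<in> U" if w: "N-lipschitz_on UNIV w" "sample w \<in> W" for w
    proof -
      have "norm (u x - w x) \<le> r / 2" if x: "norm x \<le> real n" for x
      proof -
        obtain i where i: "i \<le> m" "dist x (dense_seq i) < \<delta>" using m[OF x] by blast
        have "norm (u x - w x) \<le> norm (u (dense_seq i) - w (dense_seq i)) + (N + N) * \<delta>"
          using i by (intro lipschitz_diff_near[OF u w(1)]) auto
        also have "norm (u (dense_seq i) - w (dense_seq i)) \<le> r / 4"
          using w(2) i(1) by (auto simp: W_def sample_def norm_minus_commute intro: less_imp_le)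
        also have "(N + N) * \<delta> \<le> r / 4" using r N by (simp add: \<delta>_def field_simps)
        finally show ?thesis by simp
      qed
      then have "d_cc u w \<le> r / 2 + (1 / 2) ^ n" using r by (intro d_cc_le) auto
      then have "w \<in> cc.mball u r" using n lipschitz_imp_C0[OF u] lipschitz_imp_C0[OF w(1)] by simp
      then show "w \<in> U" using r by blast
    qed
    moreover have "sample u \<in> W" using r by (simp add: W_def sample_def)
    ultimately show "sample u \<in> Op N" unfolding Op_def by blast
  qed
  have "v -` U \<inter> space (lebesgue_on {0..T})
     = (\<Union>N::nat. {t \<in> space (lebesgue_on {0..T}). l t \<le> real N} \<inter> ((\<lambda>t. sample (v t)) -` Op (real N) \<inter> space (lebesgue_on {0..T})))"
  proof (intro equalityI subsetI)
    fix t assume t: "t \<in> v -` U \<inter> space (lebesgue_on {0..T})"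
    obtain N where N: "l t \<le> real N" using real_arch_simple by blast
    then have "(real N)-lipschitz_on UNIV (v t)" using lip t by (auto intro: lipschitz_on_mono)
    then show "t \<in> (\<Union>N::nat. {t \<in> space (lebesgue_on {0..T}). l t \<le> real N} \<inter> ((\<lambda>t. sample (v t)) -` Op (real N) \<inter> space (lebesgue_on {0..T})))"
      using t N key[of "real N" "v t"] by auto
  next
    fix t assume "t \<in> (\<Union>N::nat. {t \<in> space (lebesgue_on {0..T}). l t \<le> real N} \<inter> ((\<lambda>t. sample (v t)) -` Op (real N) \<inter> space (lebesgue_on {0..T})))"
    then obtain N :: nat where N: "t \<in> {0..T}" "l t \<le> real N" "sample (v t) \<in> Op (real N)" by auto
    then have "(real N)-lipschitz_on UNIV (v t)" using lip by (auto intro: lipschitz_on_mono)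
    then show "t \<in> v -` U \<inter> space (lebesgue_on {0..T})" using N key by auto
  qed
  also have "\<dots> \<in> sets (lebesgue_on {0..T})"
  proof -
    have "{t \<in> space (lebesgue_on {0..T}). l t \<le> real N} \<in> sets (lebesgue_on {0..T})" for N
      using l by measurable
    moreover have "(\<lambda>t. sample (v t)) -` Op (real N) \<inter> space (lebesgue_on {0..T}) \<in> sets (lebesgue_on {0..T})" for N
    proof -
      have "open (Op (real N))" unfolding Op_def by (rule open_Union) auto
      then show ?thesis by (intro measurable_sets[OF sm]) auto
    qed
    ultimately have "{t \<in> space (lebesgue_on {0..T}). l t \<le> real N} \<inter>
      ((\<lambda>t. sample (v t)) -` Op (real N) \<inter> space (lebesgue_on {0..T})) \<in> sets (lebesgue_on {0..T})" for N
      by (rule sets.Int)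
    then show ?thesis by (intro sets.countable_UN image_subsetI)
  qed
  finally show "v -` U \<inter> space (lebesgue_on {0..T}) \<in> sets (lebesgue_on {0..T})" .
qed

section \<open>Couplings and countable approximation of measures\<close>

lemma Wp_le_of_coupling:
  assumes p: "1 \<le> p" and \<gamma>: "\<gamma> \<in> couplings \<mu> \<nu>" and d: "0 \<le> d"
    and le: "(\<integral>\<^sup>+ (x, y). ennreal (norm (x - y) powr p) \<partial>\<gamma>) \<le> ennreal (d powr p)"
  shows "Wp p \<mu> \<nu> \<le> ennreal d"
proof -
  define c where "c = (INF \<gamma>\<in>couplings \<mu> \<nu>. \<integral>\<^sup>+ (x, y). ennreal (norm (x - y) powr p) \<partial>\<gamma>)"
  have c: "c \<le> ennreal (d powr p)" unfolding c_def using le by (rule INF_lower2[OF \<gamma>])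
  then have "c \<noteq> \<infinity>" by (metis ennreal_neq_top infinity_ennreal_def top.extremum_unique)
  moreover have "enn2real c powr (1 / p) \<le> d"
  proof -
    have "enn2real c \<le> d powr p" using c by (intro enn2real_leI) auto
    then have "enn2real c powr (1 / p) \<le> (d powr p) powr (1 / p)" using p by (intro powr_mono2) auto
    also have "\<dots> = d" using p d by (simp add: powr_powr)
    finally show ?thesis .
  qed
  ultimately show ?thesis by (simp add: Wp_def c_def[symmetric] Let_def ennreal_leI)
qed

lemma Wp_distr_le:
  fixes X Y :: "'b \<Rightarrow> 'a::euclidean_space"
  assumes p: "1 \<le> p" and M: "prob_space M" and X[measurable]: "X \<in> borel_measurable M"
    and Y[measurable]: "Y \<in> borel_measurable M" and d: "0 \<le> d"
    and le: "(\<integral>\<^sup>+ x. ennreal (norm (X x - Y x) powr p) \<partial>M) \<le> ennreal (d powr p)"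
  shows "Wp p (distr M borel X) (distr M borel Y) \<le> ennreal d"
proof (rule Wp_le_of_coupling[OF p _ d])
  have m[measurable]: "(\<lambda>x. (X x, Y x)) \<in> borel_measurable M" by measurable
  have fs[measurable]: "fst \<in> borel_measurable (borel :: ('a \<times> 'a) measure)"
    "snd \<in> borel_measurable (borel :: ('a \<times> 'a) measure)"
    by (intro borel_measurable_continuous_onI continuous_intros)+
  show "distr M borel (\<lambda>x. (X x, Y x)) \<in> couplings (distr M borel X) (distr M borel Y)"
    unfolding couplings_def
    by (auto simp: distr_distr[OF fs(1) m] distr_distr[OF fs(2) m] o_def intro: prob_space.prob_space_distr[OF M])
  have "(\<lambda>z. ennreal (norm (fst z - snd z) powr p)) \<in> borel_measurable (borel :: ('a \<times> 'a) measure)"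
    using fs by measurable
  then show "(\<integral>\<^sup>+ (x, y). ennreal (norm (x - y) powr p) \<partial>distr M borel (\<lambda>x. (X x, Y x))) \<le> ennreal (d powr p)"
    using le by (subst nn_integral_distr) (auto simp: case_prod_beta')
qed

lemma integrable_one_plus_norm_powr:
  assumes p: "1 \<le> p" and \<mu>: "\<mu> \<in> Pp p"
  shows "integrable \<mu> (\<lambda>x. (1 + norm x) powr p)"
proof -
  interpret prob_space \<mu> using \<mu> by (simp add: Pp_def)
  have [measurable_cong]: "sets \<mu> = sets borel" using \<mu> by (simp add: Pp_def)
  show ?thesis
  proof (rule Bochner_Integration.integrable_bound)
    show "integrable \<mu> (\<lambda>x. 2 powr p * (1 + norm x powr p))" using \<mu> by (auto simp: Pp_def)
    show "(\<lambda>x. (1 + norm x) powr p) \<in> borel_measurable \<mu>" by measurable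
    have "norm ((1 + norm x) powr p) \<le> norm (2 powr p * (1 + norm x powr p))" for x :: 'a
    proof -
      have "(1 + norm x) powr p \<le> (2 * max 1 (norm x)) powr p" using p by (intro powr_mono2) auto
      also have "\<dots> = 2 powr p * (max 1 (norm x)) powr p" by (rule powr_mult)
      also have "(max 1 (norm x)) powr p \<le> 1 + norm x powr p" by (auto simp: max_def)
      finally show ?thesis by simp
    qed
    then show "AE x in \<mu>. norm ((1 + norm x) powr p) \<le> norm (2 powr p * (1 + norm x powr p))" by simp
  qed
qed

text \<open>The norm of \<open>1 + \<bar>x\<bar>\<close> in \<open>L\<^sup>p(\<mu>)\<close>. All displacements of particles below are bounded by a
  multiple of \<open>1 + \<bar>x\<bar>\<close> uniformly in \<open>x\<close>, and this constant converts such a bound into a bound for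
  the Wasserstein distance, without the triangle inequality for that distance.\<close>

definition weight_norm :: "real \<Rightarrow> 'a::euclidean_space measure \<Rightarrow> real" where
  "weight_norm p \<mu> = (\<integral>x. (1 + norm x) powr p \<partial>\<mu>) powr (1 / p)"

lemma weight_norm_nonneg: "0 \<le> weight_norm p \<mu>"
  by (simp add: weight_norm_def)

lemma nn_integral_weight:
  assumes p: "1 \<le> p" and \<mu>: "\<mu> \<in> Pp p"
  shows "(\<integral>\<^sup>+x. ennreal ((1 + norm x) powr p) \<partial>\<mu>) = ennreal (weight_norm p \<mu> powr p)"
proof -
  have "(\<integral>\<^sup>+x. ennreal ((1 + norm x) powr p) \<partial>\<mu>) = ennreal (\<integral>x. (1 + norm x) powr p \<partial>\<mu>)"
    by (rule nn_integral_eq_integral[OF integrable_one_plus_norm_powr[OF assms]]) auto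
  moreover have "0 \<le> (\<integral>x. (1 + norm x) powr p \<partial>\<mu>)" by (rule Bochner_Integration.integral_nonneg) auto
  ultimately show ?thesis using p by (simp add: weight_norm_def powr_powr)
qed

lemma nn_integral_le_weight:
  assumes p: "1 \<le> p" and \<mu>: "\<mu> \<in> Pp p" and c: "0 \<le> c" and le: "\<And>x. norm (Z x) \<le> c * (1 + norm x)"
  shows "(\<integral>\<^sup>+x. ennreal (norm (Z x) powr p) \<partial>\<mu>) \<le> ennreal ((c * weight_norm p \<mu>) powr p)"
proof -
  have [measurable_cong]: "sets \<mu> = sets borel" using \<mu> by (simp add: Pp_def)
  have "(\<integral>\<^sup>+x. ennreal (norm (Z x) powr p) \<partial>\<mu>) \<le> (\<integral>\<^sup>+x. ennreal (c powr p) * ennreal ((1 + norm x) powr p) \<partial>\<mu>)"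
  proof (rule nn_integral_mono)
    fix x
    have "norm (Z x) powr p \<le> (c * (1 + norm x)) powr p" using p le[of x] by (intro powr_mono2) auto
    also have "\<dots> = c powr p * (1 + norm x) powr p" by (rule powr_mult)
    finally show "ennreal (norm (Z x) powr p) \<le> ennreal (c powr p) * ennreal ((1 + norm x) powr p)"
      by (simp add: ennreal_mult[symmetric] ennreal_leI)
  qed
  also have "\<dots> = ennreal (c powr p) * ennreal (weight_norm p \<mu> powr p)"
    by (subst nn_integral_cmult) (auto simp: nn_integral_weight[OF p \<mu>])
  also have "\<dots> = ennreal ((c * weight_norm p \<mu>) powr p)"
    using c weight_norm_nonneg[of p \<mu>] by (simp add: ennreal_mult[symmetric] powr_mult)
  finally show ?thesis .
qed

lemma Wp_distr_le_weight:
  assumes p: "1 \<le> p" and \<mu>: "\<mu> \<in> Pp p" and X: "X \<in> borel_measurable borel" and Y: "Y \<in> borel_measurable borel"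
    and c: "0 \<le> c" and le: "\<And>x. norm (X x - Y x) \<le> c * (1 + norm x)"
  shows "Wp p (distr \<mu> borel X) (distr \<mu> borel Y) \<le> ennreal (c * weight_norm p \<mu>)"
proof (rule Wp_distr_le[OF p])
  have s: "sets \<mu> = sets borel" using \<mu> by (simp add: Pp_def)
  show "prob_space \<mu>" using \<mu> by (simp add: Pp_def)
  show "X \<in> borel_measurable \<mu>" "Y \<in> borel_measurable \<mu>" using X Y by (simp_all add: measurable_cong_sets[OF s refl])
qed (use nn_integral_le_weight[OF p \<mu> c le] c weight_norm_nonneg[of p \<mu>] in auto)

lemma distr_Pp:
  assumes p: "1 \<le> p" and \<mu>: "\<mu> \<in> Pp p" and X: "X \<in> borel_measurable borel"
    and c: "0 \<le> c" and le: "\<And>x. norm (X x) \<le> c * (1 + norm x)"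
  shows "distr \<mu> borel X \<in> Pp p" and "moment p (distr \<mu> borel X) \<le> c * weight_norm p \<mu>"
proof -
  have s: "sets \<mu> = sets borel" using \<mu> by (simp add: Pp_def)
  have X'[measurable]: "X \<in> borel_measurable \<mu>" using X by (simp add: measurable_cong_sets[OF s refl])
  have ps: "prob_space \<mu>" using \<mu> by (simp add: Pp_def)
  have nn: "(\<integral>\<^sup>+x. ennreal (norm (X x) powr p) \<partial>\<mu>) \<le> ennreal ((c * weight_norm p \<mu>) powr p)"
    by (rule nn_integral_le_weight[OF p \<mu> c le])
  then have fin: "(\<integral>\<^sup>+x. ennreal (norm (X x) powr p) \<partial>\<mu>) < \<infinity>" by (rule le_less_trans) simp
  have int: "integrable \<mu> (\<lambda>x. norm (X x) powr p)"
    using fin by (intro integrableI_bounded) auto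
  then show "distr \<mu> borel X \<in> Pp p"
    by (simp add: Pp_def prob_space.prob_space_distr[OF ps] integrable_distr_eq)
  have "ennreal (\<integral>x. norm (X x) powr p \<partial>\<mu>) \<le> ennreal ((c * weight_norm p \<mu>) powr p)"
    using nn nn_integral_eq_integral[OF int] by simp
  then have "(\<integral>x. norm (X x) powr p \<partial>\<mu>) \<le> (c * weight_norm p \<mu>) powr p"
    by (simp add: ennreal_le_iff)
  moreover have "0 \<le> (\<integral>x. norm (X x) powr p \<partial>\<mu>)" by (rule Bochner_Integration.integral_nonneg) auto
  ultimately have "(\<integral>x. norm (X x) powr p \<partial>\<mu>) powr (1 / p) \<le> ((c * weight_norm p \<mu>) powr p) powr (1 / p)"
    using p by (intro powr_mono2) auto
  also have "\<dots> = c * weight_norm p \<mu>"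
    using p c weight_norm_nonneg[of p \<mu>] by (simp add: powr_powr)
  finally show "moment p (distr \<mu> borel X) \<le> c * weight_norm p \<mu>"
    unfolding moment_def by (subst integral_distr) auto
qed

lemma nn_integral_tail_small:
  fixes f :: "'a::euclidean_space \<Rightarrow> real"
  assumes f: "integrable \<mu> f" and f0: "\<And>x. 0 \<le> f x" and s: "sets \<mu> = sets borel" and e: "0 < e"
  shows "\<exists>R>0. (\<integral>\<^sup>+x. ennreal (f x * indicator {x. R < norm x} x) \<partial>\<mu>) \<le> ennreal e"
proof -
  note [measurable_cong] = s
  have fm[measurable]: "f \<in> borel_measurable borel" using borel_measurable_integrable[OF f] by (simp add: measurable_cong_sets[OF s refl])
  have lim: "(\<lambda>n. \<integral>x. f x * indicator {x. real n < norm x} x \<partial>\<mu>) \<longlonglongrightarrow> (\<integral>x. 0 \<partial>\<mu>)"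
  proof (rule integral_dominated_convergence[OF _ _ f])
    show "AE x in \<mu>. (\<lambda>n. f x * indicator {x. real n < norm x} x) \<longlonglongrightarrow> 0"
    proof (rule AE_I2)
      fix x :: 'a
      obtain k :: nat where "norm x \<le> real k" using real_arch_simple by blast
      then have "\<forall>\<^sub>F n in sequentially. f x * indicator {x. real n < norm x} x = 0"
        by (intro eventually_sequentiallyI[of k]) (auto simp: indicator_def)
      then show "(\<lambda>n. f x * indicator {x. real n < norm x} x) \<longlonglongrightarrow> 0" by (rule tendsto_eventually)
    qed
    show "AE x in \<mu>. norm (f x * indicator {x. real n < norm x} x) \<le> f x" for n
      using f0 by (auto simp: indicator_def)
  qed measurable
  then have "\<forall>\<^sub>F n in sequentially. (\<integral>x. f x * indicator {x. real n < norm x} x \<partial>\<mu>) < e"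
    using e by (simp add: order_tendsto_iff)
  then have "\<forall>\<^sub>F n in sequentially. 0 < n \<and> (\<integral>x. f x * indicator {x. real n < norm x} x \<partial>\<mu>) < e"
    using eventually_gt_at_top[of 0] by eventually_elim auto
  then obtain n :: nat where n: "0 < n" "(\<integral>x. f x * indicator {x. real n < norm x} x \<partial>\<mu>) < e"
    by (auto dest!: eventually_happens'[OF sequentially_bot])
  have "integrable \<mu> (\<lambda>x. f x * indicator {x. real n < norm x} x)"
    by (rule Bochner_Integration.integrable_bound[OF f]) (measurable, use f0 in \<open>auto simp: indicator_def\<close>)
  then have "(\<integral>\<^sup>+x. ennreal (f x * indicator {x. real n < norm x} x) \<partial>\<mu>) = ennreal (\<integral>x. f x * indicator {x. real n < norm x} x \<partial>\<mu>)"
    using f0 by (intro nn_integral_eq_integral) auto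
  then show ?thesis using n by (intro exI[of _ "real n"]) (auto intro: ennreal_leI less_imp_le)
qed

text \<open>The law that charges the origin and the first points of the dense sequence with the given
  rational weights. Indexing by lists of rationals makes the family countable.\<close>

definition discrete_law :: "rat list \<Rightarrow> 'a::euclidean_space measure" where
  "discrete_law ws = distr (density (count_space UNIV) (\<lambda>k. ennreal (if k < length ws then of_rat (ws ! k) else 0)))
      borel (case_nat 0 dense_seq)"

lemma emeasure_uniform_threshold:
  assumes "0 \<le> b" "b \<le> a" "0 < (a::real)"
  shows "emeasure (uniform_measure lborel {0..1}) {u. u * a \<le> b} = ennreal (b / a)"
proof -
  have "{u. u * a \<le> b} = {..b / a}" using assms by (auto simp: field_simps)
  moreover have "b / a \<le> 1" using assms by simp
  ultimately have "{0..1} \<inter> {u. u * a \<le> b} = {0..b / a}" by auto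
  then show ?thesis using assms by (subst emeasure_uniform_measure) (auto simp: divide_ennreal simp flip: ennreal_1)
qed

text \<open>Round \<open>x\<close> to a nearby point of a finite net, or to the origin if \<open>x\<close> is far away. The
  law of the rounded point has finite support but real weights; to make the weights rational, an
  independent uniform variable decides whether a point is kept at its rounded position or sent to
  the origin, so that each nonzero position keeps a slightly smaller rational weight. The joint law
  of \<open>x\<close> and its final position is the coupling that bounds the distance.\<close>

lemma discrete_law_approximates:
  fixes \<mu> :: "'a::euclidean_space measure"
  assumes p: "1 \<le> p" and \<mu>: "\<mu> \<in> Pp p" and e: "0 < e"
  shows "\<exists>ws. (discrete_law ws :: 'a measure) \<in> Pp p \<and> Wp p \<mu> (discrete_law ws) \<le> ennreal e"
proof -
  have s[measurable_cong]: "sets \<mu> = sets borel" using \<mu> by (simp add: Pp_def)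
  have sp: "space \<mu> = UNIV" using sets_eq_imp_space_eq[OF s] by simp
  interpret \<mu>: prob_space \<mu> using \<mu> by (simp add: Pp_def)
  define U where "U = uniform_measure lborel {0..1::real}"
  interpret U: prob_space U unfolding U_def by (rule prob_space_uniform_measure) auto
  have sU[measurable_cong]: "sets U = sets borel" by (simp add: U_def)
  have spU: "space U = UNIV" by (simp add: U_def)
  interpret MU: pair_prob_space \<mu> U ..
  let ?M = "\<mu> \<Otimes>\<^sub>M U"
  have spM: "space ?M = UNIV" by (simp add: space_pair_measure sp spU)
  have ep: "0 < e powr p / 3" using e by simp
  obtain R where R: "R > 0" "(\<integral>\<^sup>+x. ennreal (norm x powr p * indicator {x. R < norm x} x) \<partial>\<mu>) \<le> ennreal (e powr p / 3)"
    using nn_integral_tail_small[of \<mu> "\<lambda>x. norm x powr p", OF _ _ s ep] \<mu> by (auto simp: Pp_def)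
  obtain N where N: "\<And>x::'a. norm x \<le> R \<Longrightarrow> \<exists>i\<le>N. dist x (dense_seq i) < e / 3"
    using dense_seq_net[of "e/3" R] e by auto
  define J where "J = (\<lambda>x::'a. if norm x \<le> R then Suc (LEAST i. dist x (dense_seq i) < e / 3) else 0)"
  have J[measurable]: "J \<in> borel \<rightarrow>\<^sub>M count_space UNIV" unfolding J_def by measurable
  have J1: "dist x (case_nat 0 dense_seq (J x)) < e / 3" "J x \<le> Suc N" if x: "norm x \<le> R" for x
  proof -
    obtain i where i: "i \<le> N" "dist x (dense_seq i) < e / 3" using N[OF x] by blast
    show "dist x (case_nat 0 dense_seq (J x)) < e / 3"
      using LeastI[of "\<lambda>i. dist x (dense_seq i) < e / 3", OF i(2)] x by (simp add: J_def)
    show "J x \<le> Suc N"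
      using Least_le[of "\<lambda>i. dist x (dense_seq i) < e / 3", OF i(2)] x i(1) by (simp add: J_def)
  qed
  have JN: "J x \<le> Suc N" for x using J1(2)[of x] by (cases "norm x \<le> R") (auto simp: J_def)
  define a where "a = (\<lambda>k. measure \<mu> {x. J x = k})"
  have Jk[measurable]: "{x. J x = k} \<in> sets borel" for k by measurable
  have a0: "0 \<le> a k" for k by (simp add: a_def)
  have ea: "emeasure \<mu> {x. J x = k} = ennreal (a k)" for k by (simp add: a_def \<mu>.emeasure_eq_measure)
  (* Rounding each weight down to a multiple of 1 / m loses a total mass of at most (N + 2) / m. *)
  obtain m :: nat where m: "3 * R powr p * real (N + 2) / e powr p < real m" using reals_Archimedean2 by blast
  have "0 \<le> 3 * R powr p * real (N + 2) / e powr p" by simp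
  then have m0: "0 < m" using m by linarith
  define b where "b = (\<lambda>k. real_of_int \<lfloor>real m * a k\<rfloor> / real m)"
  have b0: "0 \<le> b k" for k using a0[of k] m0 by (simp add: b_def)
  have ba: "b k \<le> a k" for k using m0 by (simp add: b_def field_simps)
  have ab: "a k - b k \<le> 1 / real m" for k
  proof -
    have *: "real m * a k - real_of_int \<lfloor>real m * a k\<rfloor> \<le> 1" by linarith
    have "a k - b k = (real m * a k - real_of_int \<lfloor>real m * a k\<rfloor>) / real m"
      using m0 by (simp add: b_def diff_divide_distrib)
    then show ?thesis using divide_right_mono[OF *, of "real m"] by linarith
  qed
  define keep where "keep = (\<lambda>(x, u::real). u * a (J x) \<le> b (J x))"
  have aJ[measurable]: "(\<lambda>x. a (J x)) \<in> borel_measurable borel" "(\<lambda>x. b (J x)) \<in> borel_measurable borel"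
    by (rule measurable_compose[OF J]; simp)+
  have keepm[measurable]: "Measurable.pred ?M keep" unfolding keep_def by measurable
  define J' where "J' = (\<lambda>z. if keep z then J (fst z) else 0)"
  have J'[measurable]: "J' \<in> ?M \<rightarrow>\<^sub>M count_space UNIV" unfolding J'_def by measurable
  have eU: "emeasure ?M {z. J (fst z) = k \<and> keep z} = ennreal (b k)" for k
  proof -
    have eq: "{z. J (fst z) = k \<and> keep z} = {x. J x = k} \<times> {u. u * a k \<le> b k}"
      by (auto simp: keep_def)
    have "emeasure ?M {z. J (fst z) = k \<and> keep z} = ennreal (a k) * emeasure U {u. u * a k \<le> b k}"
      unfolding eq by (subst U.emeasure_pair_measure_Times) (auto simp: ea)
    also have "\<dots> = ennreal (b k)"
    proof (cases "a k = 0")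
      case True
      then show ?thesis using b0[of k] ba[of k] by simp
    next
      case False
      then have "0 < a k" using a0[of k] by simp
      then show ?thesis
        using emeasure_uniform_threshold[OF b0 ba] by (simp add: U_def ennreal_mult[symmetric] a0 b0)
    qed
    finally show ?thesis .
  qed
  define pk where "pk = (\<lambda>k. measure ?M (J' -` {k}))"
  have pkb: "pk k = b k" if "k \<noteq> 0" for k
  proof -
    have "J' -` {k} = {z. J (fst z) = k \<and> keep z}" using that by (auto simp: J'_def split: if_splits)
    then show ?thesis using eU[of k] b0[of k] by (simp add: pk_def measure_def)
  qed
  have J'N: "J' z \<le> Suc N" for z using JN by (simp add: J'_def)
  have J's: "J' -` {k} \<in> sets ?M" for k using measurable_sets[OF J', of "{k}"] by (simp add: spM)
  have sum1: "(\<Sum>k\<le>Suc N. pk k) = 1"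
  proof -
    have "measure ?M (\<Union>k\<in>{..Suc N}. J' -` {k}) = (\<Sum>k\<le>Suc N. pk k)"
      unfolding pk_def using J's
      by (intro MU.finite_measure_finite_Union) (auto simp: disjoint_family_on_def)
    moreover have "(\<Union>k\<in>{..Suc N}. J' -` {k}) = space ?M" using J'N by (auto simp: spM)
    ultimately show ?thesis using MU.prob_space by simp
  qed
  have rat: "pk k \<in> \<rat>" for k
  proof -
    have *: "pk k \<in> \<rat>" if "k \<noteq> 0" for k using that by (simp add: pkb b_def)
    have "pk 0 = 1 - (\<Sum>k\<in>{1..Suc N}. pk k)"
      using sum1 by (simp add: sum.atMost_shift atMost_atLeast0 sum.atLeast_Suc_atMost)
    moreover have "(\<Sum>k\<in>{1..Suc N}. pk k) \<in> \<rat>" by (rule Rats_sum) (use * in auto)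
    ultimately show ?thesis using * by (cases "k = 0") auto
  qed
  then have "\<forall>k. \<exists>q. pk k = of_rat q" by (auto simp: Rats_def)
  then obtain w :: "nat \<Rightarrow> rat" where w: "\<And>k. pk k = of_rat (w k)" by metis
  define ws where "ws = map w [0..<Suc (Suc N)]"
  define Y where "Y = (\<lambda>z. case_nat 0 dense_seq (J' z) :: 'a)"
  have Ym[measurable]: "Y \<in> borel_measurable ?M" unfolding Y_def by (rule measurable_compose[OF J']) simp
  have law: "distr ?M borel Y = discrete_law ws"
  proof -
    have "distr ?M (count_space UNIV) J' = density (count_space UNIV) (\<lambda>k. ennreal (if k < length ws then of_rat (ws ! k) else 0))"
    proof (rule measure_eqI_countable[where A=UNIV])
      fix k :: nat
      have "emeasure (distr ?M (count_space UNIV) J') {k} = ennreal (pk k)"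
        by (subst emeasure_distr) (auto simp: spM pk_def MU.emeasure_eq_measure)
      moreover have "pk k = 0" if "Suc N < k"
      proof -
        have "J' -` {k} = {}" using J'N that by (metis (mono_tags, lifting) disjoint_iff leD vimage_singleton_eq equals0I)
        then show ?thesis by (simp add: pk_def)
      qed
      ultimately show "emeasure (distr ?M (count_space UNIV) J') {k} = emeasure (density (count_space UNIV)
          (\<lambda>k. ennreal (if k < length ws then of_rat (ws ! k) else 0))) {k}"
        using w by (auto simp: emeasure_density ws_def nn_integral_count_space_indicator[symmetric] nn_integral_indicator_finite not_less simp del: upt_Suc)
    qed auto
    then have "discrete_law ws = distr (distr ?M (count_space UNIV) J') borel (case_nat 0 dense_seq)"
      by (simp add: discrete_law_def)
    also have "\<dots> = distr ?M borel Y" by (subst distr_distr) (auto simp: Y_def o_def)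
    finally show ?thesis by simp
  qed
  have fstm: "distr ?M borel fst = \<mu>"
  proof -
    have "distr ?M borel fst = distr ?M \<mu> fst" by (rule distr_cong) (auto simp: s)
    then show ?thesis by (simp add: U.distr_pair_fst)
  qed
  obtain B where B: "\<And>k. k \<le> Suc N \<Longrightarrow> norm (case_nat 0 dense_seq k :: 'a) \<le> B"
  proof
    show "norm (case_nat 0 dense_seq k :: 'a) \<le> Max ((\<lambda>k. norm (case_nat 0 dense_seq k :: 'a)) ` {..Suc N})"
      if "k \<le> Suc N" for k using that by (intro Max_ge) auto
  qed
  have "integrable ?M (\<lambda>z. norm (Y z) powr p)"
  proof (rule MU.integrable_const_bound[where B="B powr p"])
    show "AE z in ?M. norm (norm (Y z) powr p) \<le> B powr p"
      using B[OF J'N] p by (auto simp: Y_def intro!: powr_mono2)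
  qed measurable
  then have Pp: "(discrete_law ws :: 'a measure) \<in> Pp p"
    unfolding law[symmetric] by (simp add: Pp_def MU.prob_space_distr integrable_distr_eq)
  have keepset: "{z. keep z} \<in> sets ?M" using measurable_sets[OF keepm, of "{True}"] by (simp add: spM vimage_def)
  have pkeep: "measure ?M {z. \<not> keep z} \<le> real (N + 2) / real m"
  proof -
    have "measure ?M {z. keep z} = measure ?M (\<Union>k\<in>{..Suc N}. {z. J (fst z) = k \<and> keep z})"
      using JN by (intro arg_cong[where f="measure ?M"]) auto
    also have "\<dots> = (\<Sum>k\<le>Suc N. measure ?M {z. J (fst z) = k \<and> keep z})"
    proof (rule MU.finite_measure_finite_Union)
      have "{z \<in> space ?M. J (fst z) = k \<and> keep z} \<in> sets ?M" for k by measurable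
      then show "(\<lambda>k. {z. J (fst z) = k \<and> keep z}) ` {..Suc N} \<subseteq> sets ?M" by (auto simp: spM)
    qed (auto simp: disjoint_family_on_def)
    also have "\<dots> = (\<Sum>k\<le>Suc N. b k)" using eU b0 by (simp add: measure_def)
    also have "\<dots> \<ge> (\<Sum>k\<le>Suc N. a k - 1 / real m)" using ab by (intro sum_mono) (simp add: algebra_simps)
    also have "(\<Sum>k\<le>Suc N. a k - 1 / real m) = (\<Sum>k\<le>Suc N. a k) - real (N + 2) / real m"
      by (simp add: sum_subtractf)
    also have "(\<Sum>k\<le>Suc N. a k) = measure \<mu> (\<Union>k\<in>{..Suc N}. {x. J x = k})"
      unfolding a_def by (intro \<mu>.finite_measure_finite_Union[symmetric]) (auto simp: disjoint_family_on_def s)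
    also have "(\<Union>k\<in>{..Suc N}. {x. J x = k}) = space \<mu>" using JN by (auto simp: sp)
    finally have "1 - real (N + 2) / real m \<le> measure ?M {z. keep z}" by (simp add: \<mu>.prob_space)
    moreover have "measure ?M {z. \<not> keep z} = 1 - measure ?M {z. keep z}"
      using MU.prob_compl[OF keepset] by (simp add: spM Compl_eq_Diff_UNIV[symmetric] Collect_neg_eq)
    ultimately show ?thesis by simp
  qed
  have e3: "(e / 3) powr p \<le> e powr p / 3"
  proof -
    have "(e / 3) powr p = e powr p * (1 / 3) powr p" using powr_mult[of e "1/3" p] by simp
    also have "(1 / 3) powr p \<le> (1 / 3 :: real) powr 1" using p by (intro powr_mono') auto
    finally show ?thesis by (simp add: mult_left_mono)
  qed
  have "Wp p (distr ?M borel fst) (distr ?M borel Y) \<le> ennreal e"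
  proof (rule Wp_distr_le[OF p])
    show "prob_space ?M" by (rule MU.prob_space_axioms)
    have nk: "{z. \<not> keep z} \<in> sets ?M"
      using sets.compl_sets[OF keepset] by (simp add: spM Compl_eq_Diff_UNIV[symmetric] Collect_neg_eq)
    have "(\<integral>\<^sup>+ z. ennreal (norm (fst z - Y z) powr p) \<partial>?M) \<le> (\<integral>\<^sup>+ z. ennreal (e powr p / 3)
        + (ennreal (norm (fst z) powr p * indicator {x. R < norm x} (fst z)) + ennreal (R powr p) * indicator {z. \<not> keep z} z) \<partial>?M)"
    proof (rule nn_integral_mono)
      fix z :: "'a \<times> real"
      have R0: "0 \<le> R powr p" by simp
      consider "R < norm (fst z)" | "norm (fst z) \<le> R" "keep z" | "norm (fst z) \<le> R" "\<not> keep z" by linarith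
      then show "ennreal (norm (fst z - Y z) powr p) \<le> ennreal (e powr p / 3)
        + (ennreal (norm (fst z) powr p * indicator {x. R < norm x} (fst z)) + ennreal (R powr p) * indicator {z. \<not> keep z} z)"
      proof cases
        case 1
        then have "Y z = 0" by (simp add: Y_def J'_def J_def)
        then show ?thesis using 1 by (auto intro!: add_increasing add_increasing2)
      next
        case 2
        then have "norm (fst z - Y z) \<le> e / 3" using J1(1)[of "fst z"] by (simp add: Y_def J'_def dist_norm)
        then have "norm (fst z - Y z) powr p \<le> (e / 3) powr p" using p by (intro powr_mono2) auto
        then have "norm (fst z - Y z) powr p \<le> e powr p / 3" using e3 by linarith
        then show ?thesis by (intro add_increasing2 ennreal_leI) auto
      next
        case 3
        then have "Y z = 0" by (simp add: Y_def J'_def)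
        moreover have "norm (fst z) powr p \<le> R powr p" using 3 p by (intro powr_mono2) auto
        ultimately show ?thesis using 3 by (auto intro!: add_increasing ennreal_leI)
      qed
    qed
    also have "\<dots> = ennreal (e powr p / 3) + ((\<integral>\<^sup>+ z. ennreal (norm (fst z) powr p * indicator {x. R < norm x} (fst z)) \<partial>?M)
        + ennreal (R powr p) * emeasure ?M {z. \<not> keep z})"
      using nk by (simp add: nn_integral_add nn_integral_cmult_indicator MU.emeasure_space_1)
    also have "(\<integral>\<^sup>+ z. ennreal (norm (fst z) powr p * indicator {x. R < norm x} (fst z)) \<partial>?M)
        = (\<integral>\<^sup>+ x. ennreal (norm x powr p * indicator {x. R < norm x} x) \<partial>distr ?M borel fst)"
      by (subst nn_integral_distr) auto
    also have "\<dots> \<le> ennreal (e powr p / 3)" unfolding fstm by (rule R(2))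
    also have "ennreal (R powr p) * emeasure ?M {z. \<not> keep z} \<le> ennreal (e powr p / 3)"
    proof -
      have "R powr p * measure ?M {z. \<not> keep z} \<le> R powr p * (real (N + 2) / real m)"
        using pkeep by (intro mult_left_mono) auto
      also have "\<dots> \<le> e powr p / 3" using m m0 e by (simp add: field_simps)
      finally show ?thesis by (simp add: MU.emeasure_eq_measure ennreal_mult[symmetric] ennreal_leI)
    qed
    also have "ennreal (e powr p / 3) + (ennreal (e powr p / 3) + ennreal (e powr p / 3)) = ennreal (e powr p)"
      using e by (simp add: ennreal_plus[symmetric] del: ennreal_plus)
    finally show "(\<integral>\<^sup>+ z. ennreal (norm (fst z - Y z) powr p) \<partial>?M) \<le> ennreal (e powr p)"
      by (simp add: add_mono)
  qed (use e in auto)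
  then show ?thesis using Pp unfolding fstm law by blast
qed

lemma Pp_separable:
  assumes p: "1 \<le> p"
  shows "\<exists>D::'a::euclidean_space measure set. countable D \<and> D \<subseteq> Pp p \<and>
    (\<forall>\<mu>\<in>Pp p. \<forall>e>0. \<exists>\<nu>\<in>D. Wp p \<mu> \<nu> \<le> ennreal e)"
proof (intro exI conjI)
  show "countable (range discrete_law \<inter> Pp p :: 'a measure set)" by (intro countable_Int1 countable_image) auto
  show "range discrete_law \<inter> Pp p \<subseteq> Pp p" by blast
  show "\<forall>\<mu>\<in>Pp p. \<forall>e>0. \<exists>\<nu>\<in>range discrete_law \<inter> Pp p. Wp p (\<mu> :: 'a measure) \<nu> \<le> ennreal e"
    using discrete_law_approximates[OF p] by blast
qed

section \<open>Selections of a Lipschitz inclusion along a curve of measures\<close>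

lemma integrable_lebesgue_on_iff:
  fixes f :: "real \<Rightarrow> 'b::euclidean_space"
  shows "integrable (lebesgue_on {a..b}) f \<longleftrightarrow> f absolutely_integrable_on {a..b}"
  by (simp add: integrable_restrict_space set_integrable_def)

lemma absolutely_integrable_bound:
  fixes f :: "real \<Rightarrow> 'b::euclidean_space"
  assumes "f \<in> borel_measurable (lebesgue_on {a..b})" "g absolutely_integrable_on {a..b}"
    "\<And>x. x \<in> {a..b} \<Longrightarrow> norm (f x) \<le> g x"
  shows "f absolutely_integrable_on {a..b}"
  using assms by (intro measurable_bounded_by_integrable_imp_absolutely_integrable[of f _ g])
    (auto simp: absolutely_integrable_on_def)

text \<open>Replace \<open>y\<close> by simple functions, on whose finitely many values only measurability in the
  first argument matters.\<close>

lemma caratheodory_measurable: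
  fixes f :: "'s \<Rightarrow> 'a::{metric_space, second_countable_topology} \<Rightarrow> 'b::{metric_space, second_countable_topology}"
  assumes cont: "\<And>s. s \<in> space M \<Longrightarrow> continuous_on UNIV (f s)"
    and meas: "\<And>x. (\<lambda>s. f s x) \<in> borel_measurable M" and y: "y \<in> borel_measurable M"
  shows "(\<lambda>s. f s (y s)) \<in> borel_measurable M"
proof -
  obtain F where F: "\<And>i. simple_function M (F i)" "\<And>s. s \<in> space M \<Longrightarrow> (\<lambda>i. F i s) \<longlonglongrightarrow> y s"
    using borel_measurable_implies_sequence_metric[OF y] by blast
  show ?thesis
  proof (rule borel_measurable_LIMSEQ_metric)
    fix i
    have fin: "finite (F i ` space M)" using F(1)[of i] by (simp add: simple_function_def)
    have gm: "F i \<in> M \<rightarrow>\<^sub>M count_space (F i ` space M)"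
      using F(1)[of i] fin by (subst measurable_count_space_eq2) (auto simp: simple_function_def)
    show "(\<lambda>s. f s (F i s)) \<in> borel_measurable M"
      by (rule measurable_compose_countable'[where f="\<lambda>x s. f s x" and g="F i", OF meas gm countable_finite[OF fin]])
  next
    fix s assume s: "s \<in> space M"
    have "isCont (f s) (y s)" using cont[OF s] by (simp add: continuous_on_eq_continuous_at)
    then show "(\<lambda>i. f s (F i s)) \<longlonglongrightarrow> f s (y s)" using F(2)[OF s] isCont_tendsto_compose by blast
  qed
qed

lemma dist_sample_le:
  assumes "\<And>i. norm (u i - w i) \<le> d"
  shows "dist u (w :: nat \<Rightarrow> 'a::euclidean_space) \<le> 2 * d"
proof -
  have d: "0 \<le> d" using assms[of 0] norm_ge_zero order_trans by blast
  have s: "summable (\<lambda>n. (1/2::real)^n * d)" by (intro summable_mult2 summable_geometric) simp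
  have le: "(1/2)^n * min (dist (u (from_nat n)) (w (from_nat n))) 1 \<le> (1/2)^n * d" for n
    using assms by (intro mult_left_mono min.coboundedI1) (auto simp: dist_norm)
  have "dist u w \<le> (\<Sum>n. (1/2::real)^n * d)"
    unfolding dist_fun_def using le s
    by (intro suminf_le summable_comparison_test'[OF s, of 0]) (auto simp: d)
  also have "\<dots> = 2 * d" using suminf_mult2[of "\<lambda>n. (1/2::real)^n" d] suminf_geometric[of "1/2::real"]
    by (simp add: summable_geometric)
  finally show ?thesis .
qed

lemma infdist_sample_le:
  assumes ne: "A \<noteq> {}" and close: "\<And>v. v \<in> A \<Longrightarrow> \<exists>w\<in>B. \<forall>x. norm (v x - w x) \<le> d"
  shows "infdist u (sample ` B) \<le> infdist u (sample ` A) + 2 * d"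
proof -
  have "infdist u (sample ` B) - 2 * d \<le> dist u a" if "a \<in> sample ` A" for a
  proof -
    obtain v where v: "v \<in> A" "a = sample v" using \<open>a \<in> sample ` A\<close> by blast
    obtain w where w: "w \<in> B" "\<And>x. norm (v x - w x) \<le> d" using close[OF v(1)] by blast
    have "infdist u (sample ` B) \<le> dist u (sample w)" using w(1) by (intro infdist_le) auto
    also have "\<dots> \<le> dist u a + dist a (sample w)" by (rule dist_triangle)
    also have "dist a (sample w) \<le> 2 * d" unfolding v(2) using w(2) by (intro dist_sample_le) (simp add: sample_def)
    finally show ?thesis by simp
  qed
  then have "infdist u (sample ` B) - 2 * d \<le> infdist u (sample ` A)"
    using ne by (subst (2) infdist_notempty) (auto intro!: cINF_greatest)
  then show ?thesis by simp
qed

lemma norm_le_from_dense: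
  assumes "continuous_on UNIV v" "continuous_on UNIV w" "\<And>i. norm (v (dense_seq i) - w (dense_seq i)) \<le> r"
  shows "norm (v x - w x) \<le> r"
proof (rule continuous_le_on_closure[of "range dense_seq" "\<lambda>x. norm (v x - w x)" x r])
  show "continuous_on (closure (range dense_seq)) (\<lambda>x. norm (v x - w x))"
    using assms(1,2) by (auto simp: closure_dense_seq intro!: continuous_intros)
qed (use assms(3) in \<open>auto simp: closure_dense_seq\<close>)

text \<open>The hypotheses on \<open>V\<close>, required at every time instead of almost every time. The theorem
  reduces to this case because \<open>V\<close> may be changed at the times of a null set.\<close>

locale lipschitz_inclusion =
  fixes p T :: real and V :: "real \<Rightarrow> 'a::euclidean_space measure \<Rightarrow> ('a \<Rightarrow> 'a) set"
    and m l L :: "real \<Rightarrow> real"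
  assumes p: "1 \<le> p" and T: "0 < T"
    and V_measurable: "\<And>\<mu>. \<mu> \<in> Pp p \<Longrightarrow> setvalued_measurable T (\<lambda>t. V t \<mu>)"
    and V_closed: "\<And>t \<mu>. t \<in> {0..T} \<Longrightarrow> \<mu> \<in> Pp p \<Longrightarrow> closedin cc_topology (V t \<mu>)"
    and V_nonempty: "\<And>t \<mu>. t \<in> {0..T} \<Longrightarrow> \<mu> \<in> Pp p \<Longrightarrow> V t \<mu> \<noteq> {}"
    and m: "m \<in> L1_nonneg T" and l: "l \<in> L1_nonneg T" and L: "L \<in> L1_nonneg T"
    and V_growth: "\<And>t \<mu> v x. t \<in> {0..T} \<Longrightarrow> \<mu> \<in> Pp p \<Longrightarrow> v \<in> V t \<mu> \<Longrightarrow>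
        norm (v x) \<le> m t * (1 + norm x + moment p \<mu>)"
    and V_lip: "\<And>t \<mu> v. t \<in> {0..T} \<Longrightarrow> \<mu> \<in> Pp p \<Longrightarrow> v \<in> V t \<mu> \<Longrightarrow> (l t)-lipschitz_on UNIV v"
    and V_sup: "\<And>t \<mu> \<nu> v. t \<in> {0..T} \<Longrightarrow> \<mu> \<in> Pp p \<Longrightarrow> \<nu> \<in> Pp p \<Longrightarrow> v \<in> V t \<mu> \<Longrightarrow>
        \<exists>w\<in>V t \<nu>. d_sup v w \<le> ennreal (L t) * Wp p \<mu> \<nu>"
begin

abbreviation "\<I> \<equiv> lebesgue_on {0..T}"

lemma L1_D:
  assumes "g \<in> L1_nonneg T"
  shows "g absolutely_integrable_on {0..T}" "\<And>t. t \<in> {0..T} \<Longrightarrow> 0 \<le> g t" "g \<in> borel_measurable \<I>"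
  using assms by (auto simp: L1_nonneg_def integrable_lebesgue_on_iff[symmetric])

lemma V_move:
  assumes t: "t \<in> {0..T}" and "\<mu> \<in> Pp p" "\<nu> \<in> Pp p" "v \<in> V t \<mu>" and W: "Wp p \<mu> \<nu> \<le> ennreal d" and d: "0 \<le> d"
  shows "\<exists>w\<in>V t \<nu>. \<forall>x. norm (v x - w x) \<le> L t * d"
proof -
  obtain w where w: "w \<in> V t \<nu>" "d_sup v w \<le> ennreal (L t) * Wp p \<mu> \<nu>" using V_sup assms by blast
  have L0: "0 \<le> L t" using L1_D(2)[OF L t] .
  have "norm (v x - w x) \<le> L t * d" for x
  proof -
    have "ennreal (norm (v x - w x)) \<le> d_sup v w" unfolding sup_dist_def by (rule SUP_upper) simp
    also have "\<dots> \<le> ennreal (L t) * ennreal d" using w(2) mult_left_mono[OF W, of "ennreal (L t)"] by (auto intro: order_trans)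
    also have "\<dots> = ennreal (L t * d)" using L0 d by (simp add: ennreal_mult)
    finally show ?thesis using L0 d by (simp add: ennreal_le_iff)
  qed
  then show ?thesis using w(1) by blast
qed

lemma V_C0: "t \<in> {0..T} \<Longrightarrow> \<mu> \<in> Pp p \<Longrightarrow> V t \<mu> \<subseteq> C0"
  using V_lip lipschitz_imp_C0 by blast

lemma compact_sample_V:
  assumes "t \<in> {0..T}" "\<mu> \<in> Pp p"
  shows "compact (sample ` V t \<mu>)"
proof (rule compact_sample_image)
  show "closedin cc_topology (V t \<mu>)" by (rule V_closed[OF assms])
  show "(l t)-lipschitz_on UNIV v" if "v \<in> V t \<mu>" for v using V_lip[OF assms that] .
  show "norm (v x) \<le> m t * (1 + norm x + moment p \<mu>)" if "v \<in> V t \<mu>" for v x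
    using V_growth[OF assms that] .
  show "0 \<le> l t" by (rule L1_D(2)[OF l assms(1)])
qed

lemma weakly_measurable_sample_V:
  assumes "\<mu> \<in> Pp p"
  shows "weakly_measurable \<I> (\<lambda>t. sample ` V t \<mu>)"
  using V_measurable[OF assms] V_C0[OF _ assms] by (rule weakly_measurable_sample)

text \<open>Along a curve that is constant on short time intervals the set is measurable by
  hypothesis. The general case is a limit: the distance of a fixed sequence to the sampled set
  depends continuously on the measure, by the Lipschitz estimate on \<open>V\<close>.\<close>

lemma weakly_measurable_along_curve:
  assumes \<mu>: "\<And>t. t \<in> {0..T} \<Longrightarrow> \<mu> t \<in> Pp p" and A: "continuous_on {0..T} A"
    and W: "\<And>s t. s \<in> {0..T} \<Longrightarrow> t \<in> {0..T} \<Longrightarrow> Wp p (\<mu> s) (\<mu> t) \<le> ennreal \<bar>A s - A t\<bar>"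
  shows "weakly_measurable \<I> (\<lambda>t. sample ` V t (\<mu> t))"
proof (rule weakly_measurableI_infdist)
  show "sample ` V t (\<mu> t) \<noteq> {}" if "t \<in> space \<I>" for t using V_nonempty \<mu> that by auto
  fix u :: "nat \<Rightarrow> 'a"
  (* Grid times with step 1 / (n + 1), clamped so that every index yields a time in the interval. *)
  define c where "c = (\<lambda>(n::nat) (k::int). max 0 (min T (real_of_int k / real (Suc n))))"
  have c: "c n k \<in> {0..T}" for n k using T by (auto simp: c_def)
  show "(\<lambda>t. infdist u (sample ` V t (\<mu> t))) \<in> borel_measurable \<I>"
  proof (rule borel_measurable_LIMSEQ_real)
    fix n :: nat
    have "(\<lambda>t. real (Suc n) * t) \<in> borel_measurable \<I>"
      by (intro continuous_imp_measurable_on_sets_lebesgue continuous_intros) auto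
    then have fl: "(\<lambda>t. \<lfloor>real (Suc n) * t\<rfloor>) \<in> \<I> \<rightarrow>\<^sub>M count_space UNIV"
      by (rule measurable_compose[OF _ measurable_real_floor])
    show "(\<lambda>t. infdist u (sample ` V t (\<mu> (c n \<lfloor>real (Suc n) * t\<rfloor>)))) \<in> borel_measurable \<I>"
    proof (rule measurable_compose_countable[OF _ fl, of "\<lambda>k t. infdist u (sample ` V t (\<mu> (c n k)))"])
      fix k :: int
      show "(\<lambda>t. infdist u (sample ` V t (\<mu> (c n k)))) \<in> borel_measurable \<I>"
        using \<mu>[OF c] V_nonempty by (intro weakly_measurable_imp_infdist weakly_measurable_sample_V) auto
    qed
  next
    fix t assume "t \<in> space \<I>"
    then have t: "t \<in> {0..T}" by simp
    define s where "s = (\<lambda>n. c n \<lfloor>real (Suc n) * t\<rfloor>)"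
    have st: "\<bar>s n - t\<bar> \<le> 1 / real (Suc n)" for n
    proof -
      have "\<lfloor>real (Suc n) * t\<rfloor> \<ge> 0" using t by simp
      moreover have "real_of_int \<lfloor>real (Suc n) * t\<rfloor> \<le> real (Suc n) * t" "real (Suc n) * t \<le> real_of_int \<lfloor>real (Suc n) * t\<rfloor> + 1"
        by linarith+
      moreover have "real_of_int \<lfloor>real (Suc n) * t\<rfloor> / real (Suc n) \<le> t"
        "t \<le> real_of_int \<lfloor>real (Suc n) * t\<rfloor> / real (Suc n) + 1 / real (Suc n)"
        using calculation by (simp_all add: field_simps del: of_nat_Suc)
      ultimately show ?thesis using t by (auto simp: s_def c_def max_def min_def)
    qed
    have sI: "s n \<in> {0..T}" for n using c by (simp add: s_def)
    have "(\<lambda>n. s n - t) \<longlonglongrightarrow> 0"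
      by (rule Lim_null_comparison[OF _ LIMSEQ_Suc[OF lim_1_over_n]]) (use st in auto)
    then have "s \<longlonglongrightarrow> t" by (simp add: LIM_zero_iff)
    then have "(\<lambda>n. A (s n)) \<longlonglongrightarrow> A t"
      using A t sI unfolding continuous_on_sequentially by (auto simp: o_def)
    then have "(\<lambda>n. A (s n) - A t) \<longlonglongrightarrow> 0" by (simp add: LIM_zero_iff)
    then have lim: "(\<lambda>n. 2 * (L t * \<bar>A (s n) - A t\<bar>)) \<longlonglongrightarrow> 0"
      by (intro tendsto_mult_right_zero tendsto_rabs_zero)
    have "\<bar>infdist u (sample ` V t (\<mu> (s n))) - infdist u (sample ` V t (\<mu> t))\<bar> \<le> 2 * (L t * \<bar>A (s n) - A t\<bar>)" for n
    proof -
      have "infdist u (sample ` V t (\<mu> (s n))) \<le> infdist u (sample ` V t (\<mu> t)) + 2 * (L t * \<bar>A (s n) - A t\<bar>)"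
        using W[OF t sI[of n]] \<mu>[OF t] \<mu>[OF sI[of n]]
        by (intro infdist_sample_le V_nonempty V_move t \<mu> sI) (auto simp: abs_minus_commute)
      moreover have "infdist u (sample ` V t (\<mu> t)) \<le> infdist u (sample ` V t (\<mu> (s n))) + 2 * (L t * \<bar>A (s n) - A t\<bar>)"
        using W[OF sI[of n] t] \<mu>[OF t] \<mu>[OF sI[of n]]
        by (intro infdist_sample_le V_nonempty V_move t \<mu> sI) auto
      ultimately show ?thesis by linarith
    qed
    then have "(\<lambda>n. infdist u (sample ` V t (\<mu> (s n))) - infdist u (sample ` V t (\<mu> t))) \<longlonglongrightarrow> 0"
      by (intro Lim_null_comparison[OF _ lim]) auto
    then show "(\<lambda>n. infdist u (sample ` V t (\<mu> (c n \<lfloor>real (Suc n) * t\<rfloor>)))) \<longlonglongrightarrow> infdist u (sample ` V t (\<mu> t))"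
      by (simp add: LIM_zero_iff s_def)
  qed
qed

text \<open>By continuity, each evaluation is a limit of evaluations at points of the dense sequence.\<close>

lemma evaluations_measurable:
  assumes lip: "\<And>t. t \<in> {0..T} \<Longrightarrow> (c t)-lipschitz_on UNIV (v t :: 'a \<Rightarrow> 'a)"
    and ev: "\<And>i. (\<lambda>t. v t (dense_seq i)) \<in> borel_measurable \<I>"
  shows "(\<lambda>t. v t x) \<in> borel_measurable \<I>"
proof -
  have "x \<in> closure (range dense_seq)" by (simp add: closure_dense_seq)
  then obtain q where q: "\<And>n. q n \<in> range (dense_seq :: nat \<Rightarrow> 'a)" "q \<longlonglongrightarrow> x"
    unfolding closure_sequential by blast
  show ?thesis
  proof (rule borel_measurable_LIMSEQ_metric)
    show "(\<lambda>t. v t (q n)) \<in> borel_measurable \<I>" for n using q(1)[of n] ev by auto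
    fix t assume "t \<in> space \<I>"
    then have "continuous_on UNIV (v t)" using lip by (auto intro: lipschitz_on_continuous_on)
    then have "isCont (v t) x" by (simp add: continuous_on_eq_continuous_at)
    then show "(\<lambda>n. v t (q n)) \<longlonglongrightarrow> v t x" using q(2) isCont_tendsto_compose by blast
  qed
qed

text \<open>A measurable selection that stays as close to a given field \<open>y\<close>, at the sampling points
  indexed by \<open>J\<close>, as some selection can. With all indices this is closeness in the supremum
  distance, which drives the iteration; with finitely many indices it selects a field close to the
  prescribed initial velocity.\<close>

lemma selection_along_curve:
  assumes \<mu>: "\<And>t. t \<in> {0..T} \<Longrightarrow> \<mu> t \<in> Pp p" and A: "continuous_on {0..T} A"
    and W: "\<And>s t. s \<in> {0..T} \<Longrightarrow> t \<in> {0..T} \<Longrightarrow> Wp p (\<mu> s) (\<mu> t) \<le> ennreal \<bar>A s - A t\<bar>"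
    and y: "\<And>x. (\<lambda>t. y t x) \<in> borel_measurable \<I>" and r: "r \<in> borel_measurable \<I>"
    and ex: "\<And>t. t \<in> {0..T} \<Longrightarrow> \<exists>w\<in>V t (\<mu> t). \<forall>i\<in>J. norm (w (dense_seq i) - y t (dense_seq i)) \<le> r t"
  shows "\<exists>v. (\<forall>t\<in>{0..T}. v t \<in> V t (\<mu> t) \<and> (\<forall>i\<in>J. norm (v t (dense_seq i) - y t (dense_seq i)) \<le> r t))
     \<and> (\<forall>x. (\<lambda>t. v t x) \<in> borel_measurable \<I>)"
proof -
  define K where "K = (\<lambda>t. sample ` V t (\<mu> t))"
  define g where "g = (\<lambda>i t (u :: nat \<Rightarrow> 'a). if i \<in> J then norm (u i - y t (dense_seq i)) - r t else 0)"
  define K' where "K' = (\<lambda>t. {u \<in> K t. \<forall>i. g i t u \<le> 0})"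
  have cg: "continuous_on UNIV (g i t)" for i t
    unfolding g_def by (cases "i \<in> J") (auto intro!: continuous_intros continuous_on_product_coordinates)
  have mg: "(\<lambda>t. g i t u) \<in> borel_measurable \<I>" for i u
    unfolding g_def using y r by (cases "i \<in> J") auto
  have cK: "compact (K t)" if "t \<in> space \<I>" for t using that \<mu> by (auto simp: K_def intro: compact_sample_V)
  have "weakly_measurable \<I> K" unfolding K_def by (rule weakly_measurable_along_curve[OF \<mu> A W])
  then have wK': "weakly_measurable \<I> K'"
    unfolding K'_def by (rule weakly_measurable_closed_constraints) (use cK cg mg in auto)
  have cK': "compact (K' t)" if "t \<in> space \<I>" for t
  proof -
    have "K' t = K t \<inter> (\<Inter>i. {u. g i t u \<le> 0})" by (auto simp: K'_def)
    moreover have "closed (\<Inter>i. {u. g i t u \<le> 0})"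
      using cg by (intro closed_INT ballI closed_Collect_le continuous_on_const)
    ultimately show ?thesis using cK[OF that] by (simp add: compact_Int_closed)
  qed
  have neK': "K' t \<noteq> {}" if "t \<in> space \<I>" for t
  proof -
    obtain w where "w \<in> V t (\<mu> t)" "\<forall>i\<in>J. norm (w (dense_seq i) - y t (dense_seq i)) \<le> r t"
      using ex[of t] \<open>t \<in> space \<I>\<close> by auto
    then have "sample w \<in> K' t" by (auto simp: K'_def K_def g_def sample_def)
    then show ?thesis by blast
  qed
  obtain f where f: "\<And>t. t \<in> {0..T} \<Longrightarrow> f t \<in> K' t" "\<And>i. (\<lambda>t. f t i) \<in> borel_measurable \<I>"
    using measurable_selection_sequence_space[OF wK' cK' neK'] by fastforce
  have "\<forall>t. \<exists>v. t \<in> {0..T} \<longrightarrow> v \<in> V t (\<mu> t) \<and> f t = sample v" using f(1) by (auto simp: K'_def K_def)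
  then obtain v where v: "\<And>t. t \<in> {0..T} \<Longrightarrow> v t \<in> V t (\<mu> t)" "\<And>t. t \<in> {0..T} \<Longrightarrow> f t = sample (v t)" by metis
  have "(\<lambda>t. v t x) \<in> borel_measurable \<I>" for x
  proof (rule evaluations_measurable)
    show "(l t)-lipschitz_on UNIV (v t)" if "t \<in> {0..T}" for t using V_lip[OF that \<mu>[OF that] v(1)[OF that]] .
    fix i
    show "(\<lambda>t. v t (dense_seq i)) \<in> borel_measurable \<I>"
      using f(2)[of i] v(2) by (subst measurable_cong[where g="\<lambda>t. f t i"]) (auto simp: sample_def)
  qed
  moreover have "norm (v t (dense_seq i) - y t (dense_seq i)) \<le> r t" if "t \<in> {0..T}" "i \<in> J" for t i
    using f(1)[OF that(1)] v(2)[OF that(1)] that(2) by (auto simp: K'_def g_def sample_def dest!: spec[of _ i])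
  ultimately show ?thesis using v(1) by blast
qed

end

section \<open>The Picard operator on particle motions\<close>

lemma integral_increment:
  fixes f :: "real \<Rightarrow> 'b::euclidean_space"
  assumes f: "f absolutely_integrable_on {0..T}" and st: "0 \<le> s" "s \<le> t" "t \<le> T"
  shows "integral {0..t} f - integral {0..s} f = integral {s..t} f"
proof -
  have "f integrable_on {0..T}" using f by (simp add: absolutely_integrable_on_def)
  then have "f integrable_on {0..t}" by (rule integrable_on_subinterval) (use st in auto)
  from Henstock_Kurzweil_Integration.integral_combine[OF st(1,2) this] show ?thesis
    by (simp add: algebra_simps)
qed

lemma absolutely_integrable_subinterval_real:
  fixes f :: "real \<Rightarrow> 'b::euclidean_space"
  assumes "f absolutely_integrable_on {a..b}" "a \<le> s" "t \<le> b"
  shows "f absolutely_integrable_on {s..t}"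
  using assms by (intro set_integrable_subset[OF assms(1)]) auto

lemma integral_norm_le:
  fixes f :: "real \<Rightarrow> 'b::euclidean_space"
  assumes f: "f absolutely_integrable_on {s..t}" and g: "g absolutely_integrable_on {s..t}"
    and le: "\<And>r. r \<in> {s..t} \<Longrightarrow> norm (f r) \<le> g r"
  shows "norm (integral {s..t} f) \<le> integral {s..t} g"
  using assms by (intro integral_norm_bound_integral) (auto simp: absolutely_integrable_on_def)

context lipschitz_inclusion begin

lemma lipschitz_composition_measurable:
  assumes lip: "\<And>t. t \<in> {0..T} \<Longrightarrow> (l t)-lipschitz_on UNIV (v t :: 'a \<Rightarrow> 'a)"
    and ev: "\<And>x. (\<lambda>t. v t x) \<in> borel_measurable \<I>" and y: "y \<in> borel_measurable \<I>"
  shows "(\<lambda>t. v t (y t)) \<in> borel_measurable \<I>"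
  by (rule caratheodory_measurable[OF _ ev y]) (use lip in \<open>auto intro: lipschitz_on_continuous_on\<close>)

end

text \<open>Data of the iteration: \<open>v0\<close> is a measurable selection of \<open>V\<close> along the constant curve
  \<open>\<mu>0\<close>. The existence proof is Lagrangian: the measures are laws of particle positions \<open>X t x\<close>,
  where \<open>x\<close> is distributed according to \<open>\<mu>0\<close> and \<open>X \<tau> x = x\<close>.\<close>

locale inclusion_start = lipschitz_inclusion +
  fixes \<tau> :: real and \<mu>0 :: "'a::euclidean_space measure" and v0 :: "real \<Rightarrow> 'a \<Rightarrow> 'a"
  assumes \<tau>: "\<tau> \<in> {0..T}" and \<mu>0: "\<mu>0 \<in> Pp p"
    and v0: "\<And>t. t \<in> {0..T} \<Longrightarrow> v0 t \<in> V t \<mu>0"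
    and v0_measurable: "\<And>x. (\<lambda>t. v0 t x) \<in> borel_measurable \<I>"
begin

text \<open>Displacements are measured relative to \<open>1 + \<bar>x\<bar>\<close>. In this scale, \<open>\<kappa>\<close> bounds the speed under
  \<open>v0\<close> and the rate at which an error in position feeds back through the Lipschitz constant of the
  field (\<open>l\<close>) and through its dependence on the law (\<open>K0 * L\<close>). Accordingly \<open>gap n\<close> is the bound for
  the \<open>n\<close>-th step of the iteration, and \<open>elapsed\<close> is the time from \<open>\<tau>\<close>, in either direction, on the
  clock that runs at speed \<open>\<kappa>\<close>. The operator \<open>prim\<close> is the integral from \<open>\<tau>\<close> to \<open>t\<close> with its sign.\<close>

definition K0 :: real where "K0 = weight_norm p \<mu>0"
definition \<kappa> :: "real \<Rightarrow> real" where "\<kappa> t = (1 + moment p \<mu>0) * m t + l t + K0 * L t"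
definition accrued :: "real \<Rightarrow> real" where "accrued t = integral {0..t} \<kappa>"
definition elapsed :: "real \<Rightarrow> real" where "elapsed t = \<bar>accrued t - accrued \<tau>\<bar>"
definition gap :: "nat \<Rightarrow> real \<Rightarrow> real" where "gap n t = elapsed t ^ n / fact n"
definition prim :: "(real \<Rightarrow> 'a) \<Rightarrow> real \<Rightarrow> 'a" where
  "prim f t = integral {0..t} f - integral {0..\<tau>} f"
definition law :: "(real \<Rightarrow> 'a \<Rightarrow> 'a) \<Rightarrow> real \<Rightarrow> 'a measure" where
  "law X t = distr \<mu>0 borel (X t)"

lemma K0: "0 \<le> K0" by (simp add: K0_def weight_norm_nonneg)

lemma moment_nonneg: "0 \<le> moment p \<mu>" by (simp add: moment_def)

lemma \<kappa>_abs: "\<kappa> absolutely_integrable_on {0..T}"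
  unfolding \<kappa>_def
  by (intro set_integral_add(1) set_integrable_mult_right L1_D(1) m l L)

lemma \<kappa>_nonneg: "t \<in> {0..T} \<Longrightarrow> 0 \<le> \<kappa> t"
  unfolding \<kappa>_def using L1_D(2)[OF m] L1_D(2)[OF l] L1_D(2)[OF L] K0 moment_nonneg[of \<mu>0]
  by (intro add_nonneg_nonneg mult_nonneg_nonneg) auto

lemma accrued_increment: "0 \<le> s \<Longrightarrow> s \<le> t \<Longrightarrow> t \<le> T \<Longrightarrow> accrued t - accrued s = integral {s..t} \<kappa>"
  unfolding accrued_def by (rule integral_increment[OF \<kappa>_abs])

lemma accrued_mono: "0 \<le> s \<Longrightarrow> s \<le> t \<Longrightarrow> t \<le> T \<Longrightarrow> accrued s \<le> accrued t"
proof -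
  assume st: "0 \<le> s" "s \<le> t" "t \<le> T"
  have "0 \<le> integral {s..t} \<kappa>"
    using absolutely_integrable_subinterval_real[OF \<kappa>_abs st(1,3)] \<kappa>_nonneg st
    by (intro Henstock_Kurzweil_Integration.integral_nonneg) (auto simp: absolutely_integrable_on_def)
  then show ?thesis using accrued_increment[OF st] by simp
qed

lemma accrued_continuous: "continuous_on {0..T} accrued"
  unfolding accrued_def using \<kappa>_abs
  by (intro indefinite_integral_continuous_1) (simp add: absolutely_integrable_on_def)

lemma accrued_zero: "accrued 0 = 0" by (simp add: accrued_def)

lemma elapsed_bounds: "t \<in> {0..T} \<Longrightarrow> 0 \<le> elapsed t \<and> elapsed t \<le> accrued T"
  using accrued_mono[of 0 t] accrued_mono[of t T] accrued_mono[of 0 \<tau>] accrued_mono[of \<tau> T] \<tau> by (auto simp: elapsed_def accrued_zero)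

lemma gap_nonneg: "0 \<le> gap n t" by (simp add: gap_def elapsed_def)

lemma gap_measurable: "gap n \<in> borel_measurable \<I>"
proof -
  have "continuous_on {0..T} (gap n)" unfolding gap_def elapsed_def by (intro continuous_intros accrued_continuous) auto
  then show ?thesis by (rule continuous_imp_measurable_on_sets_lebesgue) auto
qed

lemma prim_diff:
  assumes "f absolutely_integrable_on {0..T}" "0 \<le> s" "s \<le> t" "t \<le> T"
  shows "prim f t - prim f s = integral {s..t} f"
  using integral_increment[OF assms] by (simp add: prim_def)

lemma prim_at_start [simp]: "prim f \<tau> = 0" by (simp add: prim_def)

lemma gap_step: "C / fact n * (elapsed t ^ Suc n / real (Suc n)) = C * gap (Suc n) t"
  unfolding gap_def fact_Suc by (simp add: divide_simps del: power_Suc of_nat_Suc)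

text \<open>Both time directions are instances of the power rule, with the sign of \<open>\<kappa>\<close> reversed in
  the backward case.\<close>

lemma prim_bound:
  assumes f: "f absolutely_integrable_on {0..T}" and t: "t \<in> {0..T}"
    and le: "\<And>s. s \<in> {0..T} \<Longrightarrow> norm (f s) \<le> C * (\<kappa> s * gap n s)"
  shows "norm (prim f t) \<le> C * gap (Suc n) t"
proof (cases "\<tau> \<le> t")
  case True
  have sub: "{\<tau>..t} \<subseteq> {0..T}" using \<tau> t by auto
  have k: "\<kappa> absolutely_integrable_on {\<tau>..t}"
    using \<tau> t by (intro absolutely_integrable_subinterval_real[OF \<kappa>_abs]) auto
  have A': "accrued s - accrued \<tau> = (accrued \<tau> - accrued \<tau>) + integral {\<tau>..s} \<kappa>" if "s \<in> {\<tau>..t}" for s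
    using accrued_increment[of \<tau> s] that \<tau> t by auto
  note pw = integral_power_primitive[OF True k A', of n]
  have 1: "prim f t = integral {\<tau>..t} f" using prim_diff[OF f, of \<tau> t] \<tau> t True by simp
  have 2: "norm (integral {\<tau>..t} f) \<le> integral {\<tau>..t} (\<lambda>s. C / fact n * (\<kappa> s * (accrued s - accrued \<tau>) ^ n))"
  proof (rule integral_norm_le)
    show "f absolutely_integrable_on {\<tau>..t}"
      using \<tau> t by (intro absolutely_integrable_subinterval_real[OF f]) auto
    show "(\<lambda>s. C / fact n * (\<kappa> s * (accrued s - accrued \<tau>) ^ n)) absolutely_integrable_on {\<tau>..t}"
      using pw(1) by (rule set_integrable_mult_right)
    fix s assume s: "s \<in> {\<tau>..t}"
    then have "elapsed s = accrued s - accrued \<tau>" using accrued_mono[of \<tau> s] \<tau> t by (auto simp: elapsed_def)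
    then show "norm (f s) \<le> C / fact n * (\<kappa> s * (accrued s - accrued \<tau>) ^ n)"
      using le[of s] s sub by (auto simp: gap_def)
  qed
  have 3: "integral {\<tau>..t} (\<lambda>s. C / fact n * (\<kappa> s * (accrued s - accrued \<tau>) ^ n))
      = C / fact n * integral {\<tau>..t} (\<lambda>s. \<kappa> s * (accrued s - accrued \<tau>) ^ n)"
    by (rule integral_mult_right)
  have "accrued t - accrued \<tau> = elapsed t"
    using accrued_mono[of \<tau> t] \<tau> t True by (simp add: elapsed_def)
  then have 4: "integral {\<tau>..t} (\<lambda>s. \<kappa> s * (accrued s - accrued \<tau>) ^ n) = elapsed t ^ Suc n / real (Suc n)"
    using pw(2) by (simp del: power_Suc of_nat_Suc)
  show ?thesis using 2 unfolding 1 3 4 gap_step .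
next
  case False
  then have tt: "t \<le> \<tau>" by simp
  have sub: "{t..\<tau>} \<subseteq> {0..T}" using \<tau> t by auto
  have k: "(\<lambda>s. - \<kappa> s) absolutely_integrable_on {t..\<tau>}"
    using \<tau> t absolutely_integrable_subinterval_real[OF \<kappa>_abs, of t \<tau>]
      set_integrable_mult_right[of "-1" lebesgue "{t..\<tau>}" \<kappa>] by auto
  have A': "accrued \<tau> - accrued s = (accrued \<tau> - accrued t) + integral {t..s} (\<lambda>s. - \<kappa> s)" if "s \<in> {t..\<tau>}" for s
    using accrued_increment[of t s] that \<tau> t by auto
  note pw = integral_power_primitive[OF tt k A', of n]
  have "- prim f t = integral {t..\<tau>} f" using prim_diff[OF f, of t \<tau>] \<tau> t tt by simp
  then have 1: "norm (prim f t) = norm (integral {t..\<tau>} f)" by (metis norm_minus_cancel)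
  have 2: "norm (integral {t..\<tau>} f) \<le> integral {t..\<tau>} (\<lambda>s. - C / fact n * (- \<kappa> s * (accrued \<tau> - accrued s) ^ n))"
  proof (rule integral_norm_le)
    show "f absolutely_integrable_on {t..\<tau>}"
      using \<tau> t by (intro absolutely_integrable_subinterval_real[OF f]) auto
    show "(\<lambda>s. - C / fact n * (- \<kappa> s * (accrued \<tau> - accrued s) ^ n)) absolutely_integrable_on {t..\<tau>}"
      using pw(1) by (rule set_integrable_mult_right)
    fix s assume s: "s \<in> {t..\<tau>}"
    then have "elapsed s = accrued \<tau> - accrued s" using accrued_mono[of s \<tau>] \<tau> t by (auto simp: elapsed_def)
    then show "norm (f s) \<le> - C / fact n * (- \<kappa> s * (accrued \<tau> - accrued s) ^ n)"
      using le[of s] s sub by (auto simp: gap_def)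
  qed
  have 3: "integral {t..\<tau>} (\<lambda>s. - C / fact n * (- \<kappa> s * (accrued \<tau> - accrued s) ^ n))
      = - C / fact n * integral {t..\<tau>} (\<lambda>s. - \<kappa> s * (accrued \<tau> - accrued s) ^ n)"
    by (rule integral_mult_right)
  have "accrued \<tau> - accrued t = elapsed t"
    using accrued_mono[of t \<tau>] \<tau> t tt by (simp add: elapsed_def)
  then have 4: "integral {t..\<tau>} (\<lambda>s. - \<kappa> s * (accrued \<tau> - accrued s) ^ n) = - (elapsed t ^ Suc n / real (Suc n))"
    using pw(2) by (simp del: power_Suc of_nat_Suc)
  have 5: "- C / fact n * - (elapsed t ^ Suc n / real (Suc n)) = C * gap (Suc n) t" using gap_step by simp
  show ?thesis using 2 unfolding 1 3 4 5 .
qed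

text \<open>The increments are controlled uniformly in \<open>x\<close>, relative to \<open>1 + \<bar>x\<bar>\<close>; this yields at once
  continuous paths, finite moments of the laws and absolute continuity of the curve of laws.\<close>

definition motion :: "(real \<Rightarrow> 'a \<Rightarrow> 'a) \<Rightarrow> bool" where
  "motion X \<longleftrightarrow> (\<forall>x. X \<tau> x = x) \<and> (\<forall>t\<in>{0..T}. X t \<in> borel_measurable borel) \<and>
     (\<exists>g\<in>L1_nonneg T. \<forall>s t x. 0 \<le> s \<longrightarrow> s \<le> t \<longrightarrow> t \<le> T \<longrightarrow>
        norm (X t x - X s x) \<le> integral {s..t} g * (1 + norm x))"

lemma motionE:
  assumes "motion X"
  obtains g where "g \<in> L1_nonneg T"
    "\<And>s t x. 0 \<le> s \<Longrightarrow> s \<le> t \<Longrightarrow> t \<le> T \<Longrightarrow> norm (X t x - X s x) \<le> integral {s..t} g * (1 + norm x)"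
  using assms unfolding motion_def by blast

lemma L1_integral_nonneg:
  assumes g: "g \<in> L1_nonneg T" and st: "0 \<le> s" "t \<le> T"
  shows "0 \<le> integral {s..t} g"
  using absolutely_integrable_subinterval_real[OF L1_D(1)[OF g] st] L1_D(2)[OF g] st
  by (intro Henstock_Kurzweil_Integration.integral_nonneg) (auto simp: absolutely_integrable_on_def)

lemma L1_integral_mono_set:
  assumes g: "g \<in> L1_nonneg T" and st: "0 \<le> s" "s \<le> t" "t \<le> T"
  shows "integral {s..t} g \<le> integral {0..T} g"
  using integral_increment[OF L1_D(1)[OF g] st] integral_increment[OF L1_D(1)[OF g], of t T]
    L1_integral_nonneg[OF g, of 0 s] L1_integral_nonneg[OF g, of t T] st by auto

lemma motion_growth:
  assumes "motion X"
  shows "\<exists>C\<ge>0. \<forall>t\<in>{0..T}. \<forall>x. norm (X t x) \<le> C * (1 + norm x)"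
proof -
  obtain g where g: "g \<in> L1_nonneg T"
    and inc: "\<And>s t x. 0 \<le> s \<Longrightarrow> s \<le> t \<Longrightarrow> t \<le> T \<Longrightarrow> norm (X t x - X s x) \<le> integral {s..t} g * (1 + norm x)"
    using assms by (rule motionE) blast
  have start: "X \<tau> x = x" for x using assms by (simp add: motion_def)
  have "norm (X t x) \<le> (1 + integral {0..T} g) * (1 + norm x)" if t: "t \<in> {0..T}" for t x
  proof -
    have "norm (X t x - x) \<le> integral {0..T} g * (1 + norm x)"
    proof (cases "\<tau> \<le> t")
      case True
      then have "norm (X t x - x) \<le> integral {\<tau>..t} g * (1 + norm x)" using inc[of \<tau> t x] \<tau> t start by auto
      also have "\<dots> \<le> integral {0..T} g * (1 + norm x)"
        using L1_integral_mono_set[OF g, of \<tau> t] \<tau> t True by (intro mult_right_mono) auto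
      finally show ?thesis .
    next
      case False
      then have "norm (X t x - x) \<le> integral {t..\<tau>} g * (1 + norm x)" using inc[of t \<tau> x] \<tau> t start by (auto simp: norm_minus_commute)
      also have "\<dots> \<le> integral {0..T} g * (1 + norm x)"
        using L1_integral_mono_set[OF g, of t \<tau>] \<tau> t False by (intro mult_right_mono) auto
      finally show ?thesis .
    qed
    moreover have "norm (X t x) \<le> norm x + norm (X t x - x)" by (metis norm_triangle_sub add.commute)
    ultimately show ?thesis by (simp add: algebra_simps)
  qed
  moreover have "0 \<le> 1 + integral {0..T} g" using L1_integral_nonneg[OF g, of 0 T] by simp
  ultimately show ?thesis by blast
qed

lemma motion_measurable: "motion X \<Longrightarrow> t \<in> {0..T} \<Longrightarrow> X t \<in> borel_measurable borel"
  by (simp add: motion_def)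

lemma law_Pp:
  assumes X: "motion X" and t: "t \<in> {0..T}"
  shows "law X t \<in> Pp p"
proof -
  obtain C where "C \<ge> 0" "\<And>x. norm (X t x) \<le> C * (1 + norm x)" using motion_growth[OF X] t by blast
  then show ?thesis unfolding law_def by (intro distr_Pp(1)[OF p \<mu>0 motion_measurable[OF X t]])
qed

lemma law_moment:
  assumes X: "motion X"
  shows "\<exists>C\<ge>0. \<forall>t\<in>{0..T}. moment p (law X t) \<le> C"
proof -
  obtain C where C: "C \<ge> 0" "\<And>t x. t \<in> {0..T} \<Longrightarrow> norm (X t x) \<le> C * (1 + norm x)" using motion_growth[OF X] by blast
  have "moment p (law X t) \<le> C * K0" if "t \<in> {0..T}" for t
    unfolding law_def K0_def by (intro distr_Pp(2)[OF p \<mu>0 motion_measurable[OF X that]] C that)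
  moreover have "0 \<le> C * K0" using C(1) K0 by simp
  ultimately show ?thesis by blast
qed

lemma Wp_law_le:
  assumes "motion X" "motion Y" "s \<in> {0..T}" "t \<in> {0..T}" "0 \<le> c"
    "\<And>x. norm (X s x - Y t x) \<le> c * (1 + norm x)"
  shows "Wp p (law X s) (law Y t) \<le> ennreal (c * K0)"
  unfolding law_def K0_def using assms
  by (intro Wp_distr_le_weight[OF p \<mu>0] motion_measurable)

lemma Wp_law_increment:
  assumes X: "motion X"
  shows "\<exists>g\<in>L1_nonneg T. \<forall>s t. 0 \<le> s \<longrightarrow> s \<le> t \<longrightarrow> t \<le> T \<longrightarrow>
    Wp p (law X s) (law X t) \<le> ennreal (integral {s..t} g) \<and> Wp p (law X t) (law X s) \<le> ennreal (integral {s..t} g)"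
proof -
  obtain g where g: "g \<in> L1_nonneg T"
    and inc: "\<And>s t x. 0 \<le> s \<Longrightarrow> s \<le> t \<Longrightarrow> t \<le> T \<Longrightarrow> norm (X t x - X s x) \<le> integral {s..t} g * (1 + norm x)"
    using X by (rule motionE) blast
  have "Wp p (law X s) (law X t) \<le> ennreal (integral {s..t} (\<lambda>r. g r * K0)) \<and>
        Wp p (law X t) (law X s) \<le> ennreal (integral {s..t} (\<lambda>r. g r * K0))" if "0 \<le> s" "s \<le> t" "t \<le> T" for s t
    using Wp_law_le[OF X X, of s t "integral {s..t} g"] Wp_law_le[OF X X, of t s "integral {s..t} g"]
      L1_integral_nonneg[OF g] inc that by (auto simp: norm_minus_commute)
  moreover have "(\<lambda>r. g r * K0) \<in> L1_nonneg T" using g K0 by (auto simp: L1_nonneg_def)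
  ultimately show ?thesis by blast
qed

lemma law_continuity:
  assumes X: "motion X"
  shows "\<exists>A'. continuous_on {0..T} A' \<and> (\<forall>s\<in>{0..T}. \<forall>t\<in>{0..T}. Wp p (law X s) (law X t) \<le> ennreal \<bar>A' s - A' t\<bar>)"
proof -
  obtain g where g: "g \<in> L1_nonneg T"
    and W: "\<And>s t. 0 \<le> s \<Longrightarrow> s \<le> t \<Longrightarrow> t \<le> T \<Longrightarrow> Wp p (law X s) (law X t) \<le> ennreal (integral {s..t} g)"
     "\<And>s t. 0 \<le> s \<Longrightarrow> s \<le> t \<Longrightarrow> t \<le> T \<Longrightarrow> Wp p (law X t) (law X s) \<le> ennreal (integral {s..t} g)"
    using Wp_law_increment[OF X] by blast
  define A' where "A' = (\<lambda>t. integral {0..t} g)"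
  have "continuous_on {0..T} A'"
    unfolding A'_def using L1_D(1)[OF g]
    by (intro indefinite_integral_continuous_1) (simp add: absolutely_integrable_on_def)
  moreover have "Wp p (law X s) (law X t) \<le> ennreal \<bar>A' s - A' t\<bar>" if "s \<in> {0..T}" "t \<in> {0..T}" for s t
  proof (cases "s \<le> t")
    case True
    then show ?thesis
      using W(1)[of s t] integral_increment[OF L1_D(1)[OF g], of s t] that L1_integral_nonneg[OF g, of s t] by (auto simp: A'_def)
  next
    case False
    then show ?thesis
      using W(2)[of t s] integral_increment[OF L1_D(1)[OF g], of t s] that L1_integral_nonneg[OF g, of t s] by (auto simp: A'_def)
  qed
  ultimately show ?thesis by blast
qed

lemma motion_path_continuous:
  assumes X: "motion X"
  shows "continuous_on {0..T} (\<lambda>t. X t x)"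
proof -
  obtain g where g: "g \<in> L1_nonneg T"
    and inc: "\<And>s t x. 0 \<le> s \<Longrightarrow> s \<le> t \<Longrightarrow> t \<le> T \<Longrightarrow> norm (X t x - X s x) \<le> integral {s..t} g * (1 + norm x)"
    using X by (rule motionE) blast
  define A' where "A' = (\<lambda>t. integral {0..t} g)"
  have cA: "continuous_on {0..T} A'"
    unfolding A'_def using L1_D(1)[OF g]
    by (intro indefinite_integral_continuous_1) (simp add: absolutely_integrable_on_def)
  have le: "dist (X t x) (X s x) \<le> \<bar>A' t - A' s\<bar> * (1 + norm x)" if "s \<in> {0..T}" "t \<in> {0..T}" for s t
  proof (cases "s \<le> t")
    case True
    then show ?thesis
      using inc[of s t x] integral_increment[OF L1_D(1)[OF g], of s t] that L1_integral_nonneg[OF g, of s t] by (auto simp: A'_def dist_norm)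
  next
    case False
    then show ?thesis
      using inc[of t s x] integral_increment[OF L1_D(1)[OF g], of t s] that L1_integral_nonneg[OF g, of t s]
      by (auto simp: A'_def dist_norm norm_minus_commute abs_minus_commute)
  qed
  show ?thesis unfolding continuous_on_def
  proof
    fix s assume s: "s \<in> {0..T}"
    have "((\<lambda>t. \<bar>A' t - A' s\<bar> * (1 + norm x)) \<longlongrightarrow> \<bar>A' s - A' s\<bar> * (1 + norm x)) (at s within {0..T})"
      using cA s by (intro tendsto_intros) (auto simp: continuous_on_def)
    then have lim: "((\<lambda>t. \<bar>A' t - A' s\<bar> * (1 + norm x)) \<longlongrightarrow> 0) (at s within {0..T})" by simp
    have "((\<lambda>t. dist (X t x) (X s x)) \<longlongrightarrow> 0) (at s within {0..T})"
      by (rule tendsto_sandwich[OF _ _ tendsto_const lim])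
        (use le s in \<open>auto simp: eventually_at_filter\<close>)
    then show "((\<lambda>t. X t x) \<longlongrightarrow> X s x) (at s within {0..T})" by (simp add: tendsto_dist_iff[symmetric])
  qed
qed

text \<open>A motion together with a measurable velocity selected from \<open>V\<close> along its own laws. That
  the particles move with this velocity is the separate equation \<open>X = picard X v\<close>.\<close>

definition admissible :: "(real \<Rightarrow> 'a \<Rightarrow> 'a) \<Rightarrow> (real \<Rightarrow> 'a \<Rightarrow> 'a) \<Rightarrow> bool" where
  "admissible X v \<longleftrightarrow> motion X \<and> (\<forall>t\<in>{0..T}. v t \<in> V t (law X t)) \<and> (\<forall>x. (\<lambda>t. v t x) \<in> borel_measurable \<I>)"

lemma admissible_lip: "admissible X v \<Longrightarrow> t \<in> {0..T} \<Longrightarrow> (l t)-lipschitz_on UNIV (v t)"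
  using V_lip law_Pp unfolding admissible_def by blast

lemma admissible_velocity_bound:
  assumes "admissible X v"
  shows "\<exists>g\<in>L1_nonneg T. \<forall>t\<in>{0..T}. \<forall>x. norm (v t (X t x)) \<le> g t * (1 + norm x)"
proof -
  have X: "motion X" using assms by (simp add: admissible_def)
  obtain C where C: "C \<ge> 0" "\<And>t x. t \<in> {0..T} \<Longrightarrow> norm (X t x) \<le> C * (1 + norm x)" using motion_growth[OF X] by blast
  obtain D where D: "D \<ge> 0" "\<And>t. t \<in> {0..T} \<Longrightarrow> moment p (law X t) \<le> D" using law_moment[OF X] by blast
  have "norm (v t (X t x)) \<le> (1 + C + D) * m t * (1 + norm x)" if t: "t \<in> {0..T}" for t x
  proof -
    have m0: "0 \<le> m t" by (rule L1_D(2)[OF m t])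
    have "norm (v t (X t x)) \<le> m t * (1 + norm (X t x) + moment p (law X t))"
      using assms t by (intro V_growth law_Pp X) (auto simp: admissible_def)
    also have "\<dots> \<le> m t * ((1 + norm x) + C * (1 + norm x) + D * (1 + norm x))"
    proof (intro mult_left_mono add_mono m0 C t)
      have "D * 1 \<le> D * (1 + norm x)" using D(1) by (intro mult_left_mono) auto
      then show "moment p (law X t) \<le> D * (1 + norm x)" using D(2)[OF t] by simp
    qed auto
    finally show ?thesis by (simp add: algebra_simps)
  qed
  moreover have "(\<lambda>t. (1 + C + D) * m t) \<in> L1_nonneg T"
    using m C(1) D(1) by (auto simp: L1_nonneg_def)
  ultimately show ?thesis by (intro bexI[of _ "\<lambda>t. (1 + C + D) * m t"]) auto
qed

lemma admissible_velocity_integrable: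
  assumes "admissible X v"
  shows "(\<lambda>t. v t (X t x)) absolutely_integrable_on {0..T}"
proof -
  obtain g where g: "g \<in> L1_nonneg T" "\<And>t x. t \<in> {0..T} \<Longrightarrow> norm (v t (X t x)) \<le> g t * (1 + norm x)"
    using admissible_velocity_bound[OF assms] by blast
  show ?thesis
  proof (rule absolutely_integrable_bound)
    show "(\<lambda>t. v t (X t x)) \<in> borel_measurable \<I>"
    proof (rule lipschitz_composition_measurable[where v=v and y="\<lambda>t. X t x"])
      show "(\<lambda>t. X t x) \<in> borel_measurable \<I>"
        using motion_path_continuous assms unfolding admissible_def
        by (intro continuous_imp_measurable_on_sets_lebesgue) auto
    qed (use assms admissible_lip in \<open>auto simp: admissible_def\<close>)
    show "(\<lambda>t. (1 + norm x) * g t) absolutely_integrable_on {0..T}"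
      using L1_D(1)[OF g(1)] by (rule set_integrable_mult_right)
  qed (use g(2) in \<open>auto simp: mult.commute\<close>)
qed

definition lipschitz_motion :: "(real \<Rightarrow> 'a \<Rightarrow> 'a) \<Rightarrow> bool" where
  "lipschitz_motion X \<longleftrightarrow> (\<exists>C. \<forall>t\<in>{0..T}. C-lipschitz_on UNIV (X t))"

definition picard :: "(real \<Rightarrow> 'a \<Rightarrow> 'a) \<Rightarrow> (real \<Rightarrow> 'a \<Rightarrow> 'a) \<Rightarrow> real \<Rightarrow> 'a \<Rightarrow> 'a" where
  "picard X v t x = x + prim (\<lambda>s. v s (X s x)) t"

text \<open>Continuity in the starting point ensures that the iterates are Borel functions of it; the
  constant may depend on the iterate.\<close>

lemma picard_lipschitz:
  assumes adm: "admissible X v" and lipX: "lipschitz_motion X"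
  shows "lipschitz_motion (picard X v)"
proof -
  obtain C where C: "\<And>t. t \<in> {0..T} \<Longrightarrow> C-lipschitz_on UNIV (X t)" using lipX unfolding lipschitz_motion_def by blast
  have C0: "0 \<le> C" using C[OF \<tau>] by (rule lipschitz_on_nonneg)
  have li: "l absolutely_integrable_on {0..T}" by (rule L1_D(1)[OF l])
  have "(1 + C * integral {0..T} l)-lipschitz_on UNIV (picard X v t)" if t: "t \<in> {0..T}" for t
  proof (rule lipschitz_onI)
    fix x y :: 'a
    let ?f = "\<lambda>s. v s (X s x) - v s (X s y)"
    have f: "?f absolutely_integrable_on {0..T}"
      by (intro set_integral_diff(1) admissible_velocity_integrable adm)
    have le: "norm (?f s) \<le> (C * dist x y) * l s" if s: "s \<in> {0..T}" for s
    proof -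
      have "norm (?f s) \<le> l s * dist (X s x) (X s y)"
        using lipschitz_onD[OF admissible_lip[OF adm s]] by (simp add: dist_norm)
      also have "\<dots> \<le> l s * (C * dist x y)"
        using lipschitz_onD[OF C[OF s]] L1_D(2)[OF l s] by (intro mult_left_mono) auto
      finally show ?thesis by (simp add: mult_ac)
    qed
    have bnd: "norm (integral {s..r} ?f) \<le> (C * dist x y) * integral {0..T} l" if "0 \<le> s" "s \<le> r" "r \<le> T" for s r
    proof -
      have "norm (integral {s..r} ?f) \<le> integral {s..r} (\<lambda>s. (C * dist x y) * l s)"
        using that le by (intro integral_norm_le absolutely_integrable_subinterval_real[OF f]
            absolutely_integrable_subinterval_real[OF set_integrable_mult_right[OF li]]) auto
      also have "\<dots> = (C * dist x y) * integral {s..r} l" by simp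
      also have "\<dots> \<le> (C * dist x y) * integral {0..T} l"
        using L1_integral_mono_set[OF l that] C0 by (intro mult_left_mono) auto
      finally show ?thesis .
    qed
    have "prim ?f t = prim (\<lambda>s. v s (X s x)) t - prim (\<lambda>s. v s (X s y)) t"
    proof -
      have i: "(\<lambda>s. v s (X s z)) integrable_on {0..r}" if "r \<le> T" for z r
        using absolutely_integrable_subinterval_real[OF admissible_velocity_integrable[OF adm, of z], of 0 r] that
        by (auto simp: absolutely_integrable_on_def)
      show ?thesis using i[of t] i[of \<tau>] t \<tau> by (simp add: prim_def Henstock_Kurzweil_Integration.integral_diff)
    qed
    moreover have "norm (prim ?f t) \<le> (C * dist x y) * integral {0..T} l"
    proof (cases "\<tau> \<le> t")
      case True
      then show ?thesis using prim_diff[OF f, of \<tau> t] bnd[of \<tau> t] t \<tau> by simp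
    next
      case False
      then have "- prim ?f t = integral {t..\<tau>} ?f" using prim_diff[OF f, of t \<tau>] t \<tau> by simp
      then have "norm (prim ?f t) = norm (integral {t..\<tau>} ?f)" by (metis norm_minus_cancel)
      then show ?thesis using bnd[of t \<tau>] False t \<tau> by simp
    qed
    moreover have "picard X v t x - picard X v t y = (x - y) + (prim (\<lambda>s. v s (X s x)) t - prim (\<lambda>s. v s (X s y)) t)"
      by (simp add: picard_def)
    ultimately have "dist (picard X v t x) (picard X v t y) \<le> norm (x - y) + (C * dist x y) * integral {0..T} l"
      using norm_triangle_ineq[of "x - y" "prim ?f t"] by (simp add: dist_norm)
    then show "dist (picard X v t x) (picard X v t y) \<le> (1 + C * integral {0..T} l) * dist x y"
      by (simp add: dist_norm algebra_simps)
  next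
    show "0 \<le> 1 + C * integral {0..T} l" using C0 L1_integral_nonneg[OF l, of 0 T] by simp
  qed
  then show ?thesis unfolding lipschitz_motion_def by blast
qed

lemma picard_increment:
  assumes adm: "admissible X v"
  shows "\<exists>g\<in>L1_nonneg T. \<forall>s t x. 0 \<le> s \<longrightarrow> s \<le> t \<longrightarrow> t \<le> T \<longrightarrow>
        norm (picard X v t x - picard X v s x) \<le> integral {s..t} g * (1 + norm x)"
proof -
  obtain g where g: "g \<in> L1_nonneg T" "\<And>t x. t \<in> {0..T} \<Longrightarrow> norm (v t (X t x)) \<le> g t * (1 + norm x)"
    using admissible_velocity_bound[OF assms] by blast
  have "norm (picard X v t x - picard X v s x) \<le> integral {s..t} g * (1 + norm x)" if st: "0 \<le> s" "s \<le> t" "t \<le> T" for s t x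
  proof -
    have "picard X v t x - picard X v s x = integral {s..t} (\<lambda>r. v r (X r x))"
      using prim_diff[OF admissible_velocity_integrable[OF adm] st] by (simp add: picard_def)
    also have "norm \<dots> \<le> integral {s..t} (\<lambda>r. (1 + norm x) * g r)"
      using g(2) st by (intro integral_norm_le absolutely_integrable_subinterval_real[OF admissible_velocity_integrable[OF adm]]
         absolutely_integrable_subinterval_real[OF set_integrable_mult_right[OF L1_D(1)[OF g(1)]]]) (auto simp: mult.commute)
    finally show ?thesis by (simp add: mult.commute)
  qed
  then show ?thesis using g(1) by blast
qed

lemma picard_motion:
  assumes adm: "admissible X v" and "\<And>t. t \<in> {0..T} \<Longrightarrow> picard X v t \<in> borel_measurable borel"
  shows "motion (picard X v)"
  unfolding motion_def using picard_increment[OF adm] assms(2) by (simp add: picard_def)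

end

section \<open>Convergence of the Filippov iteration\<close>

lemma telescoping_limit:
  fixes x :: "nat \<Rightarrow> 'b::banach"
  assumes le: "\<And>n. norm (x (Suc n) - x n) \<le> d n" and d: "summable d"
  shows "\<exists>y. x \<longlonglongrightarrow> y \<and> (\<forall>n. norm (y - x n) \<le> (\<Sum>k. d (k + n)))"
proof -
  let ?f = "\<lambda>n. x (Suc n) - x n"
  have s: "summable ?f" by (rule summable_comparison_test'[OF d, of 0]) (use le in auto)
  have part: "(\<Sum>k<n. ?f k) = x n - x 0" for n by (rule sum_lessThan_telescope)
  have "(\<lambda>n. (\<Sum>k<n. ?f k) + x 0) \<longlonglongrightarrow> suminf ?f + x 0"
    by (intro tendsto_intros summable_LIMSEQ s)
  then have lim: "x \<longlonglongrightarrow> suminf ?f + x 0" by (simp add: part)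
  have "norm (suminf ?f + x 0 - x n) \<le> (\<Sum>k. d (k + n))" for n
  proof -
    have "suminf ?f + x 0 - x n = (\<Sum>k. ?f (k + n))"
      using suminf_minus_initial_segment[OF s, of n] part[of n] by (simp add: algebra_simps)
    also have "norm \<dots> \<le> (\<Sum>k. d (k + n))"
      using le d by (intro norm_suminf_le) (auto simp: summable_iff_shift)
    finally show ?thesis .
  qed
  then show ?thesis using lim by blast
qed

lemma suminf_tail_tendsto_zero:
  fixes f :: "nat \<Rightarrow> real"
  assumes "summable f"
  shows "(\<lambda>n. \<Sum>k. f (k + n)) \<longlonglongrightarrow> 0"
proof -
  have "(\<lambda>n. suminf f - (\<Sum>k<n. f k)) \<longlonglongrightarrow> suminf f - suminf f"
    by (intro tendsto_intros summable_LIMSEQ assms)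
  then show ?thesis using suminf_minus_initial_segment[OF assms] by simp
qed

lemma lipschitz_on_limit:
  fixes f :: "nat \<Rightarrow> 'b::metric_space \<Rightarrow> 'c::metric_space"
  assumes lip: "\<And>n. C-lipschitz_on U (f n)" and lim: "\<And>x. x \<in> U \<Longrightarrow> (\<lambda>n. f n x) \<longlonglongrightarrow> g x"
  shows "C-lipschitz_on U g"
proof (rule lipschitz_onI)
  fix x y assume "x \<in> U" "y \<in> U"
  then have "(\<lambda>n. dist (f n x) (f n y)) \<longlonglongrightarrow> dist (g x) (g y)" by (intro tendsto_dist lim)
  moreover have "\<exists>N. \<forall>n\<ge>N. dist (f n x) (f n y) \<le> C * dist x y"
    using lipschitz_onD[OF lip \<open>x \<in> U\<close> \<open>y \<in> U\<close>] by blast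
  ultimately show "dist (g x) (g y) \<le> C * dist x y" by (rule LIMSEQ_le_const2)
qed (use lipschitz_on_nonneg[OF lip[of 0]] in auto)

context inclusion_start begin

lemma law_start: "law (\<lambda>t x. x) t = \<mu>0"
  using \<mu>0 by (simp add: law_def Pp_def distr_id2)

lemma admissible_start: "admissible (\<lambda>t x. x) v0"
proof -
  have "(\<lambda>t. 0) \<in> L1_nonneg T" by (simp add: L1_nonneg_def)
  then have "motion (\<lambda>t x. x)" unfolding motion_def by (auto intro!: bexI[of _ "\<lambda>t. 0"])
  then show ?thesis using v0 v0_measurable by (simp add: admissible_def law_start)
qed

lemma lipschitz_motion_start: "lipschitz_motion (\<lambda>t x. x)"
  unfolding lipschitz_motion_def by (intro exI[of _ 1] ballI lipschitz_onI) auto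

lemma initial_field_bound:
  assumes t: "t \<in> {0..T}" and u: "u \<in> V t \<mu>0"
  shows "norm (u x) \<le> \<kappa> t * (1 + norm x)"
proof -
  have m0: "0 \<le> m t" "0 \<le> l t" "0 \<le> L t" using L1_D(2)[OF m t] L1_D(2)[OF l t] L1_D(2)[OF L t] by auto
  have "norm (u x) \<le> m t * (1 + norm x + moment p \<mu>0)" using V_growth[OF t \<mu>0 u] .
  also have "\<dots> \<le> m t * ((1 + moment p \<mu>0) * (1 + norm x))"
    using m0 moment_nonneg[of \<mu>0] by (intro mult_left_mono) (auto simp: algebra_simps)
  also have "\<dots> = ((1 + moment p \<mu>0) * m t) * (1 + norm x)" by simp
  also have "\<dots> \<le> \<kappa> t * (1 + norm x)"
    using m0 K0 by (intro mult_right_mono) (auto simp: \<kappa>_def)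
  finally show ?thesis .
qed

lemma v0_bound: "t \<in> {0..T} \<Longrightarrow> norm (v0 t x) \<le> \<kappa> t * (1 + norm x)"
  by (intro initial_field_bound v0)

lemma L_le_\<kappa>: "t \<in> {0..T} \<Longrightarrow> L t * K0 + l t \<le> \<kappa> t"
  using L1_D(2)[OF m] moment_nonneg[of \<mu>0] by (simp add: \<kappa>_def mult.commute)

lemma picard_start_bound:
  assumes t: "t \<in> {0..T}"
  shows "norm (picard (\<lambda>t x. x) v0 t x - x) \<le> gap (Suc 0) t * (1 + norm x)"
proof -
  have "norm (prim (\<lambda>s. v0 s x) t) \<le> (1 + norm x) * gap (Suc 0) t"
    using admissible_velocity_integrable[OF admissible_start, of x] t v0_bound
    by (intro prim_bound) (auto simp: gap_def mult.commute)
  then show ?thesis by (simp add: picard_def mult.commute)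
qed

text \<open>The new law is within \<open>gap (Suc n) t * K0\<close> of the old one, so the Lipschitz estimate on \<open>V\<close>
  provides a new velocity within \<open>L t\<close> times that distance of the old one, and the selection may be
  made measurable. The next displacement is the integral of the resulting change of velocity,
  which \<open>\<kappa>\<close> times the previous gap dominates.\<close>

lemma filippov_step:
  assumes adm: "admissible X v" and lipX: "lipschitz_motion X"
    and bnd: "\<And>t x. t \<in> {0..T} \<Longrightarrow> norm (picard X v t x - X t x) \<le> gap (Suc n) t * (1 + norm x)"
  shows "\<exists>v'. admissible (picard X v) v' \<and>
    (\<forall>t\<in>{0..T}. \<forall>x. norm (v' t x - v t x) \<le> L t * (gap (Suc n) t * K0)) \<and>
    (\<forall>t\<in>{0..T}. \<forall>x. norm (picard (picard X v) v' t x - picard X v t x) \<le> gap (Suc (Suc n)) t * (1 + norm x))"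
proof -
  let ?X = "picard X v"
  have lipX': "lipschitz_motion ?X" by (rule picard_lipschitz[OF adm lipX])
  have X: "motion X" using adm by (simp add: admissible_def)
  have X': "motion ?X"
  proof (rule picard_motion[OF adm])
    fix t assume "t \<in> {0..T}"
    then obtain C where "C-lipschitz_on UNIV (?X t)" using lipX' unfolding lipschitz_motion_def by blast
    then show "?X t \<in> borel_measurable borel"
      by (intro borel_measurable_continuous_onI lipschitz_on_continuous_on)
  qed
  obtain A' where A': "continuous_on {0..T} A'"
    "\<And>s t. s \<in> {0..T} \<Longrightarrow> t \<in> {0..T} \<Longrightarrow> Wp p (law ?X s) (law ?X t) \<le> ennreal \<bar>A' s - A' t\<bar>"
    using law_continuity[OF X'] by blast
  have ex: "\<exists>w\<in>V t (law ?X t). \<forall>i\<in>UNIV. norm (w (dense_seq i) - v t (dense_seq i)) \<le> L t * (gap (Suc n) t * K0)"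
    if t: "t \<in> {0..T}" for t
  proof -
    have "Wp p (law X t) (law ?X t) \<le> ennreal (gap (Suc n) t * K0)"
      using bnd[OF t] by (intro Wp_law_le X X' t gap_nonneg) (simp add: norm_minus_commute)
    then obtain w where "w \<in> V t (law ?X t)" "\<And>x. norm (v t x - w x) \<le> L t * (gap (Suc n) t * K0)"
      using V_move[OF t law_Pp[OF X t] law_Pp[OF X' t], of "v t" "gap (Suc n) t * K0"] adm t gap_nonneg K0
      by (auto simp: admissible_def)
    then show ?thesis by (auto simp: norm_minus_commute intro!: bexI[of _ w])
  qed
  have rm: "(\<lambda>t. L t * (gap (Suc n) t * K0)) \<in> borel_measurable \<I>"
    by (intro borel_measurable_times L1_D(3)[OF L] gap_measurable borel_measurable_const)
  obtain v' where v': "\<And>t. t \<in> {0..T} \<Longrightarrow> v' t \<in> V t (law ?X t)"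
    "\<And>t i. t \<in> {0..T} \<Longrightarrow> norm (v' t (dense_seq i) - v t (dense_seq i)) \<le> L t * (gap (Suc n) t * K0)"
    "\<And>x. (\<lambda>t. v' t x) \<in> borel_measurable \<I>"
    using selection_along_curve[where \<mu>="law ?X" and A=A' and y=v and J=UNIV, OF law_Pp[OF X'] A' _ rm ex] adm
    unfolding admissible_def by blast
  have adm': "admissible ?X v'" using X' v' by (simp add: admissible_def)
  have vv': "norm (v' t x - v t x) \<le> L t * (gap (Suc n) t * K0)" if t: "t \<in> {0..T}" for t x
    by (rule norm_le_from_dense[where v="v' t" and w="v t", OF _ _ v'(2)[OF t]])
      (use admissible_lip[OF adm t] admissible_lip[OF adm' t] in \<open>auto intro: lipschitz_on_continuous_on\<close>)
  have "norm (picard ?X v' t x - ?X t x) \<le> gap (Suc (Suc n)) t * (1 + norm x)" if t: "t \<in> {0..T}" for t x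
  proof -
    let ?f = "\<lambda>s. v' s (?X s x) - v s (X s x)"
    have i: "(\<lambda>s. v' s (?X s x)) absolutely_integrable_on {0..T}" "(\<lambda>s. v s (X s x)) absolutely_integrable_on {0..T}"
      by (intro admissible_velocity_integrable adm adm')+
    have f: "?f absolutely_integrable_on {0..T}" by (rule set_integral_diff(1)[OF i])
    have "norm (prim ?f t) \<le> (1 + norm x) * gap (Suc (Suc n)) t"
    proof (rule prim_bound[OF f t])
      fix s assume s: "s \<in> {0..T}"
      have "norm (?f s) \<le> norm (v' s (?X s x) - v s (?X s x)) + norm (v s (?X s x) - v s (X s x))"
        using norm_triangle_ineq[of "v' s (?X s x) - v s (?X s x)" "v s (?X s x) - v s (X s x)"] by simp
      also have "norm (v s (?X s x) - v s (X s x)) \<le> l s * norm (?X s x - X s x)"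
        using lipschitz_onD[OF admissible_lip[OF adm s], of "?X s x" "X s x"] by (simp add: dist_norm)
      also have "\<dots> \<le> l s * (gap (Suc n) s * (1 + norm x))"
        using bnd[OF s] L1_D(2)[OF l s] by (intro mult_left_mono) auto
      also have "norm (v' s (?X s x) - v s (?X s x)) \<le> L s * (gap (Suc n) s * K0)" by (rule vv'[OF s])
      also have "L s * (gap (Suc n) s * K0) \<le> L s * (gap (Suc n) s * K0) * (1 + norm x)"
      proof -
        have "0 \<le> L s * (gap (Suc n) s * K0)" using L1_D(2)[OF L s] gap_nonneg K0 by simp
        then show ?thesis by (simp add: mult_le_cancel_left1)
      qed
      also have "L s * (gap (Suc n) s * K0) * (1 + norm x) + l s * (gap (Suc n) s * (1 + norm x))
          = (L s * K0 + l s) * (gap (Suc n) s * (1 + norm x))" by (simp add: algebra_simps)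
      also have "\<dots> \<le> \<kappa> s * (gap (Suc n) s * (1 + norm x))"
        using L_le_\<kappa>[OF s] gap_nonneg by (intro mult_right_mono) auto
      finally show "norm (?f s) \<le> (1 + norm x) * (\<kappa> s * gap (Suc n) s)" by (simp add: mult_ac)
    qed
    moreover have "prim ?f t = prim (\<lambda>s. v' s (?X s x)) t - prim (\<lambda>s. v s (X s x)) t"
    proof -
      have j: "(\<lambda>s. v' s (?X s x)) integrable_on {0..r}" "(\<lambda>s. v s (X s x)) integrable_on {0..r}" if "r \<le> T" for r
        using absolutely_integrable_subinterval_real[OF i(1), of 0 r] absolutely_integrable_subinterval_real[OF i(2), of 0 r] that
        by (auto simp: absolutely_integrable_on_def)
      show ?thesis using j[of t] j[of \<tau>] t \<tau> by (simp add: prim_def Henstock_Kurzweil_Integration.integral_diff)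
    qed
    moreover have "picard ?X v' t x - ?X t x = prim (\<lambda>s. v' s (?X s x)) t - prim (\<lambda>s. v s (X s x)) t"
      by (simp add: picard_def)
    ultimately show ?thesis by (simp add: mult.commute)
  qed
  then show ?thesis using adm' vv' by blast
qed

lemma filippov_sequence:
  obtains Xs vs where
    "Xs 0 = (\<lambda>t x. x)" "vs 0 = v0" "\<And>n. admissible (Xs n) (vs n)" "\<And>n. Xs (Suc n) = picard (Xs n) (vs n)"
    "\<And>n. lipschitz_motion (Xs n)"
    "\<And>n t x. t \<in> {0..T} \<Longrightarrow> norm (Xs (Suc n) t x - Xs n t x) \<le> gap (Suc n) t * (1 + norm x)"
    "\<And>n t x. t \<in> {0..T} \<Longrightarrow> norm (vs (Suc n) t x - vs n t x) \<le> L t * (gap (Suc n) t * K0)"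
proof -
  define P where "P = (\<lambda>n (X, v). (n = 0 \<longrightarrow> X = (\<lambda>t x. x) \<and> v = v0) \<and> admissible X v \<and> lipschitz_motion X \<and>
    (\<forall>t\<in>{0..T}. \<forall>x. norm (picard X v t x - X t x) \<le> gap (Suc n) t * (1 + norm x)))"
  define Q where "Q = (\<lambda>n (X, v) (X', v'). X' = picard X v \<and>
    (\<forall>t\<in>{0..T}. \<forall>x. norm (v' t x - v t x) \<le> L t * (gap (Suc n) t * K0)))"
  have "\<exists>f. \<forall>n. P n (f n) \<and> Q n (f n) (f (Suc n))"
  proof (rule dependent_nat_choice)
    show "\<exists>s. P 0 s"
      using admissible_start lipschitz_motion_start picard_start_bound
      by (intro exI[of _ "(\<lambda>t x. x, v0)"]) (simp add: P_def)
    fix s n assume "P n s"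
    moreover obtain X v where s: "s = (X, v)" by (cases s)
    ultimately have "admissible X v" "lipschitz_motion X"
      "\<And>t x. t \<in> {0..T} \<Longrightarrow> norm (picard X v t x - X t x) \<le> gap (Suc n) t * (1 + norm x)"
      by (auto simp: P_def)
    from filippov_step[OF this] picard_lipschitz[OF this(1,2)] obtain v' where
      "admissible (picard X v) v'" "lipschitz_motion (picard X v)"
      "\<forall>t\<in>{0..T}. \<forall>x. norm (v' t x - v t x) \<le> L t * (gap (Suc n) t * K0)"
      "\<forall>t\<in>{0..T}. \<forall>x. norm (picard (picard X v) v' t x - picard X v t x) \<le> gap (Suc (Suc n)) t * (1 + norm x)"
      by blast
    then show "\<exists>s'. P (Suc n) s' \<and> Q n s s'"
      by (intro exI[of _ "(picard X v, v')"]) (simp add: P_def Q_def s)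
  qed
  then obtain f where f: "\<And>n. P n (f n)" "\<And>n. Q n (f n) (f (Suc n))" by blast
  define Xs vs where "Xs = (\<lambda>n. fst (f n))" and "vs = (\<lambda>n. snd (f n))"
  have P: "P n (Xs n, vs n)" and Q: "Q n (Xs n, vs n) (Xs (Suc n), vs (Suc n))" for n
    using f[of n] by (simp_all add: Xs_def vs_def)
  show thesis
  proof (rule that[of Xs vs])
    show "Xs 0 = (\<lambda>t x. x)" "vs 0 = v0" using P[of 0] by (simp_all add: P_def)
    show "admissible (Xs n) (vs n)" "lipschitz_motion (Xs n)" for n using P[of n] by (simp_all add: P_def)
    show XS: "Xs (Suc n) = picard (Xs n) (vs n)" for n using Q[of n] by (simp add: Q_def)
    show "norm (Xs (Suc n) t x - Xs n t x) \<le> gap (Suc n) t * (1 + norm x)" if "t \<in> {0..T}" for n t x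
      using P[of n] that unfolding XS P_def by blast
    show "norm (vs (Suc n) t x - vs n t x) \<le> L t * (gap (Suc n) t * K0)" if "t \<in> {0..T}" for n t x
      using Q[of n] that unfolding Q_def by blast
  qed
qed

text \<open>The gaps sum to at most \<open>exp (elapsed t) - 1\<close>, so positions and velocities converge,
  uniformly relative to \<open>1 + \<bar>x\<bar>\<close>, and the limit keeps this distance from the start of the
  iteration. The limit velocity belongs to \<open>V\<close> along the limit laws because these sets are closed
  and depend continuously on the law. The quantitative bounds, which vanish as \<open>t\<close> tends to \<open>\<tau>\<close>,
  are what makes the solution tangent to \<open>v0\<close>.\<close>

lemma filippov_existence:
  "\<exists>X v. admissible X v \<and> (\<forall>t\<in>{0..T}. \<forall>x. X t x = picard X v t x) \<and>
    (\<forall>t\<in>{0..T}. \<forall>x. norm (X t x - x) \<le> (exp (elapsed t) - 1) * (1 + norm x)) \<and>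
    (\<forall>t\<in>{0..T}. \<forall>x. norm (v t x - v0 t x) \<le> L t * (K0 * (exp (elapsed t) - 1)))"
proof -
  obtain Xs vs where seq:
    "Xs 0 = (\<lambda>t x. x)" "vs 0 = v0" "\<And>n. admissible (Xs n) (vs n)" "\<And>n. Xs (Suc n) = picard (Xs n) (vs n)"
    "\<And>n. lipschitz_motion (Xs n)"
    "\<And>n t x. t \<in> {0..T} \<Longrightarrow> norm (Xs (Suc n) t x - Xs n t x) \<le> gap (Suc n) t * (1 + norm x)"
    "\<And>n t x. t \<in> {0..T} \<Longrightarrow> norm (vs (Suc n) t x - vs n t x) \<le> L t * (gap (Suc n) t * K0)"
    by (rule filippov_sequence) blast
  have mo: "motion (Xs n)" for n using seq(3)[of n] by (simp add: admissible_def)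
  have exp_sums: "(\<lambda>n. z ^ n / fact n) sums exp z" for z :: real
    using exp_converges[of z] by (simp add: field_simps scaleR_conv_of_real)
  have tail_sums: "(\<lambda>n. z ^ Suc n / fact (Suc n)) sums (exp z - 1)" for z :: real
    using exp_sums[of z] sums_Suc_iff[of "\<lambda>n. z ^ n / fact n" "exp z - 1"] by simp
  define \<beta> where "\<beta> = (\<lambda>n. accrued T ^ Suc n / fact (Suc n))"
  have s\<beta>: "summable \<beta>" unfolding \<beta>_def using tail_sums sums_summable by blast
  have sb: "summable (\<lambda>n. gap (Suc n) t)" for t unfolding gap_def using tail_sums sums_summable by blast
  have b\<beta>: "gap (Suc n) t \<le> \<beta> n" if "t \<in> {0..T}" for n t
    unfolding gap_def \<beta>_def using elapsed_bounds[OF that] by (intro divide_right_mono power_mono) auto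
  define R where "R = (\<lambda>n t. \<Sum>k. gap (Suc (k + n)) t)"
  (* The tail bound uniform in time serves the limits; the sharp one, at n = 0, serves the final estimate. *)
  define Rm where "Rm = (\<lambda>n. \<Sum>k. \<beta> (k + n))"
  have R0: "R 0 t = exp (elapsed t) - 1" for t using tail_sums[of "elapsed t"] by (simp add: R_def gap_def sums_iff)
  have R_le: "R n t \<le> Rm n" if "t \<in> {0..T}" for n t
    unfolding R_def Rm_def using b\<beta>[OF that] sb[of t] s\<beta>
    by (intro suminf_le) (auto simp: summable_iff_shift[of "\<lambda>n. gap (Suc n) t"] summable_iff_shift[of \<beta>])
  have R_nonneg: "0 \<le> R n t" for n t unfolding R_def using sb[of t] gap_nonneg
    by (intro suminf_nonneg) (auto simp: summable_iff_shift[of "\<lambda>n. gap (Suc n) t"])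
  have Rm0: "Rm \<longlonglongrightarrow> 0" unfolding Rm_def by (rule suminf_tail_tendsto_zero[OF s\<beta>])
  have Rm_nonneg: "0 \<le> Rm n" for n using R_nonneg[of n 0] R_le[of 0 n] T by simp
  have exX: "\<exists>y. (\<lambda>n. Xs n t x) \<longlonglongrightarrow> y \<and> (\<forall>n. norm (y - Xs n t x) \<le> R n t * (1 + norm x))" if t: "t \<in> {0..T}" for t x
  proof -
    have sm: "summable (\<lambda>n. gap (Suc n) t * (1 + norm x))" by (rule summable_mult2[OF sb])
    have "(\<Sum>k. gap (Suc (k + n)) t * (1 + norm x)) = R n t * (1 + norm x)" for n
      unfolding R_def using sb[of t] by (intro suminf_mult2[symmetric]) (auto simp: summable_iff_shift[of "\<lambda>n. gap (Suc n) t"])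
    then show ?thesis using telescoping_limit[of "\<lambda>n. Xs n t x", OF seq(6)[OF t] sm] by simp
  qed
  have exv: "\<exists>y. (\<lambda>n. vs n t x) \<longlonglongrightarrow> y \<and> (\<forall>n. norm (y - vs n t x) \<le> L t * (K0 * R n t))" if t: "t \<in> {0..T}" for t x
  proof -
    have sm: "summable (\<lambda>n. L t * (gap (Suc n) t * K0))" by (intro summable_mult summable_mult2 sb)
    have "(\<Sum>k. L t * (gap (Suc (k + n)) t * K0)) = L t * (K0 * R n t)" for n
    proof -
      have s: "summable (\<lambda>k. gap (Suc (k + n)) t)" using sb[of t] by (simp add: summable_iff_shift[of "\<lambda>n. gap (Suc n) t"])
      show ?thesis unfolding R_def using suminf_mult2[OF s, of K0] suminf_mult[OF summable_mult2[OF s, of K0], of "L t"]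
        by (simp add: mult.commute)
    qed
    then show ?thesis using telescoping_limit[of "\<lambda>n. vs n t x", OF seq(7)[OF t] sm] by simp
  qed
  define X where "X = (\<lambda>t x. lim (\<lambda>n. Xs n t x))"
  define v where "v = (\<lambda>t x. lim (\<lambda>n. vs n t x))"
  have X: "(\<lambda>n. Xs n t x) \<longlonglongrightarrow> X t x" "norm (X t x - Xs n t x) \<le> R n t * (1 + norm x)" if "t \<in> {0..T}" for t x n
    using exX[OF that, of x] limI unfolding X_def by blast+
  have v: "(\<lambda>n. vs n t x) \<longlonglongrightarrow> v t x" "norm (v t x - vs n t x) \<le> L t * (K0 * R n t)" if "t \<in> {0..T}" for t x n
    using exv[OF that, of x] limI unfolding v_def by blast+
  have lipv: "(l t)-lipschitz_on UNIV (v t)" if t: "t \<in> {0..T}" for t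
    by (rule lipschitz_on_limit[OF admissible_lip[OF seq(3) t] v(1)[OF t]])
  have mv: "(\<lambda>t. v t x) \<in> borel_measurable \<I>" for x
    by (rule borel_measurable_LIMSEQ_metric[of "\<lambda>n t. vs n t x"])
      (use seq(3) v(1) in \<open>auto simp: admissible_def\<close>)
  have diff: "norm (v t (X t x) - vs n t (Xs n t x)) \<le> (Rm n * (1 + norm x)) * (\<kappa> t * gap 0 t)" if t: "t \<in> {0..T}" for t x n
  proof -
    have L0: "0 \<le> L t" and l0: "0 \<le> l t" using L1_D(2)[OF L t] L1_D(2)[OF l t] .
    have "norm (v t (X t x) - vs n t (Xs n t x)) \<le> norm (v t (X t x) - vs n t (X t x)) + norm (vs n t (X t x) - vs n t (Xs n t x))"
      using norm_triangle_ineq[of "v t (X t x) - vs n t (X t x)" "vs n t (X t x) - vs n t (Xs n t x)"] by simp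
    also have "norm (vs n t (X t x) - vs n t (Xs n t x)) \<le> l t * norm (X t x - Xs n t x)"
      using lipschitz_onD[OF admissible_lip[OF seq(3) t], of "X t x" "Xs n t x"] by (simp add: dist_norm)
    also have "\<dots> \<le> l t * (Rm n * (1 + norm x))"
      using X(2)[OF t, of x n] mult_right_mono[OF R_le[OF t, of n], of "1 + norm x"] l0
      by (intro mult_left_mono) auto
    also have "norm (v t (X t x) - vs n t (X t x)) \<le> L t * (K0 * R n t)" by (rule v(2)[OF t])
    also have "\<dots> \<le> L t * (K0 * (Rm n * (1 + norm x)))"
    proof (intro mult_left_mono L0 K0)
      have "R n t * 1 \<le> Rm n * (1 + norm x)" using R_le[OF t] R_nonneg Rm_nonneg by (intro mult_mono) auto
      then show "R n t \<le> Rm n * (1 + norm x)" by simp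
    qed
    also have "L t * (K0 * (Rm n * (1 + norm x))) + l t * (Rm n * (1 + norm x)) = (L t * K0 + l t) * (Rm n * (1 + norm x))"
      by (simp add: algebra_simps)
    also have "\<dots> \<le> \<kappa> t * (Rm n * (1 + norm x))"
      using L_le_\<kappa>[OF t] Rm_nonneg by (intro mult_right_mono) auto
    finally show ?thesis by (simp add: gap_def mult_ac)
  qed
  have Xm: "X t \<in> borel_measurable borel" if t: "t \<in> {0..T}" for t
    by (rule borel_measurable_LIMSEQ_metric[of "\<lambda>n. Xs n t"]) (use motion_measurable[OF mo t] X(1)[OF t] in auto)
  have pathm: "(\<lambda>t. X t x) \<in> borel_measurable \<I>" for x
  proof (rule borel_measurable_LIMSEQ_metric[of "\<lambda>n t. Xs n t x"])
    show "(\<lambda>t. Xs n t x) \<in> borel_measurable \<I>" for n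
      using motion_path_continuous[OF mo] by (intro continuous_imp_measurable_on_sets_lebesgue) auto
  qed (use X(1) in auto)
  have fm: "(\<lambda>t. v t (X t x)) \<in> borel_measurable \<I>" for x
    by (rule lipschitz_composition_measurable[where v=v and y="\<lambda>t. X t x"]) (use lipv mv pathm in auto)
  have fb: "norm (v t (X t x)) \<le> ((1 + Rm 0) * \<kappa> t) * (1 + norm x)" if t: "t \<in> {0..T}" for t x
  proof -
    have "norm (v t (X t x)) \<le> norm (v0 t x) + norm (v t (X t x) - vs 0 t (Xs 0 t x))"
      using norm_triangle_ineq[of "v0 t x" "v t (X t x) - v0 t x"] by (simp add: seq(1,2))
    also have "\<dots> \<le> \<kappa> t * (1 + norm x) + (Rm 0 * (1 + norm x)) * (\<kappa> t * gap 0 t)"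
      by (intro add_mono v0_bound diff t)
    finally show ?thesis by (simp add: gap_def algebra_simps)
  qed
  have \<kappa>L1: "(\<lambda>t. (1 + Rm 0) * \<kappa> t) \<in> L1_nonneg T"
    using \<kappa>_nonneg Rm_nonneg[of 0] set_integrable_mult_right[OF \<kappa>_abs, of "1 + Rm 0"]
    unfolding L1_nonneg_def integrable_lebesgue_on_iff by auto
  have fi: "(\<lambda>t. v t (X t x)) absolutely_integrable_on {0..T}" for x
    by (rule absolutely_integrable_bound[OF fm set_integrable_mult_left[OF L1_D(1)[OF \<kappa>L1], of "1 + norm x"]])
      (use fb in auto)
  have pic: "X t x = picard X v t x" if t: "t \<in> {0..T}" for t x
  proof -
    have "norm (picard X v t x - Xs (Suc n) t x) \<le> Rm n * ((1 + norm x) * gap (Suc 0) t)" for n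
    proof -
      let ?f = "\<lambda>s. v s (X s x) - vs n s (Xs n s x)"
      have i: "(\<lambda>s. vs n s (Xs n s x)) absolutely_integrable_on {0..T}"
        by (rule admissible_velocity_integrable[OF seq(3)])
      have f: "?f absolutely_integrable_on {0..T}" by (rule set_integral_diff(1)[OF fi i])
      have j: "(\<lambda>s. v s (X s x)) integrable_on {0..r}" "(\<lambda>s. vs n s (Xs n s x)) integrable_on {0..r}" if "r \<le> T" for r
        using absolutely_integrable_subinterval_real[OF i, of 0 r] absolutely_integrable_subinterval_real[OF fi, of 0 r] that
        by (auto simp: absolutely_integrable_on_def)
      have "prim ?f t = prim (\<lambda>s. v s (X s x)) t - prim (\<lambda>s. vs n s (Xs n s x)) t"
        using j[of t] j[of \<tau>] t \<tau> by (simp add: prim_def Henstock_Kurzweil_Integration.integral_diff)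
      then have "picard X v t x - Xs (Suc n) t x = prim ?f t" by (simp add: seq(4) picard_def)
      moreover have "norm (prim ?f t) \<le> (Rm n * (1 + norm x)) * gap (Suc 0) t"
        by (rule prim_bound[OF f t]) (use diff in auto)
      ultimately show ?thesis by (simp add: mult_ac)
    qed
    then have le: "norm (Xs (Suc n) t x - picard X v t x) \<le> Rm n * ((1 + norm x) * gap (Suc 0) t)" for n
      by (simp add: norm_minus_commute)
    have "(\<lambda>n. Xs (Suc n) t x - picard X v t x) \<longlonglongrightarrow> 0"
      using always_eventually[OF allI[of "\<lambda>n. norm (Xs (Suc n) t x - picard X v t x) \<le> Rm n * ((1 + norm x) * gap (Suc 0) t)", OF le]]
      by (rule Lim_null_comparison[OF _ tendsto_mult_left_zero[OF Rm0]])
    then have "(\<lambda>n. Xs (Suc n) t x) \<longlonglongrightarrow> picard X v t x" by (simp add: LIM_zero_iff)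
    then show ?thesis using LIMSEQ_Suc[OF X(1)[OF t]] LIMSEQ_unique by blast
  qed
  have motX: "motion X"
    unfolding motion_def
  proof (intro conjI allI ballI bexI[OF _ \<kappa>L1] impI)
    show "X \<tau> x = x" for x using pic[OF \<tau>] by (simp add: picard_def)
    show "X t \<in> borel_measurable borel" if "t \<in> {0..T}" for t by (rule Xm[OF that])
    fix s t x assume st: "0 \<le> s" "s \<le> t" "t \<le> T"
    have "X t x - X s x = integral {s..t} (\<lambda>r. v r (X r x))"
      using prim_diff[OF fi st, of x] pic[of t x] pic[of s x] st by (simp add: picard_def)
    also have "norm \<dots> \<le> integral {s..t} (\<lambda>r. (1 + norm x) * ((1 + Rm 0) * \<kappa> r))"
    proof (rule integral_norm_le)
      show "(\<lambda>r. v r (X r x)) absolutely_integrable_on {s..t}"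
        by (rule absolutely_integrable_subinterval_real[OF fi st(1,3)])
      show "(\<lambda>r. (1 + norm x) * ((1 + Rm 0) * \<kappa> r)) absolutely_integrable_on {s..t}"
        by (rule absolutely_integrable_subinterval_real[OF set_integrable_mult_right[OF L1_D(1)[OF \<kappa>L1]] st(1,3)])
      show "norm (v r (X r x)) \<le> (1 + norm x) * ((1 + Rm 0) * \<kappa> r)" if "r \<in> {s..t}" for r
        using fb[of r x] that st by (simp add: mult.commute)
    qed
    also have "\<dots> = (1 + norm x) * integral {s..t} (\<lambda>r. (1 + Rm 0) * \<kappa> r)" by (rule integral_mult_right)
    finally show "norm (X t x - X s x) \<le> integral {s..t} (\<lambda>r. (1 + Rm 0) * \<kappa> r) * (1 + norm x)"
      by (simp only: mult.commute)
  qed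
  have inV: "v t \<in> V t (law X t)" if t: "t \<in> {0..T}" for t
  proof (rule closedin_cc_locally_uniform[OF V_closed[OF t law_Pp[OF motX t]] lipschitz_imp_C0[OF lipv[OF t]]])
    fix k :: nat and e :: real assume e: "0 < e"
    have L0: "0 \<le> L t" by (rule L1_D(2)[OF L t])
    have "(\<lambda>n. 2 * (L t * (K0 * Rm n))) \<longlonglongrightarrow> 0" by (intro tendsto_mult_right_zero Rm0)
    then have "\<forall>\<^sub>F n in sequentially. 2 * (L t * (K0 * Rm n)) < e" by (rule order_tendstoD(2)) (rule e)
    then obtain n where n: "2 * (L t * (K0 * Rm n)) < e" by (auto dest!: eventually_happens'[OF sequentially_bot])
    have "Wp p (law (Xs n) t) (law X t) \<le> ennreal (Rm n * K0)"
    proof (rule Wp_law_le[OF mo motX t t Rm_nonneg])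
      fix x
      have "norm (X t x - Xs n t x) \<le> Rm n * (1 + norm x)"
        using X(2)[OF t, of x n] mult_right_mono[OF R_le[OF t, of n], of "1 + norm x"] by simp
      then show "norm (Xs n t x - X t x) \<le> Rm n * (1 + norm x)" by (simp add: norm_minus_commute)
    qed
    then obtain w where w: "w \<in> V t (law X t)" "\<And>x. norm (vs n t x - w x) \<le> L t * (Rm n * K0)"
      using V_move[OF t law_Pp[OF mo t] law_Pp[OF motX t], of "vs n t" n "Rm n * K0"] seq(3)[of n] t Rm_nonneg[of n] K0
      by (auto simp: admissible_def)
    have "norm (v t x - w x) \<le> e" for x
    proof -
      have "norm (v t x - w x) \<le> norm (v t x - vs n t x) + norm (vs n t x - w x)"
        using norm_triangle_ineq[of "v t x - vs n t x" "vs n t x - w x"] by simp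
      also have "norm (v t x - vs n t x) \<le> L t * (K0 * R n t)" by (rule v(2)[OF t])
      also have "\<dots> \<le> L t * (K0 * Rm n)" using L0 K0 R_le[OF t] by (intro mult_left_mono) auto
      also have "norm (vs n t x - w x) \<le> L t * (K0 * Rm n)" using w(2)[of x] by (simp add: mult.commute)
      finally show ?thesis using n by (simp add: mult.commute)
    qed
    then show "\<exists>w\<in>V t (law X t). \<forall>x. norm x \<le> real k \<longrightarrow> norm (v t x - w x) \<le> e" using w(1) by blast
  qed
  have "admissible X v" using motX inV mv by (simp add: admissible_def)
  moreover have "norm (X t x - x) \<le> (exp (elapsed t) - 1) * (1 + norm x)" if "t \<in> {0..T}" for t x
    using X(2)[OF that, of x 0] by (simp add: seq(1) R0)
  moreover have "norm (v t x - v0 t x) \<le> L t * (K0 * (exp (elapsed t) - 1))" if "t \<in> {0..T}" for t x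
    using v(2)[OF that, of x 0] by (simp add: seq(2) R0)
  ultimately show ?thesis using pic by (intro exI[of _ X] exI[of _ v]) blast
qed

end

section \<open>The continuity equation for laws of particle motions\<close>

definition gradient_field :: "('b::euclidean_space \<Rightarrow> real) \<Rightarrow> 'b \<Rightarrow> 'b" where
  "gradient_field \<phi> z = (\<Sum>b\<in>Basis. frechet_derivative \<phi> (at z) b *\<^sub>R b)"

lemma has_derivative_gradient_field:
  assumes "\<phi> differentiable (at z)"
  shows "(\<phi> has_derivative (\<lambda>h. gradient_field \<phi> z \<bullet> h)) (at z)"
proof -
  let ?f = "frechet_derivative \<phi> (at z)"
  have d: "(\<phi> has_derivative ?f) (at z)" using assms frechet_derivative_works by blast
  then interpret f: bounded_linear ?f by (rule has_derivative_bounded_linear)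
  have "?f h = gradient_field \<phi> z \<bullet> h" for h
  proof -
    have "?f h = ?f (\<Sum>b\<in>Basis. (h \<bullet> b) *\<^sub>R b)" by (simp add: euclidean_representation)
    also have "\<dots> = (\<Sum>b\<in>Basis. (h \<bullet> b) * ?f b)" by (simp add: f.sum f.scaleR)
    also have "\<dots> = gradient_field \<phi> z \<bullet> h"
      unfolding gradient_field_def inner_sum_left inner_scaleR_left
      by (intro sum.cong) (simp_all add: inner_commute mult.commute)
    finally show ?thesis .
  qed
  then have "?f = (\<lambda>h. gradient_field \<phi> z \<bullet> h)" by (rule ext)
  then show ?thesis using d by simp
qed

lemma test_function_derivative:
  assumes "\<phi> \<in> test_functions T"
  shows "(\<phi> has_derivative (\<lambda>h. gradient_field \<phi> z \<bullet> h)) (at z)"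
    and "continuous_on UNIV (gradient_field \<phi>)"
proof -
  have "Ck (Suc 0) \<phi>" using assms unfolding test_functions_def by blast
  then have \<phi>: "\<And>x. \<phi> differentiable (at x)"
    "\<And>b. b \<in> Basis \<Longrightarrow> continuous_on UNIV (\<lambda>x. frechet_derivative \<phi> (at x) b)" by auto
  show "(\<phi> has_derivative (\<lambda>h. gradient_field \<phi> z \<bullet> h)) (at z)"
    by (rule has_derivative_gradient_field[OF \<phi>(1)])
  show "continuous_on UNIV (gradient_field \<phi>)"
    unfolding gradient_field_def[abs_def] by (intro continuous_intros \<phi>(2))
qed

text \<open>Outside the compact support the function vanishes near the point, hence so does its
  gradient.\<close>

lemma test_function_gradient_bounded:
  assumes \<phi>: "\<phi> \<in> test_functions T"
  shows "\<exists>C\<ge>0. \<forall>z. norm (gradient_field \<phi> z) \<le> C"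
proof -
  let ?S = "closure {z. \<phi> z \<noteq> 0}"
  have "compact ?S" using \<phi> by (simp add: test_functions_def)
  then have "compact (gradient_field \<phi> ` ?S)"
    using test_function_derivative(2)[OF \<phi>] by (intro compact_continuous_image) (auto intro: continuous_on_subset)
  then obtain C where C: "\<And>z. z \<in> ?S \<Longrightarrow> norm (gradient_field \<phi> z) \<le> C"
    using compact_imp_bounded bounded_iff by (metis imageI)
  have "norm (gradient_field \<phi> z) \<le> max C 0" for z
  proof (cases "z \<in> ?S")
    case False
    have "((\<lambda>_. 0) has_derivative (\<lambda>_. 0)) (at z)" by simp
    then have "(\<phi> has_derivative (\<lambda>_. 0)) (at z)"
    proof (rule has_derivative_transform_within_open[where s="- ?S"])
      show "0 = \<phi> x" if "x \<in> - ?S" for x using that closure_subset[of "{z. \<phi> z \<noteq> 0}"] by auto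
    qed (use False in auto)
    then have "(\<lambda>h. gradient_field \<phi> z \<bullet> h) = (\<lambda>_. 0)"
      using has_derivative_unique test_function_derivative(1)[OF \<phi>] by blast
    then have "gradient_field \<phi> z \<bullet> gradient_field \<phi> z = 0" by (rule fun_cong)
    then show ?thesis by simp
  next
    case True
    then show ?thesis using C[of z] by simp
  qed
  then show ?thesis by (intro exI[of _ "max C 0"]) auto
qed

lemma test_function_endpoints:
  assumes \<phi>: "\<phi> \<in> test_functions T" and "t \<notin> {0<..<T}"
  shows "\<phi> (t, x) = 0"
proof (rule ccontr)
  assume "\<phi> (t, x) \<noteq> 0"
  then have "(t, x) \<in> closure {z. \<phi> z \<noteq> 0}" using closure_subset by fastforce
  then show False using assms by (auto simp: test_functions_def)
qed

lemma test_function_time_derivative: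
  assumes \<phi>: "\<phi> \<in> test_functions T"
  shows "deriv (\<lambda>s. \<phi> (s, x)) t = fst (gradient_field \<phi> (t, x))"
proof -
  have "((\<lambda>s. (s, x)) has_derivative (\<lambda>h. (h, 0))) (at t)" by (intro derivative_intros)
  then have "((\<lambda>s. \<phi> (s, x)) has_derivative (\<lambda>h. gradient_field \<phi> (t, x) \<bullet> (h, 0))) (at t)"
    by (rule has_derivative_compose[OF _ test_function_derivative(1)[OF \<phi>]])
  then have "((\<lambda>s. \<phi> (s, x)) has_field_derivative fst (gradient_field \<phi> (t, x))) (at t)"
    unfolding has_field_derivative_def by (simp add: inner_prod_def mult_commute_abs)
  then show ?thesis by (rule DERIV_imp_deriv)
qed

lemma test_function_space_gradient:
  fixes \<phi> :: "real \<times> 'a::euclidean_space \<Rightarrow> real"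
  assumes \<phi>: "\<phi> \<in> test_functions T"
  shows "grad (\<lambda>y. \<phi> (t, y)) x = snd (gradient_field \<phi> (t, x))"
proof -
  let ?D = "snd (gradient_field \<phi> (t, x))"
  have "((\<lambda>y. (t, y)) has_derivative (\<lambda>h. (0, h))) (at x)" by (intro derivative_intros)
  then have "((\<lambda>y. \<phi> (t, y)) has_derivative (\<lambda>h. gradient_field \<phi> (t, x) \<bullet> (0, h))) (at x)"
    by (rule has_derivative_compose[OF _ test_function_derivative(1)[OF \<phi>]])
  then have d: "((\<lambda>y. \<phi> (t, y)) has_derivative (\<lambda>h. h \<bullet> ?D)) (at x)"
    by (simp add: inner_prod_def inner_commute)
  show ?thesis unfolding grad_def
  proof (rule the_equality)
    show "GDERIV (\<lambda>y. \<phi> (t, y)) x :> ?D" using d by (simp add: gderiv_def)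
    fix D assume "GDERIV (\<lambda>y. \<phi> (t, y)) x :> D"
    then have "((\<lambda>y. \<phi> (t, y)) has_derivative (\<lambda>h. h \<bullet> D)) (at x)" by (simp add: gderiv_def)
    then have "(\<lambda>h. h \<bullet> D) = (\<lambda>h. h \<bullet> ?D)" using d has_derivative_unique by blast
    then have "\<forall>h. h \<bullet> D = h \<bullet> ?D" by (metis)
    then show "D = ?D" by (simp only: vector_eq_ldot)
  qed
qed

context inclusion_start begin

lemma identity_measurable: "(\<lambda>t. t) \<in> borel_measurable \<I>"
  by (intro continuous_imp_measurable_on_sets_lebesgue continuous_intros) auto

text \<open>Along each particle path the integrand is the derivative of \<open>\<phi> (t, X t x)\<close>, and \<open>\<phi>\<close>
  vanishes at both end times.\<close>

lemma path_test_function_integral: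
  assumes adm: "admissible X v" and pic: "\<And>t x. t \<in> {0..T} \<Longrightarrow> X t x = picard X v t x"
    and \<phi>: "\<phi> \<in> test_functions T"
  shows "integral {0..T} (\<lambda>t. gradient_field \<phi> (t, X t x) \<bullet> (1, v t (X t x))) = 0"
    and "(\<lambda>t. gradient_field \<phi> (t, X t x) \<bullet> (1, v t (X t x))) absolutely_integrable_on {0..T}"
proof -
  let ?f = "\<lambda>t. v t (X t x)"
  let ?g = "\<lambda>t. (1::real, ?f t)"
  have f: "?f absolutely_integrable_on {0..T}" by (rule admissible_velocity_integrable[OF adm])
  have fm: "?f \<in> borel_measurable \<I>"
    using f unfolding integrable_lebesgue_on_iff[symmetric] by (rule borel_measurable_integrable)
  have g: "?g absolutely_integrable_on {0..T}"
  proof (rule absolutely_integrable_bound)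
    show "?g \<in> borel_measurable \<I>" using fm by measurable
    have "(\<lambda>t. 1 :: real) absolutely_integrable_on {0..T}"
      by (simp flip: integrable_lebesgue_on_iff)
    then show "(\<lambda>t. 1 + norm (?f t)) absolutely_integrable_on {0..T}"
      using f by (intro set_integral_add(1)) (auto intro: absolutely_integrable_norm[unfolded o_def])
    show "norm (?g t) \<le> 1 + norm (?f t)" if "t \<in> {0..T}" for t
      using norm_Pair_le[of "1::real" "?f t"] by simp
  qed
  have Y: "(t, X t x) = (0, X 0 x) + integral {0..t} ?g" if t: "t \<in> {0..T}" for t
  proof -
    have gi: "?g integrable_on {0..t}"
      using absolutely_integrable_subinterval_real[OF g, of 0 t] t by (auto simp: absolutely_integrable_on_def)
    have "fst (integral {0..t} ?g) = t"
      using integral_linear[OF gi bounded_linear_fst] t by (simp add: o_def)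
    moreover have "snd (integral {0..t} ?g) = integral {0..t} ?f"
      using integral_linear[OF gi bounded_linear_snd] by (simp add: o_def)
    moreover have "X t x - X 0 x = integral {0..t} ?f"
      using pic[OF t, of x] pic[of 0 x] prim_diff[OF f, of 0 t] t by (simp add: picard_def)
    ultimately show ?thesis by (simp add: prod_eq_iff algebra_simps)
  qed
  note ch = chain_rule_indefinite_integral[of 0 T \<phi> "gradient_field \<phi>" ?g "\<lambda>t. (t, X t x)",
      OF _ test_function_derivative[OF \<phi>] g Y]
  show "(\<lambda>t. gradient_field \<phi> (t, X t x) \<bullet> (1, v t (X t x))) absolutely_integrable_on {0..T}"
    using ch(1) T by simp
  show "integral {0..T} (\<lambda>t. gradient_field \<phi> (t, X t x) \<bullet> (1, v t (X t x))) = 0"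
    using ch(2) T test_function_endpoints[OF \<phi>] by simp
qed

text \<open>Positions are continuous in time and measurable in the starting point, so the Caratheodory
  argument applies with the roles of the two variables exchanged. Time is clamped to the interval
  because continuity is known only there.\<close>

lemma motion_jointly_measurable:
  assumes X: "motion X"
  shows "(\<lambda>s. X (fst s) (snd s)) \<in> borel_measurable (\<I> \<Otimes>\<^sub>M \<mu>0)"
proof -
  define c where "c = (\<lambda>r. max 0 (min T r))"
  have c: "c r \<in> {0..T}" for r using T by (auto simp: c_def)
  have [measurable_cong]: "sets \<mu>0 = sets borel" using \<mu>0 by (simp add: Pp_def)
  have "(\<lambda>s. X (c (fst s)) (snd s)) \<in> borel_measurable (\<I> \<Otimes>\<^sub>M \<mu>0)"
  proof (rule caratheodory_measurable[where f="\<lambda>s r. X (c r) (snd s)" and y=fst])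
    show "continuous_on UNIV (\<lambda>r. X (c r) (snd s))" for s
      using c by (intro continuous_on_compose2[OF motion_path_continuous[OF X]]) (auto simp: c_def intro!: continuous_intros)
    show "(\<lambda>s. X (c r) (snd s)) \<in> borel_measurable (\<I> \<Otimes>\<^sub>M \<mu>0)" for r
      using motion_measurable[OF X c, of r] by measurable
    show "fst \<in> borel_measurable (\<I> \<Otimes>\<^sub>M \<mu>0)"
      by (rule measurable_compose[OF measurable_fst identity_measurable])
  qed
  moreover have "c (fst s) = fst s" if "s \<in> space (\<I> \<Otimes>\<^sub>M \<mu>0)" for s
    using that T by (auto simp: c_def space_pair_measure)
  ultimately show ?thesis by (subst measurable_cong[where g="\<lambda>s. X (c (fst s)) (snd s)"]) auto
qed

text \<open>Transported to the starting points, the space integral becomes an integral over \<open>\<mu>0\<close>;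
  after exchanging the order of integration, the time integral vanishes for each single particle.\<close>

lemma law_continuity_equation:
  assumes adm: "admissible X v" and pic: "\<And>t x. t \<in> {0..T} \<Longrightarrow> X t x = picard X v t x"
  shows "continuity_equation T v (law X)"
  unfolding continuity_equation_def
proof
  fix \<phi> :: "real \<times> 'a \<Rightarrow> real" assume \<phi>: "\<phi> \<in> test_functions T"
  have X: "motion X" using adm by (simp add: admissible_def)
  have s\<mu>[measurable_cong]: "sets \<mu>0 = sets borel" using \<mu>0 by (simp add: Pp_def)
  interpret \<mu>: prob_space \<mu>0 using \<mu>0 by (simp add: Pp_def)
  interpret I: finite_measure \<I> by (rule finite_measure_lebesgue_on) simp
  interpret P: pair_sigma_finite \<I> \<mu>0 ..
  define D where "D = gradient_field \<phi>"
  have D: "continuous_on UNIV D" unfolding D_def by (rule test_function_derivative(2)[OF \<phi>])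
  then have Dm[measurable]: "D \<in> borel_measurable borel" by (rule borel_measurable_continuous_onI)
  define h where "h = (\<lambda>t x. D (t, X t x) \<bullet> (1, v t (X t x)))"
  have Xm[measurable]: "(\<lambda>s. X (fst s) (snd s)) \<in> borel_measurable (\<I> \<Otimes>\<^sub>M \<mu>0)" by (rule motion_jointly_measurable[OF X])
  have fm: "fst \<in> borel_measurable (\<I> \<Otimes>\<^sub>M \<mu>0)"
    by (rule measurable_compose[OF measurable_fst identity_measurable])
  have vm: "(\<lambda>s. v (fst s) (X (fst s) (snd s))) \<in> borel_measurable (\<I> \<Otimes>\<^sub>M \<mu>0)"
  proof (rule caratheodory_measurable[where f="\<lambda>s. v (fst s)" and y="\<lambda>s. X (fst s) (snd s)", OF _ _ Xm])
    show "continuous_on UNIV (v (fst s))" if "s \<in> space (\<I> \<Otimes>\<^sub>M \<mu>0)" for s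
      using admissible_lip[OF adm, of "fst s"] that by (auto simp: space_pair_measure intro: lipschitz_on_continuous_on)
    show "(\<lambda>s. v (fst s) x) \<in> borel_measurable (\<I> \<Otimes>\<^sub>M \<mu>0)" for x
      using adm by (intro measurable_compose[OF measurable_fst]) (simp add: admissible_def)
  qed
  have hm: "case_prod h \<in> borel_measurable (\<I> \<Otimes>\<^sub>M \<mu>0)"
    unfolding h_def case_prod_beta'
    by (intro borel_measurable_inner measurable_compose[OF borel_measurable_Pair Dm] borel_measurable_Pair fm vm Xm) auto
  obtain C where C: "0 \<le> C" "\<And>z. norm (D z) \<le> C"
    using test_function_gradient_bounded[OF \<phi>] unfolding D_def by blast
  obtain g where g: "g \<in> L1_nonneg T" "\<And>t x. t \<in> {0..T} \<Longrightarrow> norm (v t (X t x)) \<le> g t * (1 + norm x)"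
    using admissible_velocity_bound[OF adm] by blast
  have hb: "norm (h t x) \<le> C * (1 + g t * (1 + norm x) powr p)" if t: "t \<in> {0..T}" for t x
  proof -
    have "norm (h t x) \<le> norm (D (t, X t x)) * norm (1::real, v t (X t x))"
      unfolding h_def by (simp add: Cauchy_Schwarz_ineq2)
    also have "\<dots> \<le> C * (1 + norm (v t (X t x)))"
      using C norm_Pair_le[of "1::real" "v t (X t x)"] by (intro mult_mono) auto
    also have "\<dots> \<le> C * (1 + g t * (1 + norm x) powr p)"
    proof (intro mult_left_mono add_left_mono C)
      have "(1 + norm x) powr 1 \<le> (1 + norm x) powr p" using p by (intro powr_mono) auto
      then have "g t * (1 + norm x) \<le> g t * (1 + norm x) powr p"
        using L1_D(2)[OF g(1) t] by (intro mult_left_mono) auto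
      then show "norm (v t (X t x)) \<le> g t * (1 + norm x) powr p" using g(2)[OF t, of x] by linarith
    qed
    finally show ?thesis .
  qed
  have int: "integrable (\<I> \<Otimes>\<^sub>M \<mu>0) (case_prod h)"
  proof (rule integrableI_bounded[OF hm])
    define w where "w = weight_norm p \<mu>0 powr p"
    have "(\<integral>\<^sup>+ s. ennreal (norm (case_prod h s)) \<partial>(\<I> \<Otimes>\<^sub>M \<mu>0)) = (\<integral>\<^sup>+ t. \<integral>\<^sup>+ x. ennreal (norm (h t x)) \<partial>\<mu>0 \<partial>\<I>)"
      using hm by (subst \<mu>.nn_integral_fst[symmetric]) auto
    also have "\<dots> \<le> (\<integral>\<^sup>+ t. \<integral>\<^sup>+ x. ennreal C + ennreal (C * g t) * ennreal ((1 + norm x) powr p) \<partial>\<mu>0 \<partial>\<I>)"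
    proof (intro nn_integral_mono)
      fix t x assume "t \<in> space \<I>"
      then have t: "t \<in> {0..T}" by simp
      have "ennreal (norm (h t x)) \<le> ennreal (C + C * g t * (1 + norm x) powr p)"
        using hb[OF t, of x] by (intro ennreal_leI) (simp add: algebra_simps)
      then show "ennreal (norm (h t x)) \<le> ennreal C + ennreal (C * g t) * ennreal ((1 + norm x) powr p)"
        using C(1) L1_D(2)[OF g(1) t] by (simp add: ennreal_mult[symmetric] ennreal_plus[symmetric] del: ennreal_plus)
    qed
    also have "\<dots> = (\<integral>\<^sup>+ t. ennreal C + ennreal (C * g t) * ennreal w \<partial>\<I>)"
    proof (rule nn_integral_cong)
      fix t
      have "(\<integral>\<^sup>+ x. ennreal C + ennreal (C * g t) * ennreal ((1 + norm x) powr p) \<partial>\<mu>0)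
          = (\<integral>\<^sup>+ x. ennreal C \<partial>\<mu>0) + (\<integral>\<^sup>+ x. ennreal (C * g t) * ennreal ((1 + norm x) powr p) \<partial>\<mu>0)"
        by (rule nn_integral_add) measurable
      also have "(\<integral>\<^sup>+ x. ennreal C \<partial>\<mu>0) = ennreal C" by (simp add: \<mu>.emeasure_space_1)
      also have "(\<integral>\<^sup>+ x. ennreal (C * g t) * ennreal ((1 + norm x) powr p) \<partial>\<mu>0)
          = ennreal (C * g t) * (\<integral>\<^sup>+ x. ennreal ((1 + norm x) powr p) \<partial>\<mu>0)"
        by (rule nn_integral_cmult) measurable
      also have "(\<integral>\<^sup>+ x. ennreal ((1 + norm x) powr p) \<partial>\<mu>0) = ennreal w"
        unfolding w_def by (rule nn_integral_weight[OF p \<mu>0])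
      finally show "(\<integral>\<^sup>+ x. ennreal C + ennreal (C * g t) * ennreal ((1 + norm x) powr p) \<partial>\<mu>0)
          = ennreal C + ennreal (C * g t) * ennreal w" .
    qed
    also have "\<dots> = (\<integral>\<^sup>+ t. ennreal (C + C * g t * w) \<partial>\<I>)"
      using C(1) L1_D(2)[OF g(1)] by (intro nn_integral_cong) (auto simp: ennreal_mult ennreal_plus w_def)
    also have "\<dots> < \<infinity>"
    proof -
      have gi: "integrable \<I> g" using g(1) by (simp add: L1_nonneg_def)
      have "integrable \<I> (\<lambda>t. C + (C * w) * g t)"
        by (rule Bochner_Integration.integrable_add[OF I.integrable_const Bochner_Integration.integrable_mult_right[OF gi]])
      then have i: "integrable \<I> (\<lambda>t. C + C * g t * w)" by (simp add: mult_ac)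
      have "AE t in \<I>. 0 \<le> C + C * g t * w"
        using C(1) L1_D(2)[OF g(1)] by (intro AE_I2) (auto simp: w_def)
      then show ?thesis by (simp add: nn_integral_eq_integral[OF i])
    qed
    finally show "(\<integral>\<^sup>+ s. ennreal (norm (case_prod h s)) \<partial>(\<I> \<Otimes>\<^sub>M \<mu>0)) < \<infinity>" .
  qed
  have "(\<integral>t. (\<integral>x. h t x \<partial>\<mu>0) \<partial>\<I>) = (\<integral>x. (\<integral>t. h t x \<partial>\<I>) \<partial>\<mu>0)"
    by (rule P.Fubini_integral[OF int, symmetric])
  also have "\<dots> = (\<integral>x. 0 \<partial>\<mu>0)"
  proof (rule Bochner_Integration.integral_cong[OF refl])
    fix x
    have "(\<lambda>t. h t x) absolutely_integrable_on {0..T}" "integral {0..T} (\<lambda>t. h t x) = 0"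
      using path_test_function_integral[OF adm pic \<phi>] unfolding h_def D_def by blast+
    then show "(\<integral>t. h t x \<partial>\<I>) = 0"
      by (subst lebesgue_integral_eq_integral) (auto simp: integrable_lebesgue_on_iff)
  qed
  finally have zero: "(\<integral>t. (\<integral>x. h t x \<partial>\<mu>0) \<partial>\<I>) = 0" by simp
  have "has_bochner_integral \<I> (\<lambda>t. \<integral>x. h t x \<partial>\<mu>0) 0"
    using P.integrable_fst'[OF int] zero by (simp add: has_bochner_integral_iff)
  moreover have "(\<integral>x. deriv (\<lambda>s. \<phi> (s, x)) t + grad (\<lambda>y. \<phi> (t, y)) x \<bullet> v t x \<partial>law X t) = (\<integral>x. h t x \<partial>\<mu>0)"
    if "t \<in> space \<I>" for t
  proof -
    have t: "t \<in> {0..T}" using that by simp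
    have Xt: "X t \<in> borel_measurable \<mu>0" using motion_measurable[OF X t] by measurable
    have "continuous_on UNIV (v t)" using admissible_lip[OF adm t] by (rule lipschitz_on_continuous_on)
    then have "continuous_on UNIV (\<lambda>x. D (t, x) \<bullet> (1, v t x))"
      by (intro continuous_intros continuous_on_compose2[OF D]) auto
    then have cm: "(\<lambda>x. D (t, x) \<bullet> (1, v t x)) \<in> borel_measurable borel" by (rule borel_measurable_continuous_onI)
    have "deriv (\<lambda>s. \<phi> (s, x)) t + grad (\<lambda>y. \<phi> (t, y)) x \<bullet> v t x = D (t, x) \<bullet> (1, v t x)" for x
      by (simp add: test_function_time_derivative[OF \<phi>] test_function_space_gradient[OF \<phi>] D_def inner_prod_def)
    then show ?thesis unfolding law_def h_def using integral_distr[OF Xt cm] by simp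
  qed
  ultimately show "has_bochner_integral \<I>
     (\<lambda>t. \<integral>x. deriv (\<lambda>s. \<phi> (s, x)) t + grad (\<lambda>y. \<phi> (t, y)) x \<bullet> v t x \<partial>law X t) 0"
    by (subst has_bochner_integral_cong[OF refl _ refl]) auto
qed

lemma law_AC_curve:
  assumes X: "motion X"
  shows "law X \<in> AC_curves p T"
proof -
  obtain g where g: "g \<in> L1_nonneg T"
    and W: "\<And>s t. 0 \<le> s \<Longrightarrow> s \<le> t \<Longrightarrow> t \<le> T \<Longrightarrow> Wp p (law X s) (law X t) \<le> ennreal (integral {s..t} g)"
    using Wp_law_increment[OF X] by blast
  have "Wp p (law X s) (law X t) \<le> ennreal (\<integral>r. g r \<partial>lebesgue_on {s..t})" if "0 \<le> s" "s \<le> t" "t \<le> T" for s t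
    using W[OF that] absolutely_integrable_subinterval_real[OF L1_D(1)[OF g] that(1,3)]
    by (subst lebesgue_integral_eq_integral) (auto simp: integrable_lebesgue_on_iff)
  then show ?thesis using g law_Pp[OF X] unfolding AC_curves_def by blast
qed

lemma law_solution:
  assumes adm: "admissible X v" and pic: "\<And>t x. t \<in> {0..T} \<Longrightarrow> X t x = picard X v t x"
  shows "law X \<in> AC_curves p T" "law X \<tau> = \<mu>0" "field_measurable T v"
    "\<forall>t\<in>{0..T}. v t \<in> V t (law X t)" "continuity_equation T v (law X)"
proof -
  have X: "motion X" using adm by (simp add: admissible_def)
  show "law X \<in> AC_curves p T" by (rule law_AC_curve[OF X])
  have "X \<tau> = (\<lambda>x. x)" using X by (auto simp: motion_def)
  then show "law X \<tau> = \<mu>0" using law_start[of \<tau>] by (simp add: law_def)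
  show "field_measurable T v"
    using admissible_lip[OF adm] L1_D(3)[OF l] adm by (intro field_measurable_of_evaluations) (auto simp: admissible_def)
  show "\<forall>t\<in>{0..T}. v t \<in> V t (law X t)" using adm by (simp add: admissible_def)
  show "continuity_equation T v (law X)" by (rule law_continuity_equation[OF adm pic])
qed

end

section \<open>Initial velocities at good times\<close>

text \<open>Exchanging the two components of a coupling preserves its cost.\<close>

lemma Wp_commute_le:
  fixes \<mu> \<nu> :: "'a::euclidean_space measure"
  shows "Wp p \<nu> \<mu> \<le> Wp p \<mu> \<nu>"
proof -
  let ?c = "\<lambda>\<mu> \<nu> :: 'a measure. INF \<gamma>\<in>couplings \<mu> \<nu>. \<integral>\<^sup>+ (x, y). ennreal (norm (x - y) powr p) \<partial>\<gamma>"
  have "?c b a \<le> ?c a b" for a b :: "'a measure"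
  proof (rule INF_greatest)
    fix \<gamma> assume \<gamma>: "\<gamma> \<in> couplings a b"
    have s[measurable_cong]: "sets \<gamma> = sets borel" using \<gamma> by (simp add: couplings_def)
    have ps: "prob_space \<gamma>" using \<gamma> by (simp add: couplings_def)
    have sw: "(prod.swap :: 'a \<times> 'a \<Rightarrow> 'a \<times> 'a) \<in> borel_measurable borel"
      unfolding prod.swap_def by (intro borel_measurable_continuous_onI continuous_intros)
    then have sw': "prod.swap \<in> borel_measurable \<gamma>" by (simp add: measurable_cong_sets[OF s refl])
    have fs: "fst \<in> borel_measurable (borel :: ('a \<times> 'a) measure)"
      "snd \<in> borel_measurable (borel :: ('a \<times> 'a) measure)"
      by (intro borel_measurable_continuous_onI continuous_intros)+
    have "distr \<gamma> borel prod.swap \<in> couplings b a"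
      using \<gamma> distr_distr[OF fs(1) sw'] distr_distr[OF fs(2) sw'] prob_space.prob_space_distr[OF ps sw']
      by (simp add: couplings_def o_def)
    moreover have "(\<integral>\<^sup>+ (x, y). ennreal (norm (x - y) powr p) \<partial>distr \<gamma> borel prod.swap)
        = (\<integral>\<^sup>+ (x, y). ennreal (norm (x - y) powr p) \<partial>\<gamma>)"
    proof -
      have "(\<lambda>z. ennreal (norm (fst z - snd z) powr p)) \<in> borel_measurable (borel :: ('a \<times> 'a) measure)"
        using fs by measurable
      then show ?thesis using nn_integral_distr[OF sw'] by (simp add: case_prod_beta' norm_minus_commute)
    qed
    ultimately show "?c b a \<le> (\<integral>\<^sup>+ (x, y). ennreal (norm (x - y) powr p) \<partial>\<gamma>)"
      by (metis (no_types, lifting) INF_lower)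
  qed
  then have "?c \<nu> \<mu> = ?c \<mu> \<nu>" by (intro antisym) auto
  then show ?thesis by (simp add: Wp_def)
qed

lemma Wp_self:
  assumes p: "1 \<le> p" and \<mu>: "\<mu> \<in> Pp p"
  shows "Wp p \<mu> \<mu> \<le> ennreal 0"
proof -
  have "distr \<mu> borel (\<lambda>x. x) = \<mu>" using \<mu> by (simp add: Pp_def distr_id2)
  then show ?thesis using Wp_distr_le_weight[OF p \<mu>, of "\<lambda>x. x" "\<lambda>x. x" 0] by simp
qed

text \<open>The upper right derivative at \<open>\<tau>\<close> of the integral of \<open>f\<close> is at most \<open>c\<close>. Linear
  combinations with nonnegative coefficients inherit such bounds, so that a single null set serves
  all bounds built from countably many functions.\<close>

definition upper_mean :: "real \<Rightarrow> (real \<Rightarrow> real) \<Rightarrow> real \<Rightarrow> real \<Rightarrow> bool" where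
  "upper_mean T f \<tau> c \<longleftrightarrow> (\<forall>e>0. \<exists>h0>0. \<tau> + h0 \<le> T \<and> (\<forall>h\<in>{0..h0}. integral {\<tau>..\<tau>+h} f \<le> (c + e) * h))"

lemma upper_mean_add:
  assumes f: "f absolutely_integrable_on {0..T}" and g: "g absolutely_integrable_on {0..T}" and \<tau>: "0 \<le> \<tau>"
    and uf: "upper_mean T f \<tau> c" and ug: "upper_mean T g \<tau> d"
  shows "upper_mean T (\<lambda>t. f t + g t) \<tau> (c + d)"
  unfolding upper_mean_def
proof (intro allI impI)
  fix e :: real assume e: "0 < e"
  obtain h1 where h1: "h1 > 0" "\<tau> + h1 \<le> T" "\<And>h. h \<in> {0..h1} \<Longrightarrow> integral {\<tau>..\<tau>+h} f \<le> (c + e / 2) * h"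
    using uf e unfolding upper_mean_def by (meson half_gt_zero)
  obtain h2 where h2: "h2 > 0" "\<tau> + h2 \<le> T" "\<And>h. h \<in> {0..h2} \<Longrightarrow> integral {\<tau>..\<tau>+h} g \<le> (d + e / 2) * h"
    using ug e unfolding upper_mean_def by (meson half_gt_zero)
  show "\<exists>h0>0. \<tau> + h0 \<le> T \<and> (\<forall>h\<in>{0..h0}. integral {\<tau>..\<tau>+h} (\<lambda>t. f t + g t) \<le> (c + d + e) * h)"
  proof (intro exI[of _ "min h1 h2"] conjI ballI)
    fix h assume h: "h \<in> {0..min h1 h2}"
    have "f absolutely_integrable_on {\<tau>..\<tau>+h}" "g absolutely_integrable_on {\<tau>..\<tau>+h}"
      using h h1 \<tau> by (auto intro!: absolutely_integrable_subinterval_real[OF f] absolutely_integrable_subinterval_real[OF g])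
    then have "integral {\<tau>..\<tau>+h} (\<lambda>t. f t + g t) = integral {\<tau>..\<tau>+h} f + integral {\<tau>..\<tau>+h} g"
      by (intro Henstock_Kurzweil_Integration.integral_add) (auto simp: absolutely_integrable_on_def)
    also have "\<dots> \<le> (c + e / 2) * h + (d + e / 2) * h" using h h1(3)[of h] h2(3)[of h] by (intro add_mono) auto
    finally show "integral {\<tau>..\<tau>+h} (\<lambda>t. f t + g t) \<le> (c + d + e) * h" by (simp add: algebra_simps)
  qed (use h1 h2 in auto)
qed

lemma upper_mean_cmult:
  assumes a: "0 \<le> a" and uf: "upper_mean T f \<tau> c"
  shows "upper_mean T (\<lambda>t. a * f t) \<tau> (a * c)"
  unfolding upper_mean_def
proof (intro allI impI)
  fix e :: real assume e: "0 < e"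
  then have "0 < e / (a + 1)" using a by simp
  then obtain h1 where h1: "h1 > 0" "\<tau> + h1 \<le> T" "\<And>h. h \<in> {0..h1} \<Longrightarrow> integral {\<tau>..\<tau>+h} f \<le> (c + e / (a + 1)) * h"
    using uf unfolding upper_mean_def by blast
  have ae: "a * (e / (a + 1)) \<le> e" using a e by (simp add: field_simps)
  show "\<exists>h0>0. \<tau> + h0 \<le> T \<and> (\<forall>h\<in>{0..h0}. integral {\<tau>..\<tau>+h} (\<lambda>t. a * f t) \<le> (a * c + e) * h)"
  proof (intro exI[of _ h1] conjI ballI)
    fix h assume h: "h \<in> {0..h1}"
    have "integral {\<tau>..\<tau>+h} (\<lambda>t. a * f t) = a * integral {\<tau>..\<tau>+h} f" by simp
    also have "\<dots> \<le> a * ((c + e / (a + 1)) * h)" using a h1(3)[OF h] by (intro mult_left_mono)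
    also have "\<dots> = (a * c + a * (e / (a + 1))) * h" by (simp add: algebra_simps)
    also have "\<dots> \<le> (a * c + e) * h" using ae h by (intro mult_right_mono) auto
    finally show "integral {\<tau>..\<tau>+h} (\<lambda>t. a * f t) \<le> (a * c + e) * h" .
  qed (use h1 in auto)
qed

lemma upper_mean_const:
  assumes "\<tau> < T"
  shows "upper_mean T (\<lambda>t. c) \<tau> c"
  unfolding upper_mean_def
  by (intro allI impI exI[of _ "T - \<tau>"]) (use assms in \<open>auto simp: mult.commute algebra_simps\<close>)

lemma absolutely_integrable_const_real: "(\<lambda>t. c :: real) absolutely_integrable_on {a..b::real}"
  by (simp flip: integrable_lebesgue_on_iff)

context lipschitz_inclusion begin

text \<open>The smallest total deviation of a field in \<open>V t \<nu>\<close> from prescribed values \<open>z\<close> at the first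
  sampling points. For \<open>z\<close> and \<open>\<nu>\<close> in countable dense sets these are countably many integrable
  functions of time, and the times at which their means to the right do not exceed their values in the
  limit are good for all measures and all velocities simultaneously.\<close>

definition deviation :: "nat \<Rightarrow> (nat \<Rightarrow> 'a) \<Rightarrow> 'a measure \<Rightarrow> real \<Rightarrow> real" where
  "deviation n z \<nu> t = Inf ((\<lambda>u. \<Sum>i\<le>n. norm (u i - z i)) ` sample ` V t \<nu>)"

lemma continuous_deviation: "continuous_on UNIV (\<lambda>u :: nat \<Rightarrow> 'a. \<Sum>i\<le>n. norm (u i - z i))"
  by (intro continuous_intros continuous_on_product_coordinates)

lemma deviation_attained:
  assumes "t \<in> {0..T}" "\<nu> \<in> Pp p"
  shows "\<exists>w\<in>V t \<nu>. (\<Sum>i\<le>n. norm (w (dense_seq i) - z i)) = deviation n z \<nu> t \<and>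
    (\<forall>w'\<in>V t \<nu>. deviation n z \<nu> t \<le> (\<Sum>i\<le>n. norm (w' (dense_seq i) - z i)))"
proof -
  have "sample ` V t \<nu> \<noteq> {}" using V_nonempty[OF assms] by blast
  from compact_attains_Inf[OF compact_sample_V[OF assms] this continuous_deviation[where n=n and z=z]]
  obtain u where u: "u \<in> sample ` V t \<nu>" "(\<Sum>i\<le>n. norm (u i - z i)) = deviation n z \<nu> t"
    "\<And>u'. u' \<in> sample ` V t \<nu> \<Longrightarrow> (\<Sum>i\<le>n. norm (u i - z i)) \<le> (\<Sum>i\<le>n. norm (u' i - z i))"
    unfolding deviation_def by blast
  then obtain w where w: "w \<in> V t \<nu>" "u = sample w" by blast
  have "(\<Sum>i\<le>n. norm (w (dense_seq i) - z i)) = deviation n z \<nu> t"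
    using u(2) w(2) by (simp add: sample_def)
  moreover have "deviation n z \<nu> t \<le> (\<Sum>i\<le>n. norm (w' (dense_seq i) - z i))" if "w' \<in> V t \<nu>" for w'
    using u(3)[of "sample w'"] u(2) that by (simp add: sample_def)
  ultimately show ?thesis using w(1) by blast
qed

lemma deviation_nonneg: "t \<in> {0..T} \<Longrightarrow> \<nu> \<in> Pp p \<Longrightarrow> 0 \<le> deviation n z \<nu> t"
  using deviation_attained[where n=n and z=z, of t \<nu>] by (metis norm_ge_zero sum_nonneg)

lemma deviation_integrable:
  assumes \<nu>: "\<nu> \<in> Pp p"
  shows "deviation n z \<nu> absolutely_integrable_on {0..T}"
proof (rule absolutely_integrable_bound)
  show "deviation n z \<nu> \<in> borel_measurable \<I>"
    unfolding deviation_def[abs_def]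
    using compact_sample_V[OF _ \<nu>] V_nonempty[OF _ \<nu>]
    by (intro measurable_Inf_weakly_measurable weakly_measurable_sample_V[OF \<nu>] continuous_deviation) auto
  let ?c = "\<Sum>i\<le>n. 1 + norm (dense_seq i :: 'a) + moment p \<nu>" and ?d = "\<Sum>i\<le>n. norm (z i)"
  show "(\<lambda>t. ?c * m t + ?d) absolutely_integrable_on {0..T}"
    by (intro set_integral_add(1) set_integrable_mult_right L1_D(1)[OF m] absolutely_integrable_const_real)
  fix t assume t: "t \<in> {0..T}"
  obtain w where w: "w \<in> V t \<nu>" using V_nonempty[OF t \<nu>] by blast
  have "deviation n z \<nu> t \<le> (\<Sum>i\<le>n. norm (w (dense_seq i) - z i))" using deviation_attained[OF t \<nu>] w by blast
  also have "\<dots> \<le> (\<Sum>i\<le>n. (1 + norm (dense_seq i :: 'a) + moment p \<nu>) * m t + norm (z i))"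
  proof (rule sum_mono)
    fix i
    show "norm (w (dense_seq i) - z i) \<le> (1 + norm (dense_seq i :: 'a) + moment p \<nu>) * m t + norm (z i)"
      using V_growth[OF t \<nu> w, of "dense_seq i"] norm_triangle_ineq4[of "w (dense_seq i)" "z i"] by (simp add: mult.commute)
  qed
  also have "\<dots> = ?c * m t + ?d" by (subst sum.distrib) (simp only: sum_distrib_right)
  finally show "norm (deviation n z \<nu> t) \<le> ?c * m t + ?d" using deviation_nonneg[OF t \<nu>] by simp
qed

definition countably_good :: "'a measure set \<Rightarrow> (nat \<Rightarrow> 'a) set \<Rightarrow> real \<Rightarrow> bool" where
  "countably_good DP DZ \<tau> \<longleftrightarrow> upper_mean T m \<tau> (m \<tau>) \<and> upper_mean T l \<tau> (l \<tau>) \<and> upper_mean T L \<tau> (L \<tau>) \<and>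
     (\<forall>n. \<forall>z\<in>DZ. \<forall>\<nu>\<in>DP. upper_mean T (deviation n z \<nu>) \<tau> (deviation n z \<nu> \<tau>))"

lemma countably_good_ae:
  assumes DP: "countable DP" "DP \<subseteq> Pp p" and DZ: "countable DZ"
  shows "\<exists>Z. negligible Z \<and> (\<forall>\<tau>\<in>{0<..<T} - Z. countably_good DP DZ \<tau>)"
proof -
  define F where "F = {m, l, L} \<union> (\<lambda>(n, z, \<nu>). deviation n z \<nu>) ` (UNIV \<times> DZ \<times> DP)"
  have cF: "countable F" unfolding F_def using DP(1) DZ by (intro countable_Un countable_image countable_SIGMA) auto
  have "\<exists>Z. negligible Z \<and> (\<forall>\<tau>\<in>{0<..<T} - Z. upper_mean T f \<tau> (f \<tau>))" if f: "f \<in> F" for f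
  proof -
    consider "f = m" | "f = l" | "f = L" | n z \<nu> where "\<nu> \<in> DP" "f = deviation n z \<nu>"
      using f by (auto simp: F_def)
    then have "f absolutely_integrable_on {0..T} \<and> (\<forall>t\<in>{0..T}. 0 \<le> f t)"
    proof cases
      case (4 n z \<nu>)
      then have "\<nu> \<in> Pp p" using DP(2) by blast
      then show ?thesis using deviation_integrable deviation_nonneg 4(2) by blast
    qed (use L1_D(1,2)[OF m] L1_D(1,2)[OF l] L1_D(1,2)[OF L] in blast)+
    then show ?thesis using integral_upper_derivative_ae[where f=f and a=0 and b=T] unfolding upper_mean_def by blast
  qed
  then obtain Z where Z: "\<And>f. f \<in> F \<Longrightarrow> negligible (Z f)"
    "\<And>f \<tau>. f \<in> F \<Longrightarrow> \<tau> \<in> {0<..<T} - Z f \<Longrightarrow> upper_mean T f \<tau> (f \<tau>)" by metis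
  have "negligible (\<Union>(Z ` F))" using cF Z(1) by (intro negligible_countable_Union) auto
  moreover have "countably_good DP DZ \<tau>" if \<tau>: "\<tau> \<in> {0<..<T} - \<Union>(Z ` F)" for \<tau>
  proof -
    have "upper_mean T f \<tau> (f \<tau>)" if "f \<in> F" for f using Z(2)[OF that] \<tau> that by blast
    moreover have "m \<in> F" "l \<in> F" "L \<in> F" by (simp_all add: F_def)
    moreover have "deviation n z \<nu> \<in> F" if "z \<in> DZ" "\<nu> \<in> DP" for n z \<nu>
      unfolding F_def using that by (intro UnI2 image_eqI[where x="(n, z, \<nu>)"]) auto
    ultimately show ?thesis unfolding countably_good_def by blast
  qed
  ultimately show ?thesis by blast
qed

text \<open>A selection along the constant curve \<open>\<mu>\<close> whose mean distance to \<open>w\<close> on short intervals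
  after \<open>\<tau>\<close>, uniformly on a ball, is as small as desired. Take \<open>z\<close> close to the sampled \<open>w\<close> and \<open>\<nu>\<close>
  close to \<open>\<mu>\<close>: moving \<open>w\<close> into \<open>V \<tau> \<nu>\<close> shows that the deviation is small at the time \<open>\<tau>\<close>, hence in
  the mean afterwards as \<open>\<tau>\<close> is a good time, and moving the minimisers back into \<open>V t \<mu>\<close> costs only
  another multiple of \<open>L t\<close>. A fine net and the Lipschitz constants pass from the sampling points to
  the ball.\<close>

lemma initial_selection:
  assumes DP: "DP \<subseteq> Pp p" "\<And>\<mu> e. \<mu> \<in> Pp p \<Longrightarrow> 0 < e \<Longrightarrow> \<exists>\<nu>\<in>DP. Wp p \<mu> \<nu> \<le> ennreal e"
    and DZ: "\<And>X. open X \<Longrightarrow> X \<noteq> {} \<Longrightarrow> \<exists>z\<in>DZ. z \<in> X"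
    and \<tau>: "0 < \<tau>" "\<tau> < T" and good: "countably_good DP DZ \<tau>"
    and \<mu>: "\<mu> \<in> Pp p" and w: "w \<in> V \<tau> \<mu>" and \<rho>: "0 < \<rho>"
  shows "\<exists>v0 r. (\<forall>t\<in>{0..T}. v0 t \<in> V t \<mu>) \<and> (\<forall>x. (\<lambda>t. v0 t x) \<in> borel_measurable \<I>) \<and>
     r absolutely_integrable_on {0..T} \<and> (\<exists>c<\<rho>. upper_mean T r \<tau> c) \<and>
     (\<forall>t\<in>{0..T}. \<forall>x. norm x \<le> R \<longrightarrow> norm (v0 t x - w x) \<le> r t)"
proof -
  have \<tau>I: "\<tau> \<in> {0..T}" using \<tau> by simp
  have l0: "0 \<le> l \<tau>" and L0: "0 \<le> L \<tau>" using L1_D(2)[OF l \<tau>I] L1_D(2)[OF L \<tau>I] .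
  define \<eta> where "\<eta> = \<rho> / (4 * (2 + 2 * l \<tau>))"
  have \<eta>: "0 < \<eta>" "(2 + 2 * l \<tau>) * \<eta> = \<rho> / 4" using \<rho> l0 by (auto simp: \<eta>_def field_simps)
  obtain n where n: "\<And>x::'a. norm x \<le> R \<Longrightarrow> \<exists>i\<le>n. dist x (dense_seq i) < \<eta>"
    using dense_seq_net[OF \<eta>(1)] by blast
  define \<eta>' where "\<eta>' = \<rho> / (4 * (real n + 2) * (L \<tau> + 1))"
  have \<eta>': "0 < \<eta>'" using \<rho> L0 by (simp add: \<eta>'_def)
  have \<eta>'L: "(real n + 2) * L \<tau> * \<eta>' \<le> \<rho> / 4"
  proof -
    have "(real n + 2) * L \<tau> * \<eta>' \<le> (real n + 2) * (L \<tau> + 1) * \<eta>'" using \<eta>' by (intro mult_right_mono mult_left_mono) auto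
    also have "\<dots> = \<rho> / 4"
    proof -
      define q where "q = (real n + 2) * (L \<tau> + 1)"
      have "q \<noteq> 0" using L0 by (simp add: q_def)
      moreover have "\<eta>' = \<rho> / (4 * q)" by (simp add: \<eta>'_def q_def mult.assoc)
      ultimately show ?thesis unfolding q_def[symmetric] by simp
    qed
    finally show ?thesis .
  qed
  obtain z where z: "z \<in> DZ" "(\<Sum>i\<le>n. norm (z i - w (dense_seq i))) < \<eta>"
  proof -
    have "open {z :: nat \<Rightarrow> 'a. (\<Sum>i\<le>n. norm (z i - w (dense_seq i))) < \<eta>}"
      by (intro open_Collect_less continuous_deviation[where n=n and z="\<lambda>i. w (dense_seq i)"] continuous_on_const)
    moreover have "sample w \<in> {z :: nat \<Rightarrow> 'a. (\<Sum>i\<le>n. norm (z i - w (dense_seq i))) < \<eta>}" using \<eta> by (simp add: sample_def)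
    ultimately show ?thesis using DZ that by blast
  qed
  have zi: "norm (z i - w (dense_seq i)) \<le> \<eta>" if "i \<le> n" for i
  proof -
    have "norm (z i - w (dense_seq i)) \<le> (\<Sum>i\<le>n. norm (z i - w (dense_seq i)))"
      using that by (intro member_le_sum) auto
    then show ?thesis using z(2) by simp
  qed
  obtain \<nu> where \<nu>: "\<nu> \<in> DP" "Wp p \<mu> \<nu> \<le> ennreal \<eta>'" using DP(2)[OF \<mu> \<eta>'] by blast
  have \<nu>P: "\<nu> \<in> Pp p" using \<nu>(1) DP(1) by blast
  have W': "Wp p \<nu> \<mu> \<le> ennreal \<eta>'" using Wp_commute_le \<nu>(2) order_trans by blast
  define \<Phi> where "\<Phi> = deviation n z \<nu>"
  have \<Phi>i: "\<Phi> absolutely_integrable_on {0..T}" unfolding \<Phi>_def by (rule deviation_integrable[OF \<nu>P])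
  have \<Phi>\<tau>: "\<Phi> \<tau> \<le> (real n + 1) * (L \<tau> * \<eta>') + \<eta>"
  proof -
    obtain u where u: "u \<in> V \<tau> \<nu>" "\<And>x. norm (w x - u x) \<le> L \<tau> * \<eta>'"
      using V_move[OF \<tau>I \<mu> \<nu>P w \<nu>(2)] \<eta>' by auto
    have "\<Phi> \<tau> \<le> (\<Sum>i\<le>n. norm (u (dense_seq i) - z i))"
      using deviation_attained[OF \<tau>I \<nu>P, where n=n and z=z] u(1) unfolding \<Phi>_def by blast
    also have "\<dots> \<le> (\<Sum>i\<le>n. L \<tau> * \<eta>' + norm (z i - w (dense_seq i)))"
    proof (rule sum_mono)
      fix i
      have "norm (u (dense_seq i) - z i) \<le> norm (w (dense_seq i) - u (dense_seq i)) + norm (z i - w (dense_seq i))"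
        using norm_triangle_ineq4[of "u (dense_seq i) - w (dense_seq i)" "z i - w (dense_seq i)"]
        by (simp add: norm_minus_commute[of "u (dense_seq i)" "w (dense_seq i)"])
      then show "norm (u (dense_seq i) - z i) \<le> L \<tau> * \<eta>' + norm (z i - w (dense_seq i))"
        using u(2)[of "dense_seq i"] by linarith
    qed
    also have "\<dots> = (real n + 1) * (L \<tau> * \<eta>') + (\<Sum>i\<le>n. norm (z i - w (dense_seq i)))"
      by (simp add: sum.distrib)
    finally show ?thesis using z(2) by simp
  qed
  define r0 where "r0 = (\<lambda>t. \<Phi> t + (\<eta>' * L t + \<eta>))"
  define r where "r = (\<lambda>t. r0 t + (\<eta> * l t + \<eta> * l \<tau>))"
  have r0i: "r0 absolutely_integrable_on {0..T}" unfolding r0_def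
    by (intro set_integral_add(1) set_integrable_mult_right \<Phi>i L1_D(1)[OF L] absolutely_integrable_const_real)
  have r1i: "(\<lambda>t. \<eta> * l t + \<eta> * l \<tau>) absolutely_integrable_on {0..T}"
    by (intro set_integral_add(1) set_integrable_mult_right L1_D(1)[OF l] absolutely_integrable_const_real)
  have ri: "r absolutely_integrable_on {0..T}" unfolding r_def by (intro set_integral_add(1) r0i r1i)
  have um: "upper_mean T r \<tau> (\<Phi> \<tau> + (\<eta>' * L \<tau> + \<eta>) + (\<eta> * l \<tau> + \<eta> * l \<tau>))"
    unfolding r_def r0_def
    using good z(1) \<nu>(1) \<tau> \<eta> \<eta>'
    by (intro upper_mean_add upper_mean_cmult upper_mean_const r1i[unfolded r_def] r0i[unfolded r0_def] \<Phi>i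
        set_integral_add(1) set_integrable_mult_right L1_D(1)[OF L] L1_D(1)[OF l] absolutely_integrable_const_real)
      (auto simp: countably_good_def \<Phi>_def)
  have small: "\<Phi> \<tau> + (\<eta>' * L \<tau> + \<eta>) + (\<eta> * l \<tau> + \<eta> * l \<tau>) < \<rho>"
  proof -
    have "\<Phi> \<tau> + (\<eta>' * L \<tau> + \<eta>) + (\<eta> * l \<tau> + \<eta> * l \<tau>) \<le> (real n + 2) * L \<tau> * \<eta>' + (2 + 2 * l \<tau>) * \<eta>"
      using \<Phi>\<tau> by (simp add: algebra_simps)
    then show ?thesis using \<eta>'L \<eta>(2) \<rho> by linarith
  qed
  have ex: "\<exists>w'\<in>V t \<mu>. \<forall>i\<in>{..n}. norm (w' (dense_seq i) - w (dense_seq i)) \<le> r0 t" if t: "t \<in> {0..T}" for t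
  proof -
    obtain u where u: "u \<in> V t \<nu>" "(\<Sum>i\<le>n. norm (u (dense_seq i) - z i)) = \<Phi> t"
      using deviation_attained[OF t \<nu>P, where n=n and z=z] unfolding \<Phi>_def by blast
    obtain w' where w': "w' \<in> V t \<mu>" "\<And>x. norm (u x - w' x) \<le> L t * \<eta>'"
      using V_move[OF t \<nu>P \<mu> u(1) W'] \<eta>' by auto
    have "norm (w' (dense_seq i) - w (dense_seq i)) \<le> r0 t" if i: "i \<le> n" for i
    proof -
      have "norm (u (dense_seq i) - z i) \<le> \<Phi> t" unfolding u(2)[symmetric] using i by (intro member_le_sum) auto
      moreover have "norm (w' (dense_seq i) - w (dense_seq i))
          \<le> norm (u (dense_seq i) - w' (dense_seq i)) + norm (u (dense_seq i) - z i) + norm (z i - w (dense_seq i))"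
        using norm_triangle_ineq[of "w' (dense_seq i) - z i" "z i - w (dense_seq i)"]
          norm_triangle_ineq[of "w' (dense_seq i) - u (dense_seq i)" "u (dense_seq i) - z i"]
        by (simp add: norm_minus_commute[of "w' (dense_seq i)" "u (dense_seq i)"])
      ultimately show ?thesis using w'(2)[of "dense_seq i"] zi[OF i] by (simp add: r0_def mult.commute)
    qed
    then show ?thesis using w'(1) by blast
  qed
  have r0m: "r0 \<in> borel_measurable \<I>"
    using r0i unfolding integrable_lebesgue_on_iff[symmetric] by (rule borel_measurable_integrable)
  have "\<exists>v0. (\<forall>t\<in>{0..T}. v0 t \<in> V t \<mu> \<and> (\<forall>i\<in>{..n}. norm (v0 t (dense_seq i) - w (dense_seq i)) \<le> r0 t))
     \<and> (\<forall>x. (\<lambda>t. v0 t x) \<in> borel_measurable \<I>)"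
    by (rule selection_along_curve[where \<mu>="\<lambda>t. \<mu>" and A="\<lambda>t. 0" and y="\<lambda>t. w" and J="{..n}" and r=r0, OF \<mu> _ _ _ r0m ex])
      (use Wp_self[OF p \<mu>] in auto)
  then obtain v0 where v0': "\<forall>t\<in>{0..T}. v0 t \<in> V t \<mu> \<and> (\<forall>i\<in>{..n}. norm (v0 t (dense_seq i) - w (dense_seq i)) \<le> r0 t)"
     and v0m: "\<forall>x. (\<lambda>t. v0 t x) \<in> borel_measurable \<I>" by blast
  have v0: "v0 t \<in> V t \<mu>" "i \<le> n \<Longrightarrow> norm (v0 t (dense_seq i) - w (dense_seq i)) \<le> r0 t" if "t \<in> {0..T}" for t i
    using v0' that by auto
  have "norm (v0 t x - w x) \<le> r t" if t: "t \<in> {0..T}" and x: "norm x \<le> R" for t x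
  proof -
    obtain i where i: "i \<le> n" "dist x (dense_seq i) < \<eta>" using n[OF x] by blast
    have "norm (v0 t x - w x) \<le> norm (v0 t (dense_seq i) - w (dense_seq i)) + (l t + l \<tau>) * \<eta>"
      by (rule lipschitz_diff_near[OF V_lip[OF t \<mu> v0(1)[OF t]] V_lip[OF \<tau>I \<mu> w] less_imp_le[OF i(2)]])
    moreover have "(l t + l \<tau>) * \<eta> = \<eta> * l t + \<eta> * l \<tau>" by (simp add: algebra_simps)
    ultimately show ?thesis using v0(2)[OF t i(1)] unfolding r_def by linarith
  qed
  then show ?thesis using v0(1) v0m ri um small by blast
qed

end

section \<open>Solutions with prescribed initial velocity\<close>

context lipschitz_inclusion begin

text \<open>The displacement error at time \<open>\<tau> + h\<close> is the integral of the difference between the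
  velocity and \<open>w\<close>. Where \<open>\<bar>x\<bar> \<le> R\<close> it is at most \<open>\<epsilon> / 2 * h\<close>, by the choice of \<open>v0\<close> and the
  closeness of the solution to \<open>v0\<close>; elsewhere it is at most \<open>3 * k1 * h * (1 + \<bar>x\<bar>)\<close>, and \<open>R\<close> is
  chosen so that \<open>\<mu>\<close> has a small moment there. Since \<open>k1\<close> depends only on \<open>\<tau>\<close> and \<open>\<mu>\<close>, the radius can be
  fixed before \<open>v0\<close>.\<close>

lemma solution_with_initial_velocity:
  assumes DP: "DP \<subseteq> Pp p" "\<And>\<mu> e. \<mu> \<in> Pp p \<Longrightarrow> 0 < e \<Longrightarrow> \<exists>\<nu>\<in>DP. Wp p \<mu> \<nu> \<le> ennreal e"
    and DZ: "\<And>X. open X \<Longrightarrow> X \<noteq> {} \<Longrightarrow> \<exists>z\<in>DZ. z \<in> X"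
    and \<tau>: "0 < \<tau>" "\<tau> < T" and good: "countably_good DP DZ \<tau>"
    and \<mu>: "\<mu> \<in> Pp p" and w: "w \<in> V \<tau> \<mu>" and \<epsilon>: "0 < \<epsilon>"
  shows "\<exists>h0>0. \<tau> + h0 \<le> T \<and> (\<exists>\<mu>c v. \<mu>c \<in> AC_curves p T \<and> \<mu>c \<tau> = \<mu> \<and> field_measurable T v \<and>
     (\<forall>t\<in>{0..T}. v t \<in> V t (\<mu>c t)) \<and> continuity_equation T v \<mu>c \<and>
     (\<forall>h\<in>{0..h0}. Wp p (\<mu>c (\<tau> + h)) (distr \<mu> borel (\<lambda>x. x + h *\<^sub>R w x)) \<le> ennreal (\<epsilon> * h)))"
proof -
  have \<tau>I: "\<tau> \<in> {0..T}" using \<tau> by simp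
  have s\<mu>[measurable_cong]: "sets \<mu> = sets borel" using \<mu> by (simp add: Pp_def)
  define K where "K = weight_norm p \<mu>"
  have K: "0 \<le> K" by (simp add: K_def weight_norm_nonneg)
  have M: "0 \<le> moment p \<mu>" by (simp add: moment_def)
  define k where "k = (\<lambda>t. (1 + moment p \<mu>) * m t + l t + K * L t)"
  have ki: "k absolutely_integrable_on {0..T}" unfolding k_def
    by (intro set_integral_add(1) set_integrable_mult_right L1_D(1) m l L)
  have k\<tau>: "0 \<le> k \<tau>" unfolding k_def
    using L1_D(2)[OF m \<tau>I] L1_D(2)[OF l \<tau>I] L1_D(2)[OF L \<tau>I] K M by simp
  have "upper_mean T k \<tau> (k \<tau>)" unfolding k_def
    using good \<tau> K M
    by (intro upper_mean_add upper_mean_cmult set_integral_add(1) set_integrable_mult_right L1_D(1) m l L)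
      (auto simp: countably_good_def)
  then obtain h1 where h1: "h1 > 0" "\<tau> + h1 \<le> T" "\<And>h. h \<in> {0..h1} \<Longrightarrow> integral {\<tau>..\<tau>+h} k \<le> (k \<tau> + 1) * h"
    unfolding upper_mean_def using zero_less_one by blast
  define k1 where "k1 = k \<tau> + 1"
  have k1: "1 \<le> k1" using k\<tau> by (simp add: k1_def)
  define c3 where "c3 = (3 * k1) powr p"
  have c3: "0 < c3" using k1 by (simp add: c3_def)
  have "0 < \<epsilon> powr p / (2 * c3)" using \<epsilon> c3 by simp
  then obtain R where R: "R > 0"
    "(\<integral>\<^sup>+x. ennreal ((1 + norm x) powr p * indicator {x. R < norm x} x) \<partial>\<mu>) \<le> ennreal (\<epsilon> powr p / (2 * c3))"
    using nn_integral_tail_small[OF integrable_one_plus_norm_powr[OF p \<mu>] _ s\<mu>] by auto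
  have "0 < \<epsilon> / 4" using \<epsilon> by simp
  from initial_selection[OF DP DZ \<tau> good \<mu> w this, of R]
  obtain v0 r c where v0: "\<And>t. t \<in> {0..T} \<Longrightarrow> v0 t \<in> V t \<mu>" "\<And>x. (\<lambda>t. v0 t x) \<in> borel_measurable \<I>"
    and ri: "r absolutely_integrable_on {0..T}" and c: "c < \<epsilon> / 4" "upper_mean T r \<tau> c"
    and rb: "\<And>t x. t \<in> {0..T} \<Longrightarrow> norm x \<le> R \<Longrightarrow> norm (v0 t x - w x) \<le> r t"
    by blast
  have "0 < \<epsilon> / 4 - c" using c by simp
  then obtain h2 where h2: "h2 > 0" "\<tau> + h2 \<le> T" "\<And>h. h \<in> {0..h2} \<Longrightarrow> integral {\<tau>..\<tau>+h} r \<le> (c + (\<epsilon> / 4 - c)) * h"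
    using c(2) unfolding upper_mean_def by blast
  define \<delta> where "\<delta> = min 1 (\<epsilon> / (4 * k1 * (1 + R)))"
  have \<delta>: "0 < \<delta>" "\<delta> \<le> 1" using \<epsilon> k1 R(1) by (auto simp: \<delta>_def)
  have \<delta>R: "\<delta> * (1 + R) * k1 \<le> \<epsilon> / 4"
  proof -
    have "\<delta> * ((1 + R) * k1) \<le> \<epsilon> / (4 * k1 * (1 + R)) * ((1 + R) * k1)"
      using k1 R(1) by (intro mult_right_mono) (auto simp: \<delta>_def)
    also have "\<dots> = \<epsilon> / 4"
    proof -
      have "k1 \<noteq> 0" "1 + R \<noteq> 0" using k1 R(1) by auto
      then show ?thesis by (simp add: divide_simps)
    qed
    finally show ?thesis by (simp add: mult.assoc)
  qed
  (* For h up to h3, exp (elapsed (\<tau> + h)) - 1 is at most \<delta>, as k1 bounds the mean speed of the clock. *)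
  define h3 where "h3 = ln (1 + \<delta>) / k1"
  have h3: "0 < h3" using \<delta> k1 by (simp add: h3_def)
  define h0 where "h0 = min h1 (min h2 h3)"
  have h0: "0 < h0" "\<tau> + h0 \<le> T" using h1 h2 h3 by (auto simp: h0_def)
  interpret S: inclusion_start p T V m l L \<tau> \<mu> v0
    by unfold_locales (use \<tau>I \<mu> v0 in auto)
  have S\<kappa>: "S.\<kappa> = k" by (simp add: S.\<kappa>_def[abs_def] k_def S.K0_def K_def)
  obtain X v where adm: "S.admissible X v" and pic: "\<And>t x. t \<in> {0..T} \<Longrightarrow> X t x = S.picard X v t x"
    and Xx: "\<And>t x. t \<in> {0..T} \<Longrightarrow> norm (X t x - x) \<le> (exp (S.elapsed t) - 1) * (1 + norm x)"
    and vv0: "\<And>t x. t \<in> {0..T} \<Longrightarrow> norm (v t x - v0 t x) \<le> L t * (K * (exp (S.elapsed t) - 1))"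
    using S.filippov_existence unfolding S.K0_def K_def by blast
  have motX: "S.motion X" using adm by (simp add: S.admissible_def)
  have estimate: "Wp p (S.law X (\<tau> + h)) (distr \<mu> borel (\<lambda>x. x + h *\<^sub>R w x)) \<le> ennreal (\<epsilon> * h)"
    if h: "h \<in> {0..h0}" for h
  proof -
    let ?J = "{\<tau>..\<tau>+h}"
    have hh: "0 \<le> h" "h \<le> h1" "h \<le> h2" "h \<le> h3" "\<tau> + h \<le> T" using h h0 by (auto simp: h0_def)
    have JI: "s \<in> {0..T}" if "s \<in> ?J" for s using that \<tau> hh by auto
    have Ik: "integral ?J k \<le> k1 * h" using h1(3)[of h] hh by (simp add: k1_def)
    have Ir: "integral ?J r \<le> \<epsilon> / 4 * h" using h2(3)[of h] hh by simp
    have kJ: "k absolutely_integrable_on ?J" using \<tau> hh by (intro absolutely_integrable_subinterval_real[OF ki]) auto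
    have rJ: "r absolutely_integrable_on ?J" using \<tau> hh by (intro absolutely_integrable_subinterval_real[OF ri]) auto
    have kJi: "k integrable_on ?J" and rJi: "r integrable_on ?J" using kJ rJ by (auto simp: absolutely_integrable_on_def)
    have Bs: "exp (S.elapsed s) - 1 \<le> \<delta>" if s: "s \<in> ?J" for s
    proof -
      have "S.elapsed s = integral {\<tau>..s} k"
        using S.accrued_increment[of \<tau> s] S.accrued_mono[of \<tau> s] s \<tau> hh by (simp add: S.elapsed_def S\<kappa>)
      also have "\<dots> \<le> k1 * (s - \<tau>)" using h1(3)[of "s - \<tau>"] s hh by (simp add: k1_def)
      also have "\<dots> \<le> k1 * h3" using s hh k1 by (intro mult_left_mono) auto
      also have "\<dots> = ln (1 + \<delta>)" using k1 by (simp add: h3_def)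
      finally have "exp (S.elapsed s) \<le> exp (ln (1 + \<delta>))" by simp
      then show ?thesis using \<delta> by simp
    qed
    have vel: "norm (v s (X s x) - w x) \<le> (\<delta> * (1 + norm x)) * k s + norm (v0 s x - w x)" if s: "s \<in> ?J" for s x
    proof -
      note sI = JI[OF s]
      have L0: "0 \<le> L s" and l0: "0 \<le> l s" and m0: "0 \<le> m s" using L1_D(2)[OF L sI] L1_D(2)[OF l sI] L1_D(2)[OF m sI] .
      have "norm (v s (X s x) - w x) \<le> norm (v s (X s x) - v0 s (X s x)) + norm (v0 s (X s x) - v0 s x) + norm (v0 s x - w x)"
        using norm_triangle_ineq[of "v s (X s x) - v0 s (X s x) + (v0 s (X s x) - v0 s x)" "v0 s x - w x"]
          norm_triangle_ineq[of "v s (X s x) - v0 s (X s x)" "v0 s (X s x) - v0 s x"] by simp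
      moreover have "norm (v s (X s x) - v0 s (X s x)) \<le> L s * (K * (\<delta> * (1 + norm x)))"
      proof -
        have "\<delta> * 1 \<le> \<delta> * (1 + norm x)" using \<delta> by (intro mult_left_mono) auto
        then have "exp (S.elapsed s) - 1 \<le> \<delta> * (1 + norm x)" using Bs[OF s] by linarith
        then have "L s * (K * (exp (S.elapsed s) - 1)) \<le> L s * (K * (\<delta> * (1 + norm x)))"
          using L0 K by (intro mult_left_mono) auto
        then show ?thesis using vv0[OF sI, of "X s x"] by linarith
      qed
      moreover have "norm (v0 s (X s x) - v0 s x) \<le> l s * (\<delta> * (1 + norm x))"
      proof -
        have "norm (v0 s (X s x) - v0 s x) \<le> l s * norm (X s x - x)"
          using lipschitz_onD[OF V_lip[OF sI \<mu> v0(1)[OF sI]], of "X s x" x] by (simp add: dist_norm)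
        also have "norm (X s x - x) \<le> \<delta> * (1 + norm x)"
          using Xx[OF sI, of x] mult_right_mono[OF Bs[OF s], of "1 + norm x"] by simp
        finally show ?thesis using l0 by (simp add: mult_left_mono)
      qed
      moreover have "L s * (K * (\<delta> * (1 + norm x))) + l s * (\<delta> * (1 + norm x)) \<le> (\<delta> * (1 + norm x)) * k s"
      proof -
        have "L s * (K * (\<delta> * (1 + norm x))) + l s * (\<delta> * (1 + norm x)) = (\<delta> * (1 + norm x)) * (l s + K * L s)"
          by (simp add: algebra_simps)
        also have "\<dots> \<le> (\<delta> * (1 + norm x)) * k s"
          using \<delta> m0 M by (intro mult_left_mono) (auto simp: k_def)
        finally show ?thesis .
      qed
      ultimately show ?thesis by linarith
    qed
    define Z where "Z = (\<lambda>x. X (\<tau> + h) x - (x + h *\<^sub>R w x))"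
    have fJ: "(\<lambda>s. v s (X s x) - w x) absolutely_integrable_on ?J" for x
    proof (rule set_integral_diff(1))
      show "(\<lambda>s. v s (X s x)) absolutely_integrable_on ?J"
        using \<tau> hh by (intro absolutely_integrable_subinterval_real[OF S.admissible_velocity_integrable[OF adm]]) auto
      show "(\<lambda>s. w x) absolutely_integrable_on ?J" by (simp flip: integrable_lebesgue_on_iff)
    qed
    have Z: "Z x = integral ?J (\<lambda>s. v s (X s x) - w x)" for x
    proof -
      have i: "(\<lambda>s. v s (X s x)) absolutely_integrable_on {0..T}" by (rule S.admissible_velocity_integrable[OF adm])
      have "X (\<tau> + h) x - x = integral ?J (\<lambda>s. v s (X s x))"
        using S.prim_diff[OF i, of \<tau> "\<tau> + h"] pic[of "\<tau> + h" x] \<tau> hh by (simp add: S.picard_def)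
      moreover have "(\<lambda>s. v s (X s x)) integrable_on ?J"
        using absolutely_integrable_subinterval_real[OF i, of \<tau> "\<tau> + h"] \<tau> hh by (auto simp: absolutely_integrable_on_def)
      then have "integral ?J (\<lambda>s. v s (X s x) - w x) = integral ?J (\<lambda>s. v s (X s x)) - h *\<^sub>R w x"
        using hh by (subst Henstock_Kurzweil_Integration.integral_diff) auto
      ultimately show ?thesis by (simp add: Z_def algebra_simps)
    qed
    have near: "norm (Z x) \<le> \<epsilon> / 2 * h" if x: "norm x \<le> R" for x
    proof -
      have "norm (Z x) \<le> integral ?J (\<lambda>s. (\<delta> * (1 + R)) * k s + r s)"
        unfolding Z
      proof (rule integral_norm_le[OF fJ])
        show "(\<lambda>s. (\<delta> * (1 + R)) * k s + r s) absolutely_integrable_on ?J"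
          by (intro set_integral_add(1) set_integrable_mult_right kJ rJ)
        fix s assume s: "s \<in> ?J"
        have "0 \<le> k s" using S.\<kappa>_nonneg[OF JI[OF s]] by (simp add: S\<kappa>)
        then have "(\<delta> * (1 + norm x)) * k s \<le> (\<delta> * (1 + R)) * k s"
          using x \<delta> by (intro mult_right_mono mult_left_mono) auto
        then show "norm (v s (X s x) - w x) \<le> (\<delta> * (1 + R)) * k s + r s"
          using vel[OF s, of x] rb[OF JI[OF s] x] by linarith
      qed
      also have "\<dots> = (\<delta> * (1 + R)) * integral ?J k + integral ?J r"
        using integrable_on_mult_right[OF kJi, of "\<delta> * (1 + R)"] rJi by (subst Henstock_Kurzweil_Integration.integral_add) auto
      also have "\<dots> \<le> (\<delta> * (1 + R)) * (k1 * h) + \<epsilon> / 4 * h"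
        using Ik Ir \<delta> R(1) by (intro add_mono mult_left_mono) auto
      also have "\<dots> = (\<delta> * (1 + R) * k1) * h + \<epsilon> / 4 * h" by simp
      also have "\<dots> \<le> \<epsilon> / 4 * h + \<epsilon> / 4 * h" using \<delta>R hh by (intro add_mono mult_right_mono) auto
      finally show ?thesis by simp
    qed
    have far: "norm (Z x) \<le> (3 * k1 * h) * (1 + norm x)" for x
    proof -
      have "norm (Z x) \<le> integral ?J (\<lambda>s. ((\<delta> + 1) * (1 + norm x)) * k s + k \<tau> * (1 + norm x))"
        unfolding Z
      proof (rule integral_norm_le[OF fJ])
        show "(\<lambda>s. ((\<delta> + 1) * (1 + norm x)) * k s + k \<tau> * (1 + norm x)) absolutely_integrable_on ?J"
          by (intro set_integral_add(1) set_integrable_mult_right kJ absolutely_integrable_const_real)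
        fix s assume s: "s \<in> ?J"
        have "norm (v0 s x - w x) \<le> norm (v0 s x) + norm (w x)" by (rule norm_triangle_ineq4)
        also have "\<dots> \<le> k s * (1 + norm x) + k \<tau> * (1 + norm x)"
          using S.initial_field_bound[OF JI[OF s] v0(1)[OF JI[OF s]], of x] S.initial_field_bound[OF \<tau>I w, of x]
          by (simp add: S\<kappa>)
        finally show "norm (v s (X s x) - w x) \<le> ((\<delta> + 1) * (1 + norm x)) * k s + k \<tau> * (1 + norm x)"
          using vel[OF s, of x] by (simp add: algebra_simps)
      qed
      also have "\<dots> = ((\<delta> + 1) * (1 + norm x)) * integral ?J k + h * (k \<tau> * (1 + norm x))"
        using integrable_on_mult_right[OF kJi, of "(\<delta> + 1) * (1 + norm x)"] hh
        by (subst Henstock_Kurzweil_Integration.integral_add) auto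
      also have "\<dots> \<le> (2 * (1 + norm x)) * (k1 * h) + h * (k1 * (1 + norm x))"
      proof (rule add_mono)
        have "0 \<le> integral ?J k"
          using kJi S.\<kappa>_nonneg JI by (intro Henstock_Kurzweil_Integration.integral_nonneg) (auto simp: S\<kappa>)
        then show "((\<delta> + 1) * (1 + norm x)) * integral ?J k \<le> (2 * (1 + norm x)) * (k1 * h)"
          using \<delta> Ik by (intro mult_mono) auto
        show "h * (k \<tau> * (1 + norm x)) \<le> h * (k1 * (1 + norm x))"
          using hh(1) by (intro mult_left_mono mult_right_mono) (auto simp: k1_def)
      qed
      finally show ?thesis by (simp add: algebra_simps)
    qed
    have meas: "X (\<tau> + h) \<in> borel_measurable \<mu>" "(\<lambda>x. x + h *\<^sub>R w x) \<in> borel_measurable \<mu>"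
    proof -
      show "X (\<tau> + h) \<in> borel_measurable \<mu>"
        using S.motion_measurable[OF motX, of "\<tau> + h"] hh \<tau> by (simp add: measurable_cong_sets[OF s\<mu> refl])
      have "continuous_on UNIV w" using V_lip[OF \<tau>I \<mu> w] by (rule lipschitz_on_continuous_on)
      then have "(\<lambda>x. x + h *\<^sub>R w x) \<in> borel_measurable borel"
        by (intro borel_measurable_continuous_onI continuous_intros)
      then show "(\<lambda>x. x + h *\<^sub>R w x) \<in> borel_measurable \<mu>" by (simp add: measurable_cong_sets[OF s\<mu> refl])
    qed
    have half: "(\<epsilon> / 2) powr p \<le> \<epsilon> powr p / 2"
    proof -
      have "(\<epsilon> / 2) powr p = \<epsilon> powr p * (1 / 2) powr p" using powr_mult[of \<epsilon> "1/2" p] by simp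
      also have "(1 / 2) powr p \<le> (1 / 2 :: real) powr 1" using p by (intro powr_mono') auto
      finally show ?thesis by (simp add: mult_left_mono)
    qed
    show ?thesis
      unfolding S.law_def
    proof (rule Wp_distr_le[OF p _ meas])
      show "prob_space \<mu>" using \<mu> by (simp add: Pp_def)
      interpret \<mu>: prob_space \<mu> by fact
      show "0 \<le> \<epsilon> * h" using \<epsilon> hh by simp
      let ?c = "h powr p * (\<epsilon> powr p / 2)"
      have "(\<integral>\<^sup>+ x. ennreal (norm (X (\<tau> + h) x - (x + h *\<^sub>R w x)) powr p) \<partial>\<mu>)
          \<le> (\<integral>\<^sup>+ x. ennreal ?c + ennreal (h powr p * c3) * ennreal ((1 + norm x) powr p * indicator {x. R < norm x} x) \<partial>\<mu>)"
      proof (rule nn_integral_mono)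
        fix x
        show "ennreal (norm (X (\<tau> + h) x - (x + h *\<^sub>R w x)) powr p)
          \<le> ennreal ?c + ennreal (h powr p * c3) * ennreal ((1 + norm x) powr p * indicator {x. R < norm x} x)"
        proof (cases "norm x \<le> R")
          case True
          have "norm (Z x) powr p \<le> (\<epsilon> / 2 * h) powr p" using near[OF True] p by (intro powr_mono2) auto
          also have "\<dots> = h powr p * (\<epsilon> / 2) powr p" using powr_mult[of "\<epsilon> / 2" h p] by (simp only: mult.commute)
          also have "\<dots> \<le> ?c" using half by (intro mult_left_mono) auto
          finally have "ennreal (norm (Z x) powr p) \<le> ennreal ?c" by (rule ennreal_leI)
          then show ?thesis unfolding Z_def by (rule add_increasing2[rotated]) simp
        next
          case False
          have "norm (Z x) powr p \<le> ((3 * k1 * h) * (1 + norm x)) powr p" using far[of x] p by (intro powr_mono2) auto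
          also have "\<dots> = (h powr p * c3) * (1 + norm x) powr p"
            unfolding c3_def by (simp only: powr_mult mult_ac)
          finally have "ennreal (norm (Z x) powr p) \<le> ennreal ((h powr p * c3) * (1 + norm x) powr p)" by (rule ennreal_leI)
          also have "\<dots> = ennreal (h powr p * c3) * ennreal ((1 + norm x) powr p * indicator {x. R < norm x} x)"
            using False c3 by (simp add: ennreal_mult less_imp_le)
          finally show ?thesis unfolding Z_def by (rule add_increasing[rotated]) simp
        qed
      qed
      also have "\<dots> = (\<integral>\<^sup>+ x. ennreal ?c \<partial>\<mu>) + (\<integral>\<^sup>+ x. ennreal (h powr p * c3) * ennreal ((1 + norm x) powr p * indicator {x. R < norm x} x) \<partial>\<mu>)"
        by (rule nn_integral_add) measurable
      also have "(\<integral>\<^sup>+ x. ennreal (h powr p * c3) * ennreal ((1 + norm x) powr p * indicator {x. R < norm x} x) \<partial>\<mu>)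
          = ennreal (h powr p * c3) * (\<integral>\<^sup>+ x. ennreal ((1 + norm x) powr p * indicator {x. R < norm x} x) \<partial>\<mu>)"
        by (rule nn_integral_cmult) measurable
      also have "(\<integral>\<^sup>+ x. ennreal ?c \<partial>\<mu>) = ennreal ?c" by (simp add: \<mu>.emeasure_space_1)
      also have "ennreal (h powr p * c3) * (\<integral>\<^sup>+ x. ennreal ((1 + norm x) powr p * indicator {x. R < norm x} x) \<partial>\<mu>)
          \<le> ennreal (h powr p * c3) * ennreal (\<epsilon> powr p / (2 * c3))" using R(2) by (intro mult_left_mono) auto
      also have "ennreal (h powr p * c3) * ennreal (\<epsilon> powr p / (2 * c3)) = ennreal ?c"
        using c3 by (subst ennreal_mult[symmetric]) (auto simp: field_simps)
      also have "ennreal ?c + ennreal ?c = ennreal ((\<epsilon> * h) powr p)"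
        by (subst ennreal_plus[symmetric]) (auto simp: powr_mult mult.commute)
      finally show "(\<integral>\<^sup>+ x. ennreal (norm (X (\<tau> + h) x - (x + h *\<^sub>R w x)) powr p) \<partial>\<mu>) \<le> ennreal ((\<epsilon> * h) powr p)"
        by (simp add: add_left_mono)
    qed
  qed
  show ?thesis
    using S.law_solution[OF adm pic] estimate h0 by (intro exI[of _ h0] conjI exI[of _ "S.law X"] exI[of _ v]) auto
qed

end

lemma closedin_cc_zero: "closedin cc_topology {\<lambda>x. 0}"
proof -
  have "(\<lambda>x. 0) \<in> C0" by (simp add: C0_def)
  then show ?thesis
    using closedin_Hausdorff_singleton[OF cc.Hausdorff_space_mtopology] by (simp add: mtopology_cc)
qed

theorem theorem3p1:
  fixes p T :: real
    and V :: "real \<Rightarrow> (real ^ 'd) measure \<Rightarrow> (real ^ 'd \<Rightarrow> real ^ 'd) set"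
  assumes "1 \<le> p" and "0 < T" and "hypotheses_CI p T V"
  shows "\<exists>\<T>\<subseteq>{0<..<T}. \<T> \<in> sets lebesgue \<and> {0<..<T} - \<T> \<in> null_sets lebesgue \<and>
    (\<forall>\<tau>\<in>\<T>. \<forall>\<mu>\<^sub>\<tau>\<in>Pp p. \<forall>v\<^sub>\<tau>\<in>V \<tau> \<mu>\<^sub>\<tau>. \<forall>\<epsilon>>0.
      \<exists>h\<^sub>\<epsilon>>0. \<tau> + h\<^sub>\<epsilon> \<le> T \<and>
        (\<exists>\<mu>\<^sub>\<epsilon>\<in>solutions p T V \<tau> \<mu>\<^sub>\<tau>. \<forall>h\<in>{0..h\<^sub>\<epsilon>}.
          Wp p (\<mu>\<^sub>\<epsilon> (\<tau> + h)) (distr \<mu>\<^sub>\<tau> borel (\<lambda>x. x + h *\<^sub>R v\<^sub>\<tau> x)) \<le> ennreal (\<epsilon> * h)))"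
proof -
  have CI: "\<And>\<mu>. \<mu> \<in> Pp p \<Longrightarrow> setvalued_measurable T (\<lambda>t. V t \<mu>)"
    "\<And>\<mu> t. \<mu> \<in> Pp p \<Longrightarrow> t \<in> {0..T} \<Longrightarrow> closedin cc_topology (V t \<mu>)"
    "\<And>\<mu> t. \<mu> \<in> Pp p \<Longrightarrow> t \<in> {0..T} \<Longrightarrow> V t \<mu> \<noteq> {}"
    using assms(3) unfolding hypotheses_CI_def by blast+
  obtain m l L where m: "m \<in> L1_nonneg T" and l: "l \<in> L1_nonneg T" and L: "L \<in> L1_nonneg T"
    and aem: "AE t in lebesgue_on {0..T}. \<forall>\<mu>\<in>Pp p. \<forall>v\<in>V t \<mu>. \<forall>x. norm (v x) \<le> m t * (1 + norm x + moment p \<mu>)"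
    and ael: "AE t in lebesgue_on {0..T}. \<forall>\<mu>\<in>Pp p. \<forall>v\<in>V t \<mu>. (l t)-lipschitz_on UNIV v"
    and aeL: "AE t in lebesgue_on {0..T}. \<forall>\<mu>\<in>Pp p. \<forall>\<nu>\<in>Pp p. \<forall>v\<in>V t \<mu>. \<exists>w\<in>V t \<nu>. d_sup v w \<le> ennreal (L t) * Wp p \<mu> \<nu>"
    using assms(3) unfolding hypotheses_CI_def by blast
  define good where "good = (\<lambda>t. (\<forall>\<mu>\<in>Pp p. \<forall>v\<in>V t \<mu>. \<forall>x. norm (v x) \<le> m t * (1 + norm x + moment p \<mu>)) \<and>
    (\<forall>\<mu>\<in>Pp p. \<forall>v\<in>V t \<mu>. (l t)-lipschitz_on UNIV v) \<and>
    (\<forall>\<mu>\<in>Pp p. \<forall>\<nu>\<in>Pp p. \<forall>v\<in>V t \<mu>. \<exists>w\<in>V t \<nu>. d_sup v w \<le> ennreal (L t) * Wp p \<mu> \<nu>))"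
  have aeg: "AE t in lebesgue_on {0..T}. good t"
    using aem ael aeL unfolding good_def by eventually_elim blast
  then have "AE t in lebesgue. t \<in> {0..T} \<longrightarrow> good t" by (subst (asm) AE_restrict_space_iff) auto
  then obtain N where N: "{t. \<not> (t \<in> {0..T} \<longrightarrow> good t)} \<subseteq> N" "N \<in> null_sets lebesgue"
    by (auto simp: eventually_ae_filter)
  have Nn: "negligible N" using N(2) by (simp add: negligible_iff_null_sets)
  have gd: "good t" if "t \<in> {0..T}" "t \<notin> N" for t using that N(1) by blast
  (* On the exceptional times the zero field satisfies every bound. *)
  define V' where "V' = (\<lambda>t \<mu>. if t \<in> N then {\<lambda>x. 0} else V t \<mu>)"
  interpret V': lipschitz_inclusion p T V' m l L
  proof
    show "1 \<le> p" "0 < T" "m \<in> L1_nonneg T" "l \<in> L1_nonneg T" "L \<in> L1_nonneg T" using assms m l L by auto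
  next
    fix \<mu> :: "(real ^ 'd) measure" assume \<mu>: "\<mu> \<in> Pp p"
    show "setvalued_measurable T (\<lambda>t. V' t \<mu>)"
      unfolding setvalued_measurable_def
    proof (intro allI impI)
      fix U :: "(real ^ 'd \<Rightarrow> real ^ 'd) set" assume U: "openin cc_topology U"
      have "{t\<in>{0..T}. V t \<mu> \<inter> U \<noteq> {}} \<in> sets lebesgue" using CI(1)[OF \<mu>] U unfolding setvalued_measurable_def by blast
      moreover have "N \<in> sets lebesgue" "(if (\<lambda>x. 0) \<in> U then N \<inter> {0..T} else {}) \<in> sets lebesgue" using N(2) by auto
      moreover have "{t\<in>{0..T}. V' t \<mu> \<inter> U \<noteq> {}} = ({t\<in>{0..T}. V t \<mu> \<inter> U \<noteq> {}} - N) \<union> (if (\<lambda>x. 0) \<in> U then N \<inter> {0..T} else {})"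
        by (auto simp: V'_def)
      ultimately show "{t\<in>{0..T}. V' t \<mu> \<inter> U \<noteq> {}} \<in> sets lebesgue" by auto
    qed
  next
    fix t :: real and \<mu> :: "(real ^ 'd) measure" assume t: "t \<in> {0..T}" and \<mu>: "\<mu> \<in> Pp p"
    show "closedin cc_topology (V' t \<mu>)" using CI(2)[OF \<mu> t] by (simp add: V'_def closedin_cc_zero)
    show "V' t \<mu> \<noteq> {}" using CI(3)[OF \<mu> t] by (simp add: V'_def)
    have nn: "0 \<le> m t" "0 \<le> l t" using m l t by (auto simp: L1_nonneg_def)
    have M: "0 \<le> moment p \<mu>" by (simp add: moment_def)
    fix v assume v: "v \<in> V' t \<mu>"
    show "norm (v x) \<le> m t * (1 + norm x + moment p \<mu>)" for x
      using v gd[OF t] \<mu> nn M unfolding good_def V'_def by (auto split: if_splits)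
    show "(l t)-lipschitz_on UNIV v"
      using v gd[OF t] \<mu> nn unfolding good_def V'_def by (auto split: if_splits intro: lipschitz_on_mono[OF lipschitz_on_constant])
    fix \<nu> :: "(real ^ 'd) measure" assume \<nu>: "\<nu> \<in> Pp p"
    show "\<exists>w\<in>V' t \<nu>. d_sup v w \<le> ennreal (L t) * Wp p \<mu> \<nu>"
      using v gd[OF t] \<mu> \<nu> unfolding good_def V'_def by (auto split: if_splits simp: sup_dist_def)
  qed
  obtain DP :: "(real ^ 'd) measure set" where DP: "countable DP" "DP \<subseteq> Pp p"
    "\<And>\<mu> e. \<mu> \<in> Pp p \<Longrightarrow> 0 < e \<Longrightarrow> \<exists>\<nu>\<in>DP. Wp p \<mu> \<nu> \<le> ennreal e"
    using Pp_separable[OF assms(1)] by metis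
  obtain DZ :: "(nat \<Rightarrow> real ^ 'd) set" where DZ: "countable DZ" "\<And>X. open X \<Longrightarrow> X \<noteq> {} \<Longrightarrow> \<exists>z\<in>DZ. z \<in> X"
    using countable_dense_setE[where 'a="nat \<Rightarrow> real ^ 'd"] by blast
  obtain Z where Z: "negligible Z" "\<And>\<tau>. \<tau> \<in> {0<..<T} - Z \<Longrightarrow> V'.countably_good DP DZ \<tau>"
    using V'.countably_good_ae[OF DP(1,2) DZ(1)] by blast
  have NZ: "negligible (N \<union> Z)" using Nn Z(1) by (rule negligible_Un)
  show ?thesis
  proof (intro exI[of _ "{0<..<T} - (N \<union> Z)"] conjI ballI allI impI)
    show "{0<..<T} - (N \<union> Z) \<in> sets lebesgue" using NZ by (intro sets.Diff) (auto simp: negligible_imp_sets)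
    have "negligible ({0<..<T} - ({0<..<T} - (N \<union> Z)))" by (rule negligible_subset[OF NZ]) auto
    then show "{0<..<T} - ({0<..<T} - (N \<union> Z)) \<in> null_sets lebesgue" by (simp add: negligible_iff_null_sets)
    fix \<tau> \<mu> w and \<epsilon> :: real
    assume \<tau>: "\<tau> \<in> {0<..<T} - (N \<union> Z)" and \<mu>: "\<mu> \<in> Pp p" and w: "w \<in> V \<tau> \<mu>" and \<epsilon>: "0 < \<epsilon>"
    have w': "w \<in> V' \<tau> \<mu>" using w \<tau> by (simp add: V'_def)
    have \<tau>': "0 < \<tau>" "\<tau> < T" "V'.countably_good DP DZ \<tau>" using \<tau> Z(2) by auto
    obtain h0 \<mu>c v where h0: "h0 > 0" "\<tau> + h0 \<le> T" and sol: "\<mu>c \<in> AC_curves p T" "\<mu>c \<tau> = \<mu>" "field_measurable T v"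
      "\<And>t. t \<in> {0..T} \<Longrightarrow> v t \<in> V' t (\<mu>c t)" "continuity_equation T v \<mu>c"
      and est: "\<And>h. h \<in> {0..h0} \<Longrightarrow> Wp p (\<mu>c (\<tau> + h)) (distr \<mu> borel (\<lambda>x. x + h *\<^sub>R w x)) \<le> ennreal (\<epsilon> * h)"
      using V'.solution_with_initial_velocity[OF DP(2,3) DZ(2) \<tau>' \<mu> w' \<epsilon>] by blast
    have "AE t in lebesgue. t \<notin> N" using N(2) by (rule AE_not_in)
    moreover have "v t \<in> V t (\<mu>c t)" if "t \<in> {0..T}" "t \<notin> N" for t
      using sol(4)[OF that(1)] that(2) by (simp add: V'_def)
    ultimately have "AE t in lebesgue. t \<in> {0..T} \<longrightarrow> v t \<in> V t (\<mu>c t)" by (auto elim!: eventually_mono)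
    then have "AE t in lebesgue_on {0..T}. v t \<in> V t (\<mu>c t)" by (subst AE_restrict_space_iff) auto
    then have "\<mu>c \<in> solutions p T V \<tau> \<mu>" using sol unfolding solutions_def by blast
    then show "\<exists>h\<^sub>\<epsilon>>0. \<tau> + h\<^sub>\<epsilon> \<le> T \<and>
        (\<exists>\<mu>\<^sub>\<epsilon>\<in>solutions p T V \<tau> \<mu>. \<forall>h\<in>{0..h\<^sub>\<epsilon>}.
          Wp p (\<mu>\<^sub>\<epsilon> (\<tau> + h)) (distr \<mu> borel (\<lambda>x. x + h *\<^sub>R w x)) \<le> ennreal (\<epsilon> * h))"
      using h0 est by blast
  qed auto
qed

end
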